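(* Let $D\subset\mathbb{R}^n$ be a domain, let $E=D\times\mathbb{R}^r$ be the trivial real vector bundle over $D$, and let $g:D\to\mathrm{Sym}^+_r(\mathbb{R})$ be a $C^2$ Riemannian metric on $E$. Fix an integer $1\le q\le n$. Suppose that for every smooth strictly convex function $\psi$ on $\mathbb{R}^n$ and every $d$-closed $E$-valued $q$-form with compact support $f\in\wedge^q_c(D,E)$, $df=0$, there exists $u\in L^2_{q-1}(D,E)$ with $du=f$ (in the sense of distributions) and $$\int_D\langle u,u\rangle_g\,e^{-\psi}\,d\lambda\le\int_D\langle \mathrm{Hess}_\psi^{-1}f,f\rangle_g\,e^{-\psi}\,d\lambda,$$ whenever the right-hand side is finite. Then $(E,g)$ is Nakano $q$-semipositive.
   Context: An $E$-valued $q$-form is written $\alpha=\sum_{\tau=1}^r\big(\sum_{|I|=q}\alpha_{I,\tau}dx_I\big)\otimes e_\tau$, where $e_1,\dots,e_r$ is the standard frame of $E$ with $\langle e_\tau,e_\xi\rangle=g_{\tau\xi}$; the pointwise inner product is $\langle\alpha,\beta\rangle_g=\sum_{\tau,\xi}\sum_I\alpha_{I,\tau}\beta_{I,\xi}g_{\tau\xi}$, and $L^2_{q-1}(D,E)$ is the completion of the space of smooth $E$-valued $(q-1)$-forms with respect to $\int_D\langle\cdot,\cdot\rangle_g\,d\lambda$ ($d\lambda$ Lebesgue measure). For a smooth function $\psi$, $\mathrm{Hess}_\psi=\sum_{i,j=1}^n\frac{\partial^2\psi}{\partial x_i\partial x_j}\,dx_i\wedge\big(\frac{\partial}{\partial x_j}\lrcorner\,\cdot\big)$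 acting on $E$-valued $q$-forms (positive definite, hence invertible, when $\psi$ is strictly convex). The curvature operator of $g$ is $\Theta_E=-\sum_{i,j=1}^n\frac{\partial}{\partial x_i}\big(g^{-1}\frac{\partial g}{\partial x_j}\big)\,dx_i\wedge\big(\frac{\partial}{\partial x_j}\lrcorner\,\cdot\big)$, the matrix $\frac{\partial}{\partial x_i}(g^{-1}\partial_{x_j}g)$ acting on the fiber coefficients. $(E,g)$ is Nakano $q$-semipositive if $\langle\Theta_E\alpha,\alpha\rangle_g\ge0$ at every point of $D$ for every $E$-valued $q$-form $\alpha$. *)

theory Defs
  imports "HOL-Analysis.Analysis"
begin

text \<open>Points of R^n are vectors real^'n, with 'n a finite linearly ordered index type
  (CARD('n) = n).  The fiber R^r is indexed by a finite type 'r.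
  A (fiber-valued) multi-form at a point is a function 'n set => 'r => real:
  the value at (I, tau) is the coefficient alpha_{I,tau} of dx_I (x) e_tau, where dx_I
  is the wedge of dx_i, i in I, in increasing order.  A q-form has zero coefficients at
  all I with card I ~= q.\<close>

definition pd :: "'n::finite \<Rightarrow> (real^'n \<Rightarrow> real) \<Rightarrow> real^'n \<Rightarrow> real" where
  "pd j f x = frechet_derivative f (at x) (axis j 1)"

fun Ck :: "nat \<Rightarrow> (real^'n::finite) set \<Rightarrow> (real^'n \<Rightarrow> real) \<Rightarrow> bool" where
  "Ck 0 S f = continuous_on S f"
| "Ck (Suc k) S f = (f differentiable_on S \<and> (\<forall>j. Ck k S (pd j f)))"

definition smooth_on :: "(real^'n::finite) set \<Rightarrow> (real^'n \<Rightarrow> real) \<Rightarrow> bool" where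
  "smooth_on S f = (\<forall>k. Ck k S f)"

definition strictly_convex :: "(real^'n::finite \<Rightarrow> real) \<Rightarrow> bool" where
  "strictly_convex f = (\<forall>x y (t::real). x \<noteq> y \<and> 0 < t \<and> t < 1 \<longrightarrow>
      f ((1 - t) *\<^sub>R x + t *\<^sub>R y) < (1 - t) * f x + t * f y)"

definition is_form :: "nat \<Rightarrow> ('n set \<Rightarrow> 'r \<Rightarrow> real) \<Rightarrow> bool" where
  "is_form q \<alpha> = (\<forall>I \<tau>. card I \<noteq> q \<longrightarrow> \<alpha> I \<tau> = 0)"

text \<open>sign (-1)^#{k in K. k < i}: dx_i wedge dx_K = eps i K dx_{K+{i}} for i not in K\<close>
definition eps :: "'n::linorder \<Rightarrow> 'n set \<Rightarrow> real" where
  "eps i K = (-1) ^ card {k\<in>K. k < i}"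

definition inner_g :: "nat \<Rightarrow> real^'r^'r \<Rightarrow> ('n::finite set \<Rightarrow> 'r::finite \<Rightarrow> real)
    \<Rightarrow> ('n set \<Rightarrow> 'r \<Rightarrow> real) \<Rightarrow> real" where
  "inner_g q G \<alpha> \<beta> = (\<Sum>I\<in>{I. card I = q}. \<Sum>\<tau>\<in>UNIV. \<Sum>\<xi>\<in>UNIV. \<alpha> I \<tau> * \<beta> I \<xi> * G $ \<tau> $ \<xi>)"

text \<open>The operator  sum_{i,j} c_{ij} dx_i wedge (d/dx_j contract .)  on fiber-valued q-forms,
  where each c_{ij} is an r x r matrix (c i j tau xi) acting on the fiber coefficients.\<close>
definition form_op :: "('n::{finite,linorder} \<Rightarrow> 'n \<Rightarrow> 'r \<Rightarrow> 'r \<Rightarrow> real) \<Rightarrow> nat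
    \<Rightarrow> ('n set \<Rightarrow> 'r::finite \<Rightarrow> real) \<Rightarrow> ('n set \<Rightarrow> 'r \<Rightarrow> real)" where
  "form_op c q \<alpha> J \<tau> = (if card J = q then
     (\<Sum>i\<in>J. \<Sum>j\<in>UNIV - (J - {i}). \<Sum>\<xi>\<in>UNIV.
        c i j \<tau> \<xi> * eps i (J - {i}) * eps j (J - {i}) * \<alpha> (insert j (J - {i})) \<xi>)
     else 0)"

definition hess_coef :: "(real^'n::finite \<Rightarrow> real) \<Rightarrow> real^'n \<Rightarrow> 'n \<Rightarrow> 'n \<Rightarrow> 'r \<Rightarrow> 'r \<Rightarrow> real" where
  "hess_coef \<psi> x i j \<tau> \<xi> = pd i (pd j \<psi>) x * (if \<tau> = \<xi> then 1 else 0)"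

definition hess_inv :: "(real^('n::{finite,linorder}) \<Rightarrow> real) \<Rightarrow> nat \<Rightarrow> real^('n::{finite,linorder})
    \<Rightarrow> ('n set \<Rightarrow> 'r::finite \<Rightarrow> real) \<Rightarrow> ('n set \<Rightarrow> 'r \<Rightarrow> real)" where
  "hess_inv \<psi> q x \<alpha> = (THE \<beta> :: 'n set \<Rightarrow> 'r \<Rightarrow> real. is_form q \<beta> \<and> form_op (hess_coef \<psi> x) q \<beta> = \<alpha>)"

definition curv_coef :: "(real^'n::finite \<Rightarrow> real^'r::finite^'r) \<Rightarrow> real^'n
    \<Rightarrow> 'n \<Rightarrow> 'n \<Rightarrow> 'r \<Rightarrow> 'r \<Rightarrow> real" where
  "curv_coef g x i j \<tau> \<xi> =
     - pd i (\<lambda>y. (matrix_inv (g y) ** (\<chi> a b. pd j (\<lambda>z. g z $ a $ b) y)) $ \<tau> $ \<xi>) x"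

definition nakano_q_semipositive :: "(real^('n::{finite,linorder})) set
    \<Rightarrow> (real^('n::{finite,linorder}) \<Rightarrow> real^'r::finite^'r) \<Rightarrow> nat \<Rightarrow> bool" where
  "nakano_q_semipositive D g q = (\<forall>x\<in>D. \<forall>\<alpha> :: 'n set \<Rightarrow> 'r \<Rightarrow> real. is_form q \<alpha> \<longrightarrow>
      inner_g q (g x) (form_op (curv_coef g x) q \<alpha>) \<alpha> \<ge> 0)"

definition dform :: "nat \<Rightarrow> (real^('n::{finite,linorder}) \<Rightarrow> 'n set \<Rightarrow> 'r \<Rightarrow> real)
    \<Rightarrow> real^('n::{finite,linorder}) \<Rightarrow> 'n set \<Rightarrow> 'r \<Rightarrow> real" where
  "dform q \<alpha> x J \<tau> = (if card J = q + 1 then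
      (\<Sum>j\<in>J. eps j (J - {j}) * pd j (\<lambda>y. \<alpha> y (J - {j}) \<tau>) x) else 0)"

definition compact_supp_in :: "(real^'n::finite) set \<Rightarrow> (real^'n \<Rightarrow> 'b::zero) \<Rightarrow> bool" where
  "compact_supp_in D f = (\<exists>K. compact K \<and> K \<subseteq> D \<and> (\<forall>x. x \<notin> K \<longrightarrow> f x = 0))"

definition closed_test_form :: "(real^('n::{finite,linorder})) set \<Rightarrow> nat
    \<Rightarrow> (real^('n::{finite,linorder}) \<Rightarrow> 'n set \<Rightarrow> 'r::finite \<Rightarrow> real) \<Rightarrow> bool" where
  "closed_test_form D q f = ((\<forall>x. is_form q (f x)) \<and>
      (\<forall>I \<tau>. smooth_on UNIV (\<lambda>x. f x I \<tau>)) \<and>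
      (\<exists>K. compact K \<and> K \<subseteq> D \<and> (\<forall>x I \<tau>. x \<notin> K \<longrightarrow> f x I \<tau> = 0)) \<and>
      (\<forall>x\<in>D. \<forall>J \<tau>. dform q f x J \<tau> = 0))"

definition L2_forms :: "(real^'n::finite) set \<Rightarrow> (real^'n \<Rightarrow> real^'r::finite^'r) \<Rightarrow> nat
    \<Rightarrow> (real^'n \<Rightarrow> 'n set \<Rightarrow> 'r \<Rightarrow> real) \<Rightarrow> bool" where
  "L2_forms D g p u = ((\<forall>x. is_form p (u x)) \<and>
      (\<forall>I \<tau>. (\<lambda>x. u x I \<tau>) \<in> borel_measurable lborel) \<and>
      set_integrable lborel D (\<lambda>x. inner_g p (g x) (u x) (u x)))"

definition weak_d_eq :: "(real^('n::{finite,linorder})) set \<Rightarrow> nat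
    \<Rightarrow> (real^('n::{finite,linorder}) \<Rightarrow> 'n set \<Rightarrow> 'r \<Rightarrow> real) \<Rightarrow> (real^('n::{finite,linorder}) \<Rightarrow> 'n set \<Rightarrow> 'r \<Rightarrow> real) \<Rightarrow> bool" where
  "weak_d_eq D q u f = (\<forall>\<phi>. smooth_on UNIV \<phi> \<and> compact_supp_in D \<phi> \<longrightarrow>
      (\<forall>J \<tau>. card J = q \<longrightarrow>
        (LINT x:D|lborel. f x J \<tau> * \<phi> x) =
        - (LINT x:D|lborel. (\<Sum>j\<in>J. eps j (J - {j}) * u x (J - {j}) \<tau> * pd j \<phi> x))))"

definition pos_def_hessian :: "(real^'n::finite \<Rightarrow> real) \<Rightarrow> bool" where
  "pos_def_hessian \<psi> = (\<forall>x (v::real^'n). v \<noteq> 0 \<longrightarrow>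
      (\<Sum>i\<in>UNIV. \<Sum>j\<in>UNIV. pd i (pd j \<psi>) x * v $ i * v $ j) > 0)"

definition riemannian_metric_C2 :: "(real^'n::finite) set \<Rightarrow> (real^'n \<Rightarrow> real^'r::finite^'r) \<Rightarrow> bool" where
  "riemannian_metric_C2 D g = ((\<forall>a b. Ck 2 D (\<lambda>x. g x $ a $ b)) \<and>
      (\<forall>x\<in>D. transpose (g x) = g x \<and>
         (\<forall>v::real^'r. v \<noteq> 0 \<longrightarrow> v \<bullet> (g x *v v) > 0)))"

end

(*
The weights psi(x) = s |x - x0|^2 have Hess_psi^(-1) f = f / (2 s q), and one lets s tend to infinity.
Given a constant q-form xi, take for f the exterior derivative of a cut-off times the Euler
primitive of xi: it is closed, compactly supported and equal to xi near x0.  Testing du = f against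
the form (g f) exp (- psi) and using Cauchy-Schwarz together with the L^2 estimate gives
  2 s q * Int <f,f> exp (- psi)  <=  Int <h,h> exp (- psi),
where h is the formal adjoint of d applied to f.  Integrating by parts (a Bochner identity) turns
this into 0 <= Int (2 s Z + T) exp (- psi), with Z, T continuous and compactly supported, Z = 0 near
x0 and T(x0) = <Theta xi, xi>.  Gaussian concentration at x0 yields T(x0) >= 0.
*)
theory Submission
  imports Defs
begin

subsection \<open>Partial derivatives and the classes C^k\<close>

text \<open>A cut-off multiple of a constant form is not closed; cutting off a primitive instead
  keeps \<open>f\<close> exact. The price is that \<open>f\<close> is uncontrolled between the two
  radii, so the terms of order s have no sign in general. It suffices that they vanish near the
  centre, since farther out the factor s loses against the Gaussian decay. The constant in the
  estimate has to be sharp. The quantity 2 s q Int <f,f> exp (- \<psi>) reappears with the same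
  factor when the integral of <h,h> is integrated by parts, because sum_i dx_i wedge (d/dx_i
  contract .) multiplies q-forms by q. The two copies cancel exactly, and only therefore does the
  curvature, which is of order 1 in s, stay visible. The metric is merely C^2, so the form tested
  against du = f is not smooth, whereas the weak equation speaks of smooth test functions. Hence the
  mollification, and the comparison of \<open>g\<close> with the Euclidean metric on compact sets,
  which makes the coefficients of u locally integrable. What is built from \<open>g\<close> carries
  a factor of compact support and is extended by zero, so that integration by parts takes place on
  the whole space.\<close>

lemma pd_has_derivative:
  assumes "(f has_derivative f') (at x)"
  shows "pd j f x = f' (axis j 1)"
  using frechet_derivative_at[OF assms] by (simp add: pd_def)

lemma pd_cong_open:
  assumes "open S" "x \<in> S" "\<And>y. y \<in> S \<Longrightarrow> f y = g y"
  shows "pd j f x = pd j g x"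
proof -
  have "(f has_derivative f') (at x) \<longleftrightarrow> (g has_derivative f') (at x)" for f'
    using has_derivative_transform_within_open[of f f' x UNIV S g]
      has_derivative_transform_within_open[of g f' x UNIV S f] assms by auto
  then show ?thesis by (simp add: pd_def frechet_derivative_def)
qed

lemma pd_const [simp]: "pd j (\<lambda>x. c) x = 0"
  using pd_has_derivative[OF has_derivative_const[of c "at x"]] by simp

lemma has_derivative_component: "((\<lambda>x. x $ i) has_derivative (\<lambda>h. h $ i)) (at x)"
  by (rule bounded_linear.has_derivative[OF bounded_linear_vec_nth has_derivative_ident])

lemma pd_component: "pd j (\<lambda>x. x $ i) x = (if i = j then 1 else 0)"
  by (subst pd_has_derivative[OF has_derivative_component]) (simp add: axis_def)

lemma pd_add:
  assumes "f differentiable (at x)" "g differentiable (at x)"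
  shows "pd j (\<lambda>x. f x + g x) x = pd j f x + pd j g x"
  using pd_has_derivative[OF has_derivative_add[OF frechet_derivative_works[THEN iffD1, OF assms(1)]
        frechet_derivative_works[THEN iffD1, OF assms(2)]]]
  by (simp add: pd_def)

lemma pd_mult:
  assumes "f differentiable (at x)" "g differentiable (at x)"
  shows "pd j (\<lambda>x. f x * g x) x = f x * pd j g x + pd j f x * g x"
  using pd_has_derivative[OF has_derivative_mult[OF frechet_derivative_works[THEN iffD1, OF assms(1)]
        frechet_derivative_works[THEN iffD1, OF assms(2)]]]
  by (simp add: pd_def)

lemma pd_cmult:
  assumes "f differentiable (at x)"
  shows "pd j (\<lambda>x. c * f x) x = c * pd j f x"
  using pd_mult[of "\<lambda>_. c" x f j] assms by simp

lemma pd_sum: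
  assumes "\<And>i. i \<in> I \<Longrightarrow> f i differentiable (at x)"
  shows "pd j (\<lambda>x. \<Sum>i\<in>I. f i x) x = (\<Sum>i\<in>I. pd j (f i) x)"
proof (cases "finite I")
  case True
  then show ?thesis using assms
  proof (induction I)
    case (insert a I)
    have "(\<lambda>x. \<Sum>i\<in>I. f i x) differentiable (at x)"
      using insert by (intro differentiable_sum) auto
    with insert show ?case by (simp add: pd_add)
  qed simp
qed simp

lemma pd_sum_sum:
  assumes "finite J" "\<And>i k. f i k differentiable (at x)"
  shows "pd j (\<lambda>x. \<Sum>i\<in>I. \<Sum>k\<in>J. f i k x) x = (\<Sum>i\<in>I. \<Sum>k\<in>J. pd j (f i k) x)"
proof -
  have "(\<lambda>x. \<Sum>k\<in>J. f i k x) differentiable (at x)" for i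
    using assms by (intro differentiable_sum) auto
  then show ?thesis using assms(2) by (simp add: pd_sum)
qed

lemma pd_compose:
  assumes "(h has_real_derivative h') (at (f x))" "f differentiable (at x)"
  shows "pd j (\<lambda>x. h (f x)) x = h' * pd j f x"
proof -
  have "((\<lambda>x. h (f x)) has_derivative (\<lambda>v. h' * frechet_derivative f (at x) v)) (at x)"
    using diff_chain_at[OF frechet_derivative_works[THEN iffD1, OF assms(2)]
        assms(1)[unfolded has_field_derivative_def]] by (simp add: o_def)
  from pd_has_derivative[OF this] show ?thesis by (simp add: pd_def)
qed

lemma frechet_derivative_eq_sum_pd:
  assumes "f differentiable (at x)"
  shows "frechet_derivative f (at x) v = (\<Sum>j\<in>UNIV. v $ j * pd j f x)"
proof -
  interpret linear "frechet_derivative f (at x)"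
    using assms by (rule linear_frechet_derivative)
  have "frechet_derivative f (at x) v = frechet_derivative f (at x) (\<Sum>j\<in>UNIV. v $ j *\<^sub>R axis j 1)"
    by (simp add: basis_expansion scalar_mult_eq_scaleR[symmetric])
  also have "\<dots> = (\<Sum>j\<in>UNIV. v $ j * pd j f x)"
    by (simp add: sum scale pd_def)
  finally show ?thesis .
qed

section \<open>Closure properties of the classes C^k\<close>

lemma Ck_cong:
  assumes "open S" "\<And>x. x \<in> S \<Longrightarrow> f x = g x"
  shows "Ck k S f = Ck k S g"
  using assms(2)
proof (induction k arbitrary: f g)
  case 0
  then show ?case by (simp cong: continuous_on_cong)
next
  case (Suc k)
  have "f differentiable_on S \<longleftrightarrow> g differentiable_on S"
    unfolding differentiable_on_def
    using Suc.prems by (metis differentiable_transform_within zero_less_one)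
  moreover have "Ck k S (pd j f) = Ck k S (pd j g)" for j
    using Suc.prems by (intro Suc.IH pd_cong_open[OF assms(1)]) auto
  ultimately show ?case by simp
qed

lemma Ck_SucD: "Ck (Suc k) S f \<Longrightarrow> Ck k S f"
proof (induction k arbitrary: f)
  case 0
  then show ?case by (simp add: differentiable_imp_continuous_on)
next
  case (Suc k)
  from Suc.prems have "f differentiable_on S" "Ck (Suc k) S (pd j f)" for j by simp_all
  with Suc.IH show ?case unfolding Ck.simps(2)[of k] by blast
qed

lemma Ck_mono: "Ck k S f \<Longrightarrow> l \<le> k \<Longrightarrow> Ck l S f"
proof (induction k)
  case (Suc k)
  show ?case
  proof (cases "l = Suc k")
    case False
    then have "l \<le> k" using Suc.prems(2) by simp
    with Ck_SucD[OF Suc.prems(1)] show ?thesis by (rule Suc.IH)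
  qed (use Suc.prems in blast)
qed simp

lemma Ck_imp_continuous_on: "Ck k S f \<Longrightarrow> continuous_on S f"
  using Ck_mono[of k S f 0] by simp

lemma Ck_differentiable_at: "Ck (Suc k) S f \<Longrightarrow> open S \<Longrightarrow> x \<in> S \<Longrightarrow> f differentiable (at x)"
  by (metis Ck.simps(2) at_within_open differentiable_on_def)

lemma Ck_pd: "Ck (Suc k) S f \<Longrightarrow> Ck k S (pd j f)"
  by simp

lemma Ck_subset:
  assumes "Ck k S f" "T \<subseteq> S"
  shows "Ck k T f"
  using assms(1)
proof (induction k arbitrary: f)
  case 0
  then show ?case using assms(2) continuous_on_subset by auto
next
  case (Suc k)
  then show ?case using assms(2) differentiable_on_subset by auto
qed

lemma Ck_const: "Ck k S (\<lambda>x. c)"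
proof (induction k arbitrary: c)
  case (Suc k)
  have "pd j (\<lambda>x. c) = (\<lambda>x. 0)" for j :: 'a by auto
  then show ?case using Suc by (simp add: differentiable_on_const)
qed simp

lemma Ck_component: "Ck k S (\<lambda>x. x $ i)"
proof (cases k)
  case 0
  then show ?thesis by (simp add: continuous_intros)
next
  case (Suc k)
  have "pd j (\<lambda>x. x $ i) = (\<lambda>x. (if i = j then 1 else 0))" for j
    by (auto simp: pd_component)
  moreover have "(\<lambda>x. x $ i) differentiable_on S"
    by (intro differentiable_at_imp_differentiable_on differentiableI[OF has_derivative_component])
  ultimately show ?thesis using Suc by (simp add: Ck_const)
qed

lemma Ck_add:
  assumes "open S" "Ck k S f" "Ck k S g"
  shows "Ck k S (\<lambda>x. f x + g x)"
  using assms(2,3)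
proof (induction k arbitrary: f g)
  case 0
  then show ?case by (simp add: continuous_on_add)
next
  case (Suc k)
  have "Ck k S (pd j (\<lambda>x. f x + g x)) = Ck k S (\<lambda>x. pd j f x + pd j g x)" for j
    by (intro Ck_cong[OF assms(1)] pd_add Ck_differentiable_at[OF Suc.prems(1) assms(1)]
        Ck_differentiable_at[OF Suc.prems(2) assms(1)])
  with Suc show ?case by (auto simp: differentiable_on_add)
qed

lemma Ck_mult:
  assumes "open S" "Ck k S f" "Ck k S g"
  shows "Ck k S (\<lambda>x. f x * g x)"
  using assms(2,3)
proof (induction k arbitrary: f g)
  case 0
  then show ?case by (simp add: continuous_on_mult)
next
  case (Suc k)
  have "Ck k S (pd j (\<lambda>x. f x * g x)) = Ck k S (\<lambda>x. f x * pd j g x + pd j f x * g x)" for j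
    by (intro Ck_cong[OF assms(1)] pd_mult Ck_differentiable_at[OF Suc.prems(1) assms(1)]
        Ck_differentiable_at[OF Suc.prems(2) assms(1)])
  moreover have "Ck k S (\<lambda>x. f x * pd j g x + pd j f x * g x)" for j
    using Suc.prems Ck_SucD[OF Suc.prems(1)] Ck_SucD[OF Suc.prems(2)]
    by (intro Ck_add[OF assms(1)] Suc.IH) auto
  ultimately show ?case using Suc.prems by (auto intro!: differentiable_on_mult)
qed

lemma Ck_cmult: "open S \<Longrightarrow> Ck k S f \<Longrightarrow> Ck k S (\<lambda>x. c * f x)"
  by (rule Ck_mult[OF _ Ck_const])

lemma Ck_uminus: "open S \<Longrightarrow> Ck k S f \<Longrightarrow> Ck k S (\<lambda>x. - f x)"
  using Ck_cmult[of S k f "-1"] by simp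

lemma Ck_diff: "open S \<Longrightarrow> Ck k S f \<Longrightarrow> Ck k S g \<Longrightarrow> Ck k S (\<lambda>x. f x - g x)"
  using Ck_add[of S k f "\<lambda>x. - g x"] Ck_uminus[of S k g] by simp

lemma Ck_sum:
  assumes "open S" "\<And>i. i \<in> I \<Longrightarrow> Ck k S (f i)"
  shows "Ck k S (\<lambda>x. \<Sum>i\<in>I. f i x)"
  using assms(2)
proof (induction I rule: infinite_finite_induct)
  case (insert a I)
  then have "Ck k S (f a)" "Ck k S (\<lambda>x. \<Sum>i\<in>I. f i x)" by auto
  from Ck_add[OF assms(1) this] show ?case using insert by simp
qed (simp_all add: Ck_const)

lemma Ck_prod:
  assumes "open S" "\<And>i. i \<in> I \<Longrightarrow> Ck k S (f i)"
  shows "Ck k S (\<lambda>x. \<Prod>i\<in>I. f i x)"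
  using assms(2)
proof (induction I rule: infinite_finite_induct)
  case (insert a I)
  then have "Ck k S (f a)" "Ck k S (\<lambda>x. \<Prod>i\<in>I. f i x)" by auto
  from Ck_mult[OF assms(1) this] show ?case using insert by simp
qed (simp_all add: Ck_const)

text \<open>The outer function comes with all its derivatives as the sequence \<open>H\<close>: the
  chain rule leads from \<open>H n\<close> to \<open>H (Suc n)\<close>, so the induction over
  \<open>k\<close> must leave \<open>n\<close> free. The set \<open>A\<close> allows outer functions
  that are differentiable only on part of the line, such as the reciprocal.\<close>

lemma Ck_compose:
  fixes H :: "nat \<Rightarrow> real \<Rightarrow> real"
  assumes "open S" "\<And>n t. t \<in> A \<Longrightarrow> (H n has_real_derivative H (Suc n) t) (at t)"
    and "Ck k S f" "f ` S \<subseteq> A"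
  shows "Ck k S (\<lambda>x. H n (f x))"
  using assms(3)
proof (induction k arbitrary: n)
  case 0
  have "continuous_on A (H n)"
    using DERIV_isCont[OF assms(2)] by (simp add: continuous_at_imp_continuous_on)
  moreover have "continuous_on S f" using 0 by simp
  ultimately have "continuous_on S (\<lambda>x. H n (f x))"
    using assms(4) by (rule continuous_on_compose2[of A "H n" S f])
  then show ?case by simp
next
  case (Suc k)
  have f: "f differentiable (at x)" if "x \<in> S" for x
    using Ck_differentiable_at[OF Suc.prems assms(1) that] .
  have "pd j (\<lambda>x. H n (f x)) x = H (Suc n) (f x) * pd j f x" if "x \<in> S" for j x
  proof -
    have "f x \<in> A" using that assms(4) by auto
    from pd_compose[OF assms(2)[OF this] f[OF that]] show ?thesis .
  qed
  then have "Ck k S (pd j (\<lambda>x. H n (f x))) = Ck k S (\<lambda>x. H (Suc n) (f x) * pd j f x)" for j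
    by (rule Ck_cong[OF assms(1)])
  moreover have "Ck k S (\<lambda>x. H (Suc n) (f x) * pd j f x)" for j
    by (rule Ck_mult[OF assms(1) Suc.IH[OF Ck_SucD[OF Suc.prems]] Ck_pd[OF Suc.prems]])
  moreover have "(\<lambda>x. H n (f x)) differentiable_on S"
    unfolding differentiable_on_def
  proof
    fix x assume "x \<in> S"
    then have "f x \<in> A" using assms(4) by auto
    then have "H n differentiable (at (f x))"
      using assms(2)[of "f x" n] unfolding has_field_derivative_def differentiable_def by blast
    from differentiable_chain_at[OF f[OF \<open>x \<in> S\<close>] this]
    have "(\<lambda>x. H n (f x)) differentiable (at x)"
      by (simp add: o_def)
    then show "(\<lambda>x. H n (f x)) differentiable (at x within S)"
      by (rule differentiable_at_withinI)
  qed
  ultimately show ?case by simp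
qed

lemma Ck_inverse:
  assumes "open S" "Ck k S f" "\<And>x. x \<in> S \<Longrightarrow> f x \<noteq> 0"
  shows "Ck k S (\<lambda>x. inverse (f x))"
proof -
  define H where "H n t = (-1)^n * fact n * inverse t ^ Suc n" for n :: nat and t :: real
  have "(H n has_real_derivative H (Suc n) t) (at t)" if "t \<in> -{0}" for n t
  proof -
    have "((\<lambda>t. inverse t ^ Suc n) has_real_derivative
        - (real (Suc n) * inverse t ^ Suc (Suc n))) (at t)"
      using DERIV_power[OF DERIV_inverse[of t UNIV], of "Suc n"] that by (simp add: power2_eq_square mult.assoc)
    from DERIV_cmult[OF this, of "(-1) ^ n * fact n"] show ?thesis
      by (simp add: H_def[abs_def] algebra_simps)
  qed
  then have "Ck k S (\<lambda>x. H 0 (f x))"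
    using assms(3) by (intro Ck_compose[OF assms(1) _ assms(2), of "- {0}" H 0]) auto
  then show ?thesis by (simp add: H_def)
qed

lemma Ck_exp: "open S \<Longrightarrow> Ck k S f \<Longrightarrow> Ck k S (\<lambda>x. exp (f x))"
  using Ck_compose[of S UNIV "\<lambda>_. exp" k f] by simp

lemma pd_outside:
  assumes "closed K" "\<And>x. x \<notin> K \<Longrightarrow> f x = 0" "x \<notin> K"
  shows "pd j f x = 0"
  using pd_cong_open[of "- K" x f "\<lambda>_. 0"] assms by auto

text \<open>The open sets \<open>S\<close> and \<open>- K\<close> cover the space, and
  \<open>f\<close> vanishes on the second. This is what carries expressions in the metric, whose
  regularity is known on \<open>D\<close> only, to the whole space once they are multiplied by
  something supported in \<open>K\<close>.\<close>

lemma Ck_extend_zero: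
  assumes "open S" "closed K" "K \<subseteq> S" "Ck k S f" "\<And>x. x \<notin> K \<Longrightarrow> f x = 0"
  shows "Ck k UNIV f"
  using assms(4,5)
proof (induction k arbitrary: f)
  case 0
  have "continuous_on (S \<union> - K) f"
    using 0 assms(1,2) continuous_on_cong[of "- K" "- K" f "\<lambda>_. 0"]
    by (intro continuous_on_open_Un) auto
  moreover have "S \<union> - K = UNIV" using assms(3) by auto
  ultimately show ?case by simp
next
  case (Suc k)
  have "f differentiable (at x)" for x
  proof (cases "x \<in> S")
    case True
    then show ?thesis using Ck_differentiable_at[OF Suc.prems(1) assms(1)] by blast
  next
    case False
    then have "x \<in> - K" using assms(3) by auto
    then have "(f has_derivative (\<lambda>_. 0)) (at x)"
      using has_derivative_transform_within_open[of "\<lambda>_. 0" "\<lambda>_. 0" x UNIV "- K" f] Suc.prems assms(2)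
      by auto
    then show ?thesis by (auto simp: differentiable_def)
  qed
  moreover have "Ck k UNIV (pd j f)" for j
    using Suc by (intro Suc.IH pd_outside[OF assms(2)]) auto
  ultimately show ?case by (simp add: differentiable_at_imp_differentiable_on)
qed

lemma smooth_on_imp_Ck: "smooth_on UNIV f \<Longrightarrow> Ck k S f"
  unfolding smooth_on_def using Ck_subset by blast

subsection \<open>Smooth bump functions\<close>

text \<open>For \<open>p = 1\<close> this is the classical function exp (- 1/t) that vanishes to
  infinite order at 0. The polynomial factor in 1/t makes the family closed under
  differentiation.\<close>

definition flat :: "real poly \<Rightarrow> real \<Rightarrow> real" where
  "flat p t = (if t > 0 then poly p (inverse t) * exp (- inverse t) else 0)"

lemma poly_div_exp_tendsto_0: "((\<lambda>y. poly p y * exp (- y)) \<longlongrightarrow> (0::real)) at_top"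
proof -
  have "((\<lambda>y. \<Sum>i\<le>degree p. coeff p i * (y ^ i / exp y)) \<longlongrightarrow> (\<Sum>i\<le>degree p. coeff p i * 0)) at_top"
    by (intro tendsto_intros tendsto_power_div_exp_0)
  then show ?thesis
    by (simp add: poly_altdef exp_minus sum_distrib_right divide_inverse mult.assoc)
qed

text \<open>With y = 1/t one has dy/dt = - y^2, so p(y) exp (- y) has the derivative y^2 (p - p')(y)
  exp (- y), again a member of the family. At 0 both one-sided difference quotients tend to
  0.\<close>

lemma flat_has_derivative:
  "(flat p has_real_derivative flat (monom 1 2 * (p - pderiv p)) t) (at t)"
proof -
  consider "t > 0" | "t < 0" | "t = 0" by linarith
  then show ?thesis
  proof cases
    case 1
    have "((\<lambda>t. poly p (inverse t) * exp (- inverse t)) has_real_derivative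
        poly (monom 1 2 * (p - pderiv p)) (inverse t) * exp (- inverse t)) (at t)"
      using 1 by (auto intro!: derivative_eq_intros simp: poly_monom power2_eq_square algebra_simps)
    then have "(flat p has_real_derivative
        poly (monom 1 2 * (p - pderiv p)) (inverse t) * exp (- inverse t)) (at t)"
      by (rule has_field_derivative_transform_within_open[where S = "{0<..}"]) (auto simp: flat_def 1)
    then show ?thesis using 1 by (simp add: flat_def)
  next
    case 2
    have "(flat p has_real_derivative 0) (at t)"
      by (rule has_field_derivative_transform_within_open[OF DERIV_const, where S = "{..<0}"])
        (auto simp: flat_def 2)
    then show ?thesis using 2 by (simp add: flat_def)
  next
    case 3
    have "((\<lambda>h. flat p h / h) \<longlongrightarrow> 0) (at_right 0)"
    proof -
      \<comment> \<open>Division by \<open>h\<close> contributes one more factor 1/h, hence the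
        polynomial \<open>pCons 0 p\<close>.\<close>
      have "((\<lambda>h. poly (pCons 0 p) (inverse h) * exp (- inverse h)) \<longlongrightarrow> (0::real)) (at_right 0)"
        using filterlim_compose[OF poly_div_exp_tendsto_0 filterlim_inverse_at_top_right] .
      then show ?thesis
        by (rule Lim_transform_eventually)
          (auto simp: eventually_at_filter flat_def divide_inverse mult_ac)
    qed
    moreover have "((\<lambda>h. flat p h / h) \<longlongrightarrow> 0) (at_left 0)"
      by (rule Lim_transform_eventually[OF tendsto_const]) (auto simp: eventually_at_filter flat_def)
    ultimately have "((\<lambda>h. flat p h / h) \<longlongrightarrow> 0) (at 0)"
      by (simp add: filterlim_at_split)
    then show ?thesis using 3 by (simp add: DERIV_def flat_def)
  qed
qed

lemma Ck_flat:
  assumes "open S" "Ck k S f"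
  shows "Ck k S (\<lambda>x. flat p (f x))"
proof -
  define H where "H n = flat (((\<lambda>p. monom 1 2 * (p - pderiv p)) ^^ n) p)" for n :: nat
  have "(H n has_real_derivative H (Suc n) t) (at t)" for n t
    unfolding H_def by (simp add: flat_has_derivative)
  from Ck_compose[of S UNIV H k f 0, OF assms(1) this assms(2)] show ?thesis
    by (simp add: H_def)
qed

lemma flat_1_pos: "t > 0 \<Longrightarrow> flat 1 t > 0"
  and flat_1_nonpos: "t \<le> 0 \<Longrightarrow> flat 1 t = 0"
  and flat_1_nonneg: "flat 1 t \<ge> 0"
  by (auto simp: flat_def)

lemma flat_1_mono: "0 < s \<Longrightarrow> s \<le> t \<Longrightarrow> flat 1 s \<le> flat 1 t"
  by (auto simp: flat_def)

lemma Ck_inner_self: "open S \<Longrightarrow> Ck k S (\<lambda>x. (x - a) \<bullet> (x - a))"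
  unfolding inner_vec_def
  by (auto intro!: Ck_sum Ck_mult Ck_diff Ck_component Ck_const)

subsection \<open>Integrals of compactly supported functions\<close>

lemma integrable_compact_support:
  fixes f :: "'a::euclidean_space \<Rightarrow> real"
  assumes "continuous_on UNIV f" "compact K" "\<And>x. x \<notin> K \<Longrightarrow> f x = 0"
  shows "integrable lborel f"
proof -
  have "integrable lborel (\<lambda>x. indicator K x *\<^sub>R f x)"
    using assms continuous_on_subset[OF assms(1)] by (intro borel_integrable_compact) auto
  moreover have "(\<lambda>x. indicator K x *\<^sub>R f x) = f"
    using assms(3) by (intro ext) (auto simp: indicator_def)
  ultimately show ?thesis by simp
qed

lemma bounded_compact_support:
  fixes f :: "'a::euclidean_space \<Rightarrow> real"
  assumes "continuous_on UNIV f" "compact K" "\<And>x. x \<notin> K \<Longrightarrow> f x = 0"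
  obtains C where "C > 0" "\<And>x. \<bar>f x\<bar> \<le> C"
proof -
  have "compact (f ` K)"
    using assms continuous_on_subset[OF assms(1)] by (intro compact_continuous_image) auto
  then obtain B where "B > 0" "\<forall>y\<in>f ` K. norm y \<le> B"
    using compact_imp_bounded bounded_pos by metis
  then show ?thesis using assms(3) that[of B] by (force simp: image_iff)
qed

lemma lborel_integral_translation:
  fixes f :: "'a::euclidean_space \<Rightarrow> real"
  assumes "f \<in> borel_measurable borel"
  shows "(LINT x|lborel. f (a + x)) = (LINT x|lborel. f x)"
  using integral_distr[of "(+) a" lborel borel f] assms by (simp add: lborel_distr_plus)

lemma lborel_integral_reflection:
  fixes f :: "'a::euclidean_space \<Rightarrow> real"
  assumes "f \<in> borel_measurable borel"
  shows "(LINT x|lborel. f (a - x)) = (LINT x|lborel. f x)"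
proof -
  have "lborel = distr lborel borel (\<lambda>x::'a. a - x)"
    using lborel_affine[of "-1" a] by (simp add: density_1)
  then show ?thesis
    using integral_distr[of "\<lambda>x. a - x" lborel borel f] assms by simp
qed

lemma integral_cbox_eq_lborel:
  fixes f :: "'a::euclidean_space \<Rightarrow> real"
  assumes "continuous_on UNIV f" "\<And>x. x \<notin> cbox a b \<Longrightarrow> f x = 0"
  shows "integral (cbox a b) f = (LINT x|lborel. f x)"
proof -
  have "integrable lborel f"
    using assms compact_cbox by (intro integrable_compact_support) 
  then have "integral UNIV f = (LINT x|lborel. f x)" by (rule integral_lborel)
  moreover have "integral UNIV f = integral (cbox a b) f"
    using assms(2) by (intro integral_spike_set empty_imp_negligible)
      (auto intro!: empty_imp_negligible)
  ultimately show ?thesis by simp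
qed

text \<open>The total derivative in the parameter is assembled from the partial derivatives as a
  bounded linear functional \<open>F'\<close>; their joint continuity is then the continuity that
  the Leibniz rule asks for. Evaluation at a basis vector commutes with the integral and returns the
  formula for \<open>pd j\<close>.\<close>

lemma parametric_integral:
  fixes F :: "real^'n::finite \<Rightarrow> real^'n \<Rightarrow> real"
  assumes diff: "\<And>x y. (\<lambda>x. F x y) differentiable (at x)"
    and cont: "\<And>x. continuous_on UNIV (F x)"
    and cont': "\<And>j. continuous_on UNIV (\<lambda>(x, y). pd j (\<lambda>x. F x y) x)"
  shows "(\<lambda>x. integral (cbox a b) (F x)) differentiable (at x)"
    and "pd j (\<lambda>x. integral (cbox a b) (F x)) x = integral (cbox a b) (\<lambda>y. pd j (\<lambda>x. F x y) x)"
proof -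
  define B :: "'n \<Rightarrow> (real^'n) \<Rightarrow>\<^sub>L real" where "B j = Blinfun (\<lambda>v. v $ j)" for j
  have B: "blinfun_apply (B j) v = v $ j" for j v
    unfolding B_def by (simp add: bounded_linear_Blinfun_apply bounded_linear_vec_nth)
  define F' where "F' x y = (\<Sum>j\<in>UNIV. pd j (\<lambda>x. F x y) x *\<^sub>R B j)" for x y
  have F': "blinfun_apply (F' x y) v = (\<Sum>j\<in>UNIV. v $ j * pd j (\<lambda>x. F x y) x)" for x y v
    by (simp add: F'_def blinfun.sum_left blinfun.scaleR_left B mult.commute)
  have "((\<lambda>x. F x y) has_derivative blinfun_apply (F' x y)) (at x)" for x y
  proof -
    have "frechet_derivative (\<lambda>x. F x y) (at x) = blinfun_apply (F' x y)"
      using frechet_derivative_eq_sum_pd[OF diff] F' by (intro ext) simp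
    with diff[of y x, unfolded frechet_derivative_works] show ?thesis by simp
  qed
  moreover have cF': "continuous_on UNIV (\<lambda>(x, y). F' x y)"
    unfolding F'_def case_prod_beta using cont'[unfolded case_prod_beta]
    by (intro continuous_intros)
  ultimately have D: "((\<lambda>x. integral (cbox a b) (F x)) has_derivative
      blinfun_apply (integral (cbox a b) (F' x))) (at x)"
    using cont by (intro leibniz_rule[where U = UNIV, simplified] integrable_continuous)
      (auto intro: continuous_on_subset)
  then show "(\<lambda>x. integral (cbox a b) (F x)) differentiable (at x)"
    by (auto simp: differentiable_def)
  have "continuous_on UNIV (\<lambda>y. F' x y)"
    using continuous_on_compose2[OF cF', of UNIV "\<lambda>y. (x, y)"] by (simp add: continuous_intros)
  then have "F' x integrable_on cbox a b"
    by (intro integrable_continuous) (auto intro: continuous_on_subset)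
  from integral_linear[OF this blinfun.bounded_linear_left, of "axis j 1"]
  have "blinfun_apply (integral (cbox a b) (F' x)) (axis j 1)
      = integral (cbox a b) (\<lambda>y. pd j (\<lambda>x. F x y) x)"
    by (simp add: o_def F' axis_def if_distrib[of "\<lambda>c. c * _"] cong: if_cong)
  with pd_has_derivative[OF D]
  show "pd j (\<lambda>x. integral (cbox a b) (F x)) x = integral (cbox a b) (\<lambda>y. pd j (\<lambda>x. F x y) x)"
    by simp
qed

lemma has_derivative_shift:
  assumes "f differentiable (at (x + a))"
  shows "(\<lambda>x. f (x + a)) differentiable (at x)" "pd j (\<lambda>x. f (x + a)) x = pd j f (x + a)"
proof -
  have "((\<lambda>x. x + a) has_derivative (\<lambda>h. h)) (at x)" by (auto intro!: derivative_eq_intros)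
  from diff_chain_at[OF this assms[unfolded frechet_derivative_works]]
  have D: "((\<lambda>x. f (x + a)) has_derivative frechet_derivative f (at (x + a))) (at x)"
    by (simp add: o_def)
  then show "(\<lambda>x. f (x + a)) differentiable (at x)" by (auto simp: differentiable_def)
  show "pd j (\<lambda>x. f (x + a)) x = pd j f (x + a)"
    using pd_has_derivative[OF D] by (simp add: pd_def)
qed

lemma Ck_1_differentiable: "Ck (Suc 0) UNIV f \<Longrightarrow> f differentiable (at x)"
  by (rule Ck_differentiable_at[of 0 UNIV]) auto

lemma Ck_1_continuous_pd: "Ck (Suc 0) UNIV f \<Longrightarrow> continuous_on UNIV (pd j f)"
  by simp

lemma integral_pd_eq_0:
  fixes f :: "real^'n::finite \<Rightarrow> real"
  assumes f: "Ck (Suc 0) UNIV f" and K: "compact K" "\<And>x. x \<notin> K \<Longrightarrow> f x = 0"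
  shows "(LINT x|lborel. pd j f x) = 0"
proof -
  have cf: "continuous_on UNIV f" using f by (rule Ck_imp_continuous_on)
  obtain R where R: "\<And>x. x \<in> K \<Longrightarrow> norm x \<le> R"
    using K(1) compact_imp_bounded bounded_iff by metis
  \<comment> \<open>The margin 1 keeps the supports of all translates by vectors of norm below 1
    inside one fixed box.\<close>
  obtain a b :: "real^'n" where ab: "cball 0 (R + 1) \<subseteq> cbox a b"
    using bounded_subset_cbox_symmetric[OF bounded_cball] by metis
  define F where "F x y = f (x + y)" for x y
  have F: "pd j (\<lambda>x. F x y) x = pd j f (x + y)" "(\<lambda>x. F x y) differentiable (at x)" for j x y
    unfolding F_def using has_derivative_shift[OF Ck_1_differentiable[OF f]] by blast+
  have cF: "continuous_on UNIV (F x)" for x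
    unfolding F_def by (intro continuous_on_compose2[OF cf]) (auto intro!: continuous_intros)
  have cpd: "continuous_on UNIV (\<lambda>(x, y). pd j (\<lambda>x. F x y) x)" for j
    unfolding F case_prod_beta
    by (intro continuous_on_compose2[OF Ck_1_continuous_pd[OF f]]) (auto intro!: continuous_intros)
  have "integral (cbox a b) (F x) = (LINT x|lborel. f x)" if "x \<in> ball 0 1" for x
  proof -
    have "F x y = 0" if "y \<notin> cbox a b" for y
    proof -
      have "y \<notin> cball 0 (R + 1)" using that ab by blast
      then have "norm (x + y) > R" using norm_diff_ineq[of y x] \<open>x \<in> ball 0 1\<close>
        by (auto simp: add.commute)
      then show ?thesis using R K(2) by (force simp: F_def)
    qed
    then have "integral (cbox a b) (F x) = (LINT y|lborel. F x y)"
      by (intro integral_cbox_eq_lborel cF)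
    also have "\<dots> = (LINT y|lborel. f y)"
      unfolding F_def using cf
      by (intro lborel_integral_translation) (simp add: borel_measurable_continuous_onI)
    finally show ?thesis .
  qed
  then have "pd j (\<lambda>x. integral (cbox a b) (F x)) 0 = pd j (\<lambda>x. (LINT x|lborel. f x)) 0"
    by (intro pd_cong_open[of "ball 0 1"]) auto
  then have "integral (cbox a b) (\<lambda>y. pd j f y) = 0"
    by (subst (asm) parametric_integral(2)[OF F(2) cF cpd]) (simp add: F)
  moreover have "integral (cbox a b) (\<lambda>y. pd j f y) = (LINT x|lborel. pd j f x)"
  proof (intro integral_cbox_eq_lborel Ck_1_continuous_pd f)
    fix x assume "x \<notin> cbox a b"
    then have "x \<notin> K" using ab R by (force simp: subset_iff)
    then show "pd j f x = 0" using pd_outside[OF compact_imp_closed[OF K(1)]] K(2) by blast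
  qed
  ultimately show ?thesis by simp
qed

lemma integral_by_parts_exp:
  fixes f :: "real^'n::finite \<Rightarrow> real"
  assumes f: "Ck (Suc 0) UNIV f" and K: "compact K" "\<And>x. x \<notin> K \<Longrightarrow> f x = 0"
    and psi: "Ck (Suc 0) UNIV \<psi>"
  shows "(LINT x|lborel. exp (- \<psi> x) * (pd j \<psi> x * f x)) = (LINT x|lborel. exp (- \<psi> x) * pd j f x)"
proof -
  have e: "Ck (Suc 0) UNIV (\<lambda>x. exp (- \<psi> x))"
    by (intro Ck_exp Ck_uminus psi open_UNIV)
  have ef: "Ck (Suc 0) UNIV (\<lambda>x. exp (- \<psi> x) * f x)"
    by (intro Ck_mult e f open_UNIV)
  have pde: "pd j (\<lambda>x. exp (- \<psi> x)) x = - (pd j \<psi> x) * exp (- \<psi> x)" for x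
  proof -
    have "((\<lambda>t. exp (- t)) has_real_derivative - exp (- \<psi> x)) (at (\<psi> x))"
      by (auto intro!: derivative_eq_intros)
    from pd_compose[OF this Ck_1_differentiable[OF psi]] show ?thesis by simp
  qed
  have "pd j (\<lambda>x. exp (- \<psi> x) * f x) x
      = exp (- \<psi> x) * pd j f x - exp (- \<psi> x) * (pd j \<psi> x * f x)" for x
    using pd_mult[OF Ck_1_differentiable[OF e] Ck_1_differentiable[OF f], of j x] pde by simp
  with integral_pd_eq_0[OF ef K(1), of j] K(2)
  have "(LINT x|lborel. exp (- \<psi> x) * pd j f x - exp (- \<psi> x) * (pd j \<psi> x * f x)) = 0"
    by simp
  moreover have "integrable lborel (\<lambda>x. exp (- \<psi> x) * pd j f x)"
    using pd_outside[OF compact_imp_closed[OF K(1)] K(2)]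
    by (intro integrable_compact_support[OF _ K(1)])
      (auto intro!: continuous_intros Ck_1_continuous_pd f Ck_imp_continuous_on[OF psi])
  moreover have "integrable lborel (\<lambda>x. exp (- \<psi> x) * (pd j \<psi> x * f x))"
    using K(2)
    by (intro integrable_compact_support[OF _ K(1)])
      (auto intro!: continuous_intros Ck_1_continuous_pd psi f Ck_imp_continuous_on[OF psi]
        Ck_imp_continuous_on[OF f])
  ultimately show ?thesis by (simp add: Bochner_Integration.integral_diff)
qed

subsection \<open>Mollification\<close>

lemma mollifier_exists:
  fixes \<epsilon> :: real
  assumes "\<epsilon> > 0"
  obtains \<rho> :: "real^'n::finite \<Rightarrow> real" where "\<And>k. Ck k UNIV \<rho>" "\<And>x. \<rho> x \<ge> 0"
    "\<And>x. x \<notin> cball 0 \<epsilon> \<Longrightarrow> \<rho> x = 0" "(LINT x|lborel. \<rho> x) = 1"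
proof -
  define f :: "real^'n \<Rightarrow> real" where "f x = flat 1 (\<epsilon>\<^sup>2 - (x - 0) \<bullet> (x - 0))" for x
  have f: "Ck k UNIV f" for k
    unfolding f_def by (intro Ck_flat Ck_diff Ck_const Ck_inner_self open_UNIV)
  have nonneg: "f x \<ge> 0" for x unfolding f_def by (rule flat_1_nonneg)
  have supp: "f x = 0" if "x \<notin> cball 0 \<epsilon>" for x
  proof -
    have "norm x > \<epsilon>" using that by auto
    then have "(norm x)\<^sup>2 > \<epsilon>\<^sup>2" using assms by (intro power_strict_mono) auto
    then show ?thesis by (simp add: f_def flat_1_nonpos dot_square_norm)
  qed
  have int: "integrable lborel f"
    using integrable_compact_support[OF Ck_imp_continuous_on[OF f] compact_cball supp] .
  have "(LINT x|lborel. f x) > 0"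
  proof -
    \<comment> \<open>The value of \<open>f\<close> at distance \<epsilon>/2 from the origin, which
      bounds \<open>f\<close> from below on the half ball and so makes its integral
      positive.\<close>
    define c where "c = flat 1 (\<epsilon>\<^sup>2 - (\<epsilon>/2)\<^sup>2)"
    have c: "c > 0" unfolding c_def using assms
      by (intro flat_1_pos) (simp add: power2_eq_square field_simps)
    have "c * indicator (cball 0 (\<epsilon>/2)) x \<le> f x" for x
    proof (cases "x \<in> cball 0 (\<epsilon>/2)")
      case True
      then have "(norm x)\<^sup>2 \<le> (\<epsilon>/2)\<^sup>2" by (intro power_mono) auto
      then have "c \<le> f x" unfolding c_def f_def using assms
        by (intro flat_1_mono) (simp_all add: power2_eq_square field_simps dot_square_norm)
      with True show ?thesis by simp
    qed (simp add: nonneg)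
    then have "(LINT x|lborel. c * indicator (cball (0::real^'n) (\<epsilon>/2)) x) \<le> (LINT x|lborel. f x)"
      by (intro integral_mono int) (auto intro!: integrable_mult_right integrable_real_indicator simp: emeasure_lborel_cball_finite[unfolded infinity_ennreal_def])
    moreover have "(LINT x|lborel. c * indicator (cball (0::real^'n) (\<epsilon>/2)) x)
        = c * measure lborel (cball (0::real^'n) (\<epsilon>/2))"
      by simp
    moreover have "measure lborel (cball (0::real^'n) (\<epsilon>/2)) > 0"
      using content_cball_pos[of "\<epsilon>/2" "0::real^'n"] assms by simp
    ultimately show ?thesis using c by (smt (verit) mult_pos_pos)
  qed
  then show ?thesis
    using that[of "\<lambda>x. inverse (LINT x|lborel. f x) * f x"] f nonneg supp
    by (auto intro!: Ck_cmult mult_nonneg_nonneg)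
qed

definition conv :: "(real^'n::finite \<Rightarrow> real) \<Rightarrow> (real^'n \<Rightarrow> real) \<Rightarrow> real^'n \<Rightarrow> real" where
  "conv \<phi> \<rho> x = (LINT z|lborel. \<phi> (x - z) * \<rho> z)"

lemma has_derivative_reflect:
  assumes "f differentiable (at (x - a))"
  shows "(\<lambda>x. f (x - a)) differentiable (at x)" "pd j (\<lambda>x. f (x - a)) x = pd j f (x - a)"
  using has_derivative_shift[of f x "- a"] assms by simp_all

lemma integral_kernel_C1:
  fixes \<phi> :: "real^'n::finite \<Rightarrow> real"
  assumes \<phi>: "continuous_on UNIV \<phi>" and \<rho>: "Ck (Suc 0) UNIV \<rho>"
  shows "(\<lambda>x. integral (cbox a b) (\<lambda>y. \<phi> y * \<rho> (x - y))) differentiable (at x)"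
    and "pd j (\<lambda>x. integral (cbox a b) (\<lambda>y. \<phi> y * \<rho> (x - y))) x
      = integral (cbox a b) (\<lambda>y. \<phi> y * pd j \<rho> (x - y))"
proof -
  define F where "F x y = \<phi> y * \<rho> (x - y)" for x y
  have d: "(\<lambda>x. \<rho> (x - y)) differentiable (at x)" "pd j (\<lambda>x. \<rho> (x - y)) x = pd j \<rho> (x - y)" for x y j
    using has_derivative_reflect[OF Ck_1_differentiable[OF \<rho>]] by blast+
  have F: "(\<lambda>x. F x y) differentiable (at x)"
    "pd j (\<lambda>x. F x y) x = \<phi> y * pd j \<rho> (x - y)" for x y j
    unfolding F_def by (simp_all add: d pd_cmult)
  have c1: "continuous_on UNIV (F x)" for x
    unfolding F_def
    by (intro continuous_intros continuous_on_compose2[OF \<phi>]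
        continuous_on_compose2[OF Ck_imp_continuous_on[OF \<rho>]]) auto
  have c2: "continuous_on UNIV (\<lambda>(x, y). pd j (\<lambda>x. F x y) x)" for j
    unfolding F case_prod_beta
    by (intro continuous_intros continuous_on_compose2[OF \<phi>]
        continuous_on_compose2[OF Ck_1_continuous_pd[OF \<rho>]]) auto
  note p = parametric_integral[of F, OF F(1) c1 c2]
  show "(\<lambda>x. integral (cbox a b) (\<lambda>y. \<phi> y * \<rho> (x - y))) differentiable (at x)"
    by (rule p(1)[unfolded F_def])
  show "pd j (\<lambda>x. integral (cbox a b) (\<lambda>y. \<phi> y * \<rho> (x - y))) x
      = integral (cbox a b) (\<lambda>y. \<phi> y * pd j \<rho> (x - y))"
    using p(2)[of j a b x] unfolding F by (simp add: F_def[abs_def])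
qed

lemma Ck_integral_kernel:
  fixes \<phi> :: "real^'n::finite \<Rightarrow> real"
  assumes \<phi>: "continuous_on UNIV \<phi>" and "\<And>k. Ck k UNIV \<rho>"
  shows "Ck k UNIV (\<lambda>x. integral (cbox a b) (\<lambda>y. \<phi> y * \<rho> (x - y)))"
  using assms(2)
proof (induction k arbitrary: \<rho>)
  case 0
  have "(\<lambda>x. integral (cbox a b) (\<lambda>y. \<phi> y * \<rho> (x - y))) differentiable_on UNIV"
    by (intro differentiable_at_imp_differentiable_on integral_kernel_C1(1) \<phi> 0)
  then show ?case by (simp add: differentiable_imp_continuous_on)
next
  case (Suc k)
  have "Ck k UNIV (\<lambda>x. integral (cbox a b) (\<lambda>y. \<phi> y * pd j \<rho> (x - y)))" for j
    using Suc.prems[of "Suc _"] by (intro Suc.IH) simp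
  moreover have "pd j (\<lambda>x. integral (cbox a b) (\<lambda>y. \<phi> y * \<rho> (x - y)))
      = (\<lambda>x. integral (cbox a b) (\<lambda>y. \<phi> y * pd j \<rho> (x - y)))" for j
    by (intro ext integral_kernel_C1(2) \<phi> Suc.prems)
  ultimately show ?case
    by (simp add: differentiable_at_imp_differentiable_on integral_kernel_C1(1)[OF \<phi> Suc.prems])
qed

lemma continuous_on_conv_integrand:
  fixes h \<rho> :: "real^'n::finite \<Rightarrow> real"
  assumes "continuous_on UNIV h" "continuous_on UNIV \<rho>"
  shows "continuous_on UNIV (\<lambda>z. h (x - z) * \<rho> z)"
  by (intro continuous_intros assms(2) continuous_on_compose2[OF assms(1)]) auto

lemma integrable_conv_integrand:
  fixes h \<rho> :: "real^'n::finite \<Rightarrow> real"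
  assumes "continuous_on UNIV h" "continuous_on UNIV \<rho>" "\<And>x. x \<notin> cball 0 \<epsilon> \<Longrightarrow> \<rho> x = 0"
  shows "integrable lborel (\<lambda>z. h (x - z) * \<rho> z)"
  by (rule integrable_compact_support[OF continuous_on_conv_integrand[OF assms(1,2)]
        compact_cball[of 0 \<epsilon>]]) (simp add: assms(3))

text \<open>The reflection y = x - z moves the variable x into the kernel, so every derivative falls
  on the smooth \<open>\<rho>\<close> while \<open>h\<close> need only be continuous.\<close>

lemma smooth_conv:
  fixes h \<rho> :: "real^'n::finite \<Rightarrow> real"
  assumes h: "continuous_on UNIV h" "compact K" "\<And>x. x \<notin> K \<Longrightarrow> h x = 0"
    and \<rho>: "\<And>k. Ck k UNIV \<rho>"
  shows "smooth_on UNIV (conv h \<rho>)"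
proof -
  note c\<rho> = Ck_imp_continuous_on[OF \<rho>[of 0]]
  obtain a b where ab: "K \<subseteq> cbox a b"
    using bounded_subset_cbox_symmetric[OF compact_imp_bounded[OF h(2)]] by metis
  have "conv h \<rho> x = integral (cbox a b) (\<lambda>y. h y * \<rho> (x - y))" for x
  proof -
    have "conv h \<rho> x = (LINT y|lborel. h (x - (x - y)) * \<rho> (x - y))"
      unfolding conv_def using continuous_on_conv_integrand[OF h(1) c\<rho>, of x]
      by (intro lborel_integral_reflection[symmetric]) (simp add: borel_measurable_continuous_onI)
    also have "\<dots> = (LINT y|lborel. h y * \<rho> (x - y))" by simp
    also have "\<dots> = integral (cbox a b) (\<lambda>y. h y * \<rho> (x - y))"
      using ab h(3)
      by (intro integral_cbox_eq_lborel[symmetric] continuous_intros h(1)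
          continuous_on_compose2[OF c\<rho>]) auto
    finally show ?thesis .
  qed
  then have "conv h \<rho> = (\<lambda>x. integral (cbox a b) (\<lambda>y. h y * \<rho> (x - y)))" by auto
  with Ck_integral_kernel[OF h(1) \<rho>] show ?thesis by (simp add: smooth_on_def)
qed

text \<open>In the unreflected form of the convolution x occurs in \<open>h\<close> alone.
  Derivatives of a mollified function are therefore mollified derivatives, and they converge along
  with it.\<close>

lemma pd_conv:
  fixes h \<rho> :: "real^'n::finite \<Rightarrow> real"
  assumes h: "Ck (Suc 0) UNIV h" and \<rho>: "continuous_on UNIV \<rho>" "\<And>x. x \<notin> cball 0 \<epsilon> \<Longrightarrow> \<rho> x = 0"
  shows "pd j (conv h \<rho>) x = conv (pd j h) \<rho> x"
proof -
  obtain a b :: "real^'n" where ab: "cball 0 \<epsilon> \<subseteq> cbox a b"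
    using bounded_subset_cbox_symmetric[OF bounded_cball] by metis
  have *: "conv k \<rho> x = integral (cbox a b) (\<lambda>z. \<rho> z * k (x - z))"
    if "continuous_on UNIV k" for k x
  proof -
    have "\<rho> z = 0" if "z \<notin> cbox a b" for z using that ab \<rho>(2) by blast
    then have "integral (cbox a b) (\<lambda>z. k (x - z) * \<rho> z) = conv k \<rho> x"
      unfolding conv_def
      by (intro integral_cbox_eq_lborel continuous_on_conv_integrand[OF that \<rho>(1)]) simp
    then show ?thesis by (simp add: mult.commute)
  qed
  have "conv h \<rho> = (\<lambda>x. integral (cbox a b) (\<lambda>z. \<rho> z * h (x - z)))"
    using *[OF Ck_imp_continuous_on[OF h]] by auto
  then show ?thesis
    using integral_kernel_C1(2)[OF \<rho>(1) h] *[OF Ck_1_continuous_pd[OF h]] by simp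
qed

text \<open>The convolution is an average of \<open>h\<close> against a probability density. The
  lemma has two uses: with \<open>c = 0\<close> it is a uniform bound, and with \<open>c\<close> the
  value of \<open>h\<close> at \<open>y\<close> it gives pointwise convergence. The alternative
  \<open>\<rho> (y - x) = 0\<close> restricts the assumption to the points that the kernel
  sees.\<close>

lemma conv_bounded:
  fixes h \<rho> :: "real^'n::finite \<Rightarrow> real"
  assumes h: "continuous_on UNIV h" "\<And>x. \<bar>h x - c\<bar> \<le> C \<or> \<rho> (y - x) = 0"
    and \<rho>: "continuous_on UNIV \<rho>" "\<And>x. x \<notin> cball 0 \<epsilon> \<Longrightarrow> \<rho> x = 0"
      "\<And>x. \<rho> x \<ge> 0" "(LINT x|lborel. \<rho> x) = 1"
  shows "\<bar>conv h \<rho> y - c\<bar> \<le> C"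
proof -
  have i\<rho>: "integrable lborel \<rho>"
    by (rule integrable_compact_support[OF \<rho>(1) compact_cball[of 0 \<epsilon>]]) (rule \<rho>(2))
  have ih: "integrable lborel (\<lambda>z. h (y - z) * \<rho> z)"
    by (rule integrable_conv_integrand[OF h(1) \<rho>(1,2)])
  have "conv h \<rho> y - c = (LINT z|lborel. h (y - z) * \<rho> z - c * \<rho> z)"
    using \<rho>(4) i\<rho> ih by (simp add: conv_def)
  also have "\<bar>\<dots>\<bar> \<le> (LINT z|lborel. \<bar>h (y - z) * \<rho> z - c * \<rho> z\<bar>)"
    by (rule integral_abs_bound)
  also have "\<dots> \<le> (LINT z|lborel. C * \<rho> z)"
  proof (intro integral_mono integrable_abs Bochner_Integration.integrable_diff ih
      integrable_mult_right i\<rho>)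
    fix z
    have "\<bar>h (y - z) * \<rho> z - c * \<rho> z\<bar> = \<bar>h (y - z) - c\<bar> * \<rho> z"
      using \<rho>(3)[of z] by (simp add: left_diff_distrib[symmetric] abs_mult)
    also have "\<dots> \<le> C * \<rho> z"
      using h(2)[of "y - z"] \<rho>(3)[of z] by (auto intro: mult_right_mono)
    finally show "\<bar>h (y - z) * \<rho> z - c * \<rho> z\<bar> \<le> C * \<rho> z" .
  qed
  also have "\<dots> = C" using \<rho>(4) i\<rho> by simp
  finally show ?thesis .
qed

text \<open>Dominated convergence. Every kernel has radius at most \<delta>, so all mollifications
  live in the one set \<open>K'\<close>; there they share the bound of \<open>h\<close>, and a
  multiple of the absolute value of \<open>a\<close> on \<open>K'\<close> dominates.\<close>

lemma integral_conv_tendsto: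
  fixes h a :: "real^'n::finite \<Rightarrow> real"
  assumes h: "continuous_on UNIV h" "compact K" "\<And>x. x \<notin> K \<Longrightarrow> h x = 0"
    and K': "K' \<subseteq> D" "\<And>x y. x \<in> K \<Longrightarrow> y \<in> cball 0 \<delta> \<Longrightarrow> x + y \<in> K'" "\<delta> > 0"
    and a: "set_integrable lborel K' a"
    and \<rho>: "\<And>n. continuous_on UNIV (\<rho> n)" "\<And>n x. x \<notin> cball 0 (\<delta> / real (Suc n)) \<Longrightarrow> \<rho> n x = 0"
      "\<And>n x. \<rho> n x \<ge> 0" "\<And>n. (LINT x|lborel. \<rho> n x) = 1"
    and meas: "\<And>n. conv h (\<rho> n) \<in> borel_measurable borel"
  shows "(\<lambda>n. LINT x:D|lborel. a x * conv h (\<rho> n) x) \<longlonglongrightarrow> (LINT x:D|lborel. a x * h x)"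
    and "\<And>n. set_integrable lborel D (\<lambda>x. a x * conv h (\<rho> n) x)"
    and "set_integrable lborel D (\<lambda>x. a x * h x)"
    and "\<And>n x. x \<notin> K' \<Longrightarrow> conv h (\<rho> n) x = 0"
proof -
  have h': "h x = 0" if "x \<notin> K'" for x
    using that h(3) K'(2)[of x 0] K'(3) by force
  show z: "conv h (\<rho> n) x = 0" if "x \<notin> K'" for n x
  proof -
    have "h (x - z) * \<rho> n z = 0" for z
    proof (cases "z \<in> cball 0 \<delta>")
      case True
      then have "x - z \<notin> K" using K'(2)[of "x - z" z] that by auto
      then show ?thesis using h(3) by simp
    next
      case False
      have "\<delta> / real (Suc n) \<le> \<delta>" using K'(3) by (simp add: divide_le_eq)
      then have "z \<notin> cball 0 (\<delta> / real (Suc n))" using False by auto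
      then show ?thesis using \<rho>(2) by simp
    qed
    then show ?thesis by (simp only: conv_def Bochner_Integration.integral_zero)
  qed
  obtain C where C: "C > 0" "\<And>x. \<bar>h x\<bar> \<le> C"
    using bounded_compact_support[OF h] by metis
  have bd: "\<bar>conv h (\<rho> n) x\<bar> \<le> C" for n x
    using conv_bounded[of h 0 C "\<rho> n" x, OF h(1) _ \<rho>(1,2,3,4)] C(2) by simp
  have ia: "integrable lborel (\<lambda>x. indicator K' x * a x)"
    using a by (simp add: set_integrable_def)
  have eq: "(\<lambda>x. indicator D x *\<^sub>R (a x * k x)) = (\<lambda>x. (indicator K' x * a x) * k x)"
    if "\<And>x. x \<notin> K' \<Longrightarrow> k x = 0" for k
    using that K'(1) by (intro ext) (auto simp: indicator_def)
  have int: "integrable lborel (\<lambda>x. indicator D x *\<^sub>R (a x * k x))"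
    if "\<And>x. x \<notin> K' \<Longrightarrow> k x = 0" "k \<in> borel_measurable borel" "\<And>x. \<bar>k x\<bar> \<le> C" for k
  proof -
    have ic: "integrable lborel (\<lambda>x. C * (indicator K' x * a x))" using ia by simp
    have "k \<in> borel_measurable lborel" using that(2) by simp
    with borel_measurable_integrable[OF ia]
    have m: "(\<lambda>x. indicator K' x * a x * k x) \<in> borel_measurable lborel"
      by (rule borel_measurable_times)
    have "AE x in lborel. norm (indicator K' x * a x * k x) \<le> norm (C * (indicator K' x * a x))"
      using that(3) C(1)
      by (intro AE_I2) (auto simp: abs_mult mult.commute[of C] intro!: mult_left_mono)
    from Bochner_Integration.integrable_bound[OF ic m this] show ?thesis
      by (subst eq) (auto simp: that(1))
  qed
  show "set_integrable lborel D (\<lambda>x. a x * conv h (\<rho> n) x)" for n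
    unfolding set_integrable_def by (rule int[OF z meas bd])
  have mh: "h \<in> borel_measurable borel" using h(1) by (rule borel_measurable_continuous_onI)
  show "set_integrable lborel D (\<lambda>x. a x * h x)"
    unfolding set_integrable_def by (rule int[OF h' mh C(2)])
  have eqh: "(\<lambda>x. indicator D x *\<^sub>R (a x * h x)) = (\<lambda>x. (indicator K' x * a x) * h x)"
    by (rule eq) (rule h')
  have eqz: "(\<lambda>x. indicator D x *\<^sub>R (a x * conv h (\<rho> n) x)) = (\<lambda>x. (indicator K' x * a x) * conv h (\<rho> n) x)" for n
    by (rule eq) (rule z)
  have lim: "(\<lambda>n. conv h (\<rho> n) x) \<longlonglongrightarrow> h x" for x
  proof (rule LIMSEQ_I)
    fix e :: real assume "e > 0"
    obtain d where d: "d > 0" "\<And>y. dist y x < d \<Longrightarrow> \<bar>h y - h x\<bar> < e / 2"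
      using h(1) \<open>e > 0\<close> unfolding continuous_on_iff dist_real_def
      by (metis UNIV_I half_gt_zero)
    obtain N where N: "\<delta> / d < real N" using reals_Archimedean2 by blast
    have "norm (conv h (\<rho> n) x - h x) < e" if "n \<ge> N" for n
    proof -
      have "\<delta> / d < real (Suc n)" using N that by simp
      then have dn: "\<delta> / real (Suc n) < d" using d(1) by (simp add: field_simps)
      have "\<bar>h y - h x\<bar> \<le> e / 2 \<or> \<rho> n (x - y) = 0" for y
      proof (cases "dist y x < d")
        case False
        then have "x - y \<notin> cball 0 (\<delta> / real (Suc n))"
          using dn by (simp add: dist_norm norm_minus_commute)
        then show ?thesis using \<rho>(2) by blast
      qed (use d(2) in fastforce)
      then have "\<bar>conv h (\<rho> n) x - h x\<bar> \<le> e / 2"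
        by (rule conv_bounded[OF h(1) _ \<rho>(1,2,3,4)])
      then show ?thesis using \<open>e > 0\<close> by simp
    qed
    then show "\<exists>no. \<forall>n\<ge>no. norm (conv h (\<rho> n) x - h x) < e" by blast
  qed
  show "(\<lambda>n. LINT x:D|lborel. a x * conv h (\<rho> n) x) \<longlonglongrightarrow> (LINT x:D|lborel. a x * h x)"
    unfolding set_lebesgue_integral_def eqh eqz
  proof (rule integral_dominated_convergence)
    show "integrable lborel (\<lambda>x. C * \<bar>indicator K' x * a x\<bar>)" using ia by simp
    show "(\<lambda>x. indicator K' x * a x * h x) \<in> borel_measurable lborel"
      "\<And>n. (\<lambda>x. indicator K' x * a x * conv h (\<rho> n) x) \<in> borel_measurable lborel"
      using mh meas borel_measurable_times[OF borel_measurable_integrable[OF ia], of h]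
        borel_measurable_times[OF borel_measurable_integrable[OF ia], of "conv h (\<rho> _)"]
      by simp_all
    show "AE x in lborel. (\<lambda>n. indicator K' x * a x * conv h (\<rho> n) x) \<longlonglongrightarrow> indicator K' x * a x * h x"
      by (intro AE_I2 tendsto_mult tendsto_const lim)
    show "AE x in lborel. norm (indicator K' x * a x * conv h (\<rho> n) x) \<le> C * \<bar>indicator K' x * a x\<bar>" for n
      using bd by (intro AE_I2) (auto simp: abs_mult mult.commute[of C] intro!: mult_left_mono)
  qed
qed

text \<open>The metric is only \<open>C\<^sup>2\<close>, hence so are the test functions built from it.\<close>

lemma weak_eq_extends_to_C1:
  fixes a :: "real^'n::finite \<Rightarrow> real" and b :: "'n \<Rightarrow> real^'n \<Rightarrow> real"
  assumes "open D"
    and a: "\<And>K. compact K \<Longrightarrow> K \<subseteq> D \<Longrightarrow> set_integrable lborel K a"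
    and b: "\<And>j K. j \<in> J \<Longrightarrow> compact K \<Longrightarrow> K \<subseteq> D \<Longrightarrow> set_integrable lborel K (b j)"
    and weak: "\<And>\<phi>. smooth_on UNIV \<phi> \<Longrightarrow> compact_supp_in D \<phi> \<Longrightarrow>
      (LINT x:D|lborel. a x * \<phi> x) = - (LINT x:D|lborel. (\<Sum>j\<in>J. b j x * pd j \<phi> x))"
    and \<phi>: "Ck (Suc 0) UNIV \<phi>" and K: "compact K" "K \<subseteq> D" "\<And>x. x \<notin> K \<Longrightarrow> \<phi> x = 0"
  shows "(LINT x:D|lborel. a x * \<phi> x) = - (LINT x:D|lborel. (\<Sum>j\<in>J. b j x * pd j \<phi> x))"
    and "\<And>j. j \<in> J \<Longrightarrow> set_integrable lborel D (\<lambda>x. b j x * pd j \<phi> x)"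
proof -
  obtain \<delta> where \<delta>: "\<delta> > 0" "(\<Union>x\<in>K. cball x \<delta>) \<subseteq> D"
    using compact_subset_open_imp_cball_epsilon_subset[OF K(1) assms(1) K(2)] by metis
  define K' where "K' = {x + y |x y. x \<in> K \<and> y \<in> cball 0 \<delta>}"
  have K': "compact K'" unfolding K'_def by (intro compact_sums K(1) compact_cball)
  have K'D: "K' \<subseteq> D"
  proof
    fix z assume "z \<in> K'"
    then obtain x y where "x \<in> K" "y \<in> cball 0 \<delta>" "z = x + y" by (auto simp: K'_def)
    then have "z \<in> cball x \<delta>" by (simp add: dist_norm)
    then show "z \<in> D" using \<delta>(2) \<open>x \<in> K\<close> by blast
  qed
  have K'I: "x + y \<in> K'" if "x \<in> K" "y \<in> cball 0 \<delta>" for x y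
    unfolding K'_def using that by blast
  have "\<exists>\<rho> :: real^'n \<Rightarrow> real. (\<forall>k. Ck k UNIV \<rho>) \<and> (\<forall>x. \<rho> x \<ge> 0) \<and>
      (\<forall>x. x \<notin> cball 0 (\<delta> / real (Suc n)) \<longrightarrow> \<rho> x = 0) \<and> (LINT x|lborel. \<rho> x) = 1" for n
    using mollifier_exists[of "\<delta> / real (Suc n)"] \<delta>(1) by (metis divide_pos_pos of_nat_0_less_iff zero_less_Suc)
  then obtain \<rho> :: "nat \<Rightarrow> real^'n \<Rightarrow> real" where \<rho>: "\<And>n k. Ck k UNIV (\<rho> n)" "\<And>n x. \<rho> n x \<ge> 0"
      "\<And>n x. x \<notin> cball 0 (\<delta> / real (Suc n)) \<Longrightarrow> \<rho> n x = 0" "\<And>n. (LINT x|lborel. \<rho> n x) = 1"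
    by metis
  have c\<rho>: "continuous_on UNIV (\<rho> n)" for n using \<rho>(1) by (rule Ck_imp_continuous_on)
  have c\<phi>: "continuous_on UNIV \<phi>" using \<phi> by (rule Ck_imp_continuous_on)
  have z\<phi>: "pd j \<phi> x = 0" if "x \<notin> K" for j x
    using pd_outside[OF compact_imp_closed[OF K(1)] K(3) that] .
  have meas: "conv h (\<rho> n) \<in> borel_measurable borel"
    if "continuous_on UNIV h" "\<And>x. x \<notin> K \<Longrightarrow> h x = 0" for h n
    using smooth_conv[OF that(1) K(1) that(2) \<rho>(1)] Ck_imp_continuous_on[OF smooth_on_imp_Ck]
    by (metis borel_measurable_continuous_onI)
  have L: "(\<lambda>n. LINT x:D|lborel. a x * conv h (\<rho> n) x) \<longlonglongrightarrow> (LINT x:D|lborel. a x * h x)"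
    "\<And>n. set_integrable lborel D (\<lambda>x. a x * conv h (\<rho> n) x)"
    "set_integrable lborel D (\<lambda>x. a x * h x)"
    "\<And>n x. x \<notin> K' \<Longrightarrow> conv h (\<rho> n) x = 0"
    if "continuous_on UNIV h" "\<And>x. x \<notin> K \<Longrightarrow> h x = 0" "set_integrable lborel K' a" for h a
    using integral_conv_tendsto[of h K K' D \<delta> a \<rho>] that K(1) K'D K'I \<delta>(1) c\<rho> \<rho>(2-4) meas
    by blast+
  note La = L[OF c\<phi> K(3) a[OF K' K'D]]
  have Lb: "(\<lambda>n. LINT x:D|lborel. b j x * conv (pd j \<phi>) (\<rho> n) x) \<longlonglongrightarrow> (LINT x:D|lborel. b j x * pd j \<phi> x)"
    "\<And>n. set_integrable lborel D (\<lambda>x. b j x * conv (pd j \<phi>) (\<rho> n) x)"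
    "set_integrable lborel D (\<lambda>x. b j x * pd j \<phi> x)" if "j \<in> J" for j
    using L[OF Ck_1_continuous_pd[OF \<phi>] z\<phi> b[OF that K' K'D]] by blast+
  then show "\<And>j. j \<in> J \<Longrightarrow> set_integrable lborel D (\<lambda>x. b j x * pd j \<phi> x)" by blast
  \<comment> \<open>The mollified function is smooth with support in \<open>K'\<close>, so the weak
    equation applies to it. The sum is pulled out of the integral because the limit is taken term by
    term.\<close>
  have "(LINT x:D|lborel. a x * conv \<phi> (\<rho> n) x)
      = - (\<Sum>j\<in>J. LINT x:D|lborel. b j x * conv (pd j \<phi>) (\<rho> n) x)" for n
  proof -
    have "compact_supp_in D (conv \<phi> (\<rho> n))"
      unfolding compact_supp_in_def using K' K'D La(4) by blast
    from weak[OF smooth_conv[OF c\<phi> K(1,3) \<rho>(1)] this]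
    have "(LINT x:D|lborel. a x * conv \<phi> (\<rho> n) x)
        = - (LINT x:D|lborel. (\<Sum>j\<in>J. b j x * conv (pd j \<phi>) (\<rho> n) x))"
      using pd_conv[OF \<phi> c\<rho> \<rho>(3)] by simp
    also have "(LINT x:D|lborel. (\<Sum>j\<in>J. b j x * conv (pd j \<phi>) (\<rho> n) x))
        = (\<Sum>j\<in>J. LINT x:D|lborel. b j x * conv (pd j \<phi>) (\<rho> n) x)"
      using Lb(2) unfolding set_lebesgue_integral_def set_integrable_def scaleR_sum_right
    by (intro Bochner_Integration.integral_sum)
    finally show ?thesis .
  qed
  moreover have "(\<lambda>n. - (\<Sum>j\<in>J. LINT x:D|lborel. b j x * conv (pd j \<phi>) (\<rho> n) x))
      \<longlonglongrightarrow> - (\<Sum>j\<in>J. LINT x:D|lborel. b j x * pd j \<phi> x)"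
    by (intro tendsto_intros Lb(1))
  ultimately have "(LINT x:D|lborel. a x * \<phi> x) = - (\<Sum>j\<in>J. LINT x:D|lborel. b j x * pd j \<phi> x)"
    using La(1) LIMSEQ_unique by force
  also have "(\<Sum>j\<in>J. LINT x:D|lborel. b j x * pd j \<phi> x) = (LINT x:D|lborel. (\<Sum>j\<in>J. b j x * pd j \<phi> x))"
    using Lb(3) unfolding set_lebesgue_integral_def set_integrable_def scaleR_sum_right
    by (intro Bochner_Integration.integral_sum[symmetric])
  finally show "(LINT x:D|lborel. a x * \<phi> x) = - (LINT x:D|lborel. (\<Sum>j\<in>J. b j x * pd j \<phi> x))" .
qed

subsection \<open>Gaussian concentration\<close>

text \<open>If \<open>T\<close> were negative at the centre, it would be at most - c on a ball of
  radius r on which \<open>Z\<close> vanishes. The half ball then contributes at most - c v exp (- s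
  r^2 / 4), the rest of the ball is not positive, and what lies outside is at most of order s exp (-
  s r^2). For large s the negative part wins.\<close>

lemma gaussian_concentration:
  fixes T Z :: "real^'n::finite \<Rightarrow> real"
  assumes T: "continuous_on UNIV T" "\<And>x. x \<notin> K \<Longrightarrow> T x = 0"
    and Z: "continuous_on UNIV Z" "\<And>x. x \<notin> K \<Longrightarrow> Z x = 0" "\<And>x. x \<in> ball x\<^sub>0 a \<Longrightarrow> Z x = 0"
    and "compact K" "a > 0"
    and ineq: "\<And>s. s > 0 \<Longrightarrow>
      0 \<le> (LINT x|lborel. exp (- (s * ((x - x\<^sub>0) \<bullet> (x - x\<^sub>0)))) * (2 * s * Z x + T x))"
  shows "T x\<^sub>0 \<ge> 0"
proof (rule ccontr)
  assume "\<not> T x\<^sub>0 \<ge> 0"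
  define c where "c = - T x\<^sub>0 / 2"
  have c: "c > 0" using \<open>\<not> T x\<^sub>0 \<ge> 0\<close> by (simp add: c_def)
  obtain d where d: "d > 0" "\<And>y. dist y x\<^sub>0 < d \<Longrightarrow> \<bar>T y - T x\<^sub>0\<bar> < c"
    using T(1) c unfolding continuous_on_iff dist_real_def by (metis UNIV_I)
  define r where "r = min a d"
  have r: "r > 0" "r \<le> a" using d(1) \<open>a > 0\<close> by (auto simp: r_def)
  have Tc: "T x \<le> - c" if "x \<in> ball x\<^sub>0 r" for x
    using d(2)[of x] that by (auto simp: r_def c_def dist_commute abs_if split: if_splits)
  obtain C1 where C1: "C1 > 0" "\<And>x. \<bar>T x\<bar> \<le> C1"
    using bounded_compact_support[OF T(1) \<open>compact K\<close> T(2)] by metis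
  obtain C2 where C2: "C2 > 0" "\<And>x. \<bar>Z x\<bar> \<le> C2"
    using bounded_compact_support[OF Z(1) \<open>compact K\<close> Z(2)] by metis
  define C where "C = C1 + C2"
  define v where "v = measure lborel (cball x\<^sub>0 (r/2))"
  define V where "V = measure lborel K"
  have v: "v > 0" unfolding v_def using content_cball_pos[of "r/2" x\<^sub>0] r(1) by simp
  have fin: "emeasure lborel (cball x\<^sub>0 (r/2)) < top" "emeasure lborel K < top"
    using emeasure_lborel_cball_finite[of x\<^sub>0 "r/2"]
      emeasure_bounded_finite[OF compact_imp_bounded[OF \<open>compact K\<close>]] by (simp_all add: less_top)
  have K: "K \<in> sets lborel" using \<open>compact K\<close> by (simp add: borel_compact)
  have main: "c * v \<le> (2 * s + 1) * exp (- (3 / 4 * r\<^sup>2 * s)) * (C * V)" if s: "s > 0" for s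
  proof -
    let ?e = "\<lambda>x. exp (- (s * ((x - x\<^sub>0) \<bullet> (x - x\<^sub>0))))"
    \<comment> \<open>Comparing radius r/2 inside with radius r outside leaves the gap r^2 - (r/2)^2
      = 3/4 r^2 between the exponents, which is the rate in \<open>main\<close>.\<close>
    let ?A = "- c * exp (- (s * (r/2)\<^sup>2))" and ?B = "(2 * s + 1) * C * exp (- (s * r\<^sup>2))"
    have B: "?B \<ge> 0" using s C1(1) C2(1) by (simp add: C_def)
    have pt: "?e x * (2 * s * Z x + T x)
        \<le> ?A * indicator (cball x\<^sub>0 (r/2)) x + ?B * indicator K x" for x
    proof (cases "x \<in> ball x\<^sub>0 r")
      case True
      have Z0: "Z x = 0" using True r(2) Z(3) by auto
      show ?thesis
      proof (cases "x \<in> cball x\<^sub>0 (r/2)")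
        case in_small: True
        then have "(norm (x - x\<^sub>0))\<^sup>2 \<le> (r/2)\<^sup>2"
          by (intro power_mono) (auto simp: dist_norm norm_minus_commute)
        then have "exp (- (s * (r/2)\<^sup>2)) \<le> ?e x"
          using s by (simp add: dot_square_norm)
        then have "c * exp (- (s * (r/2)\<^sup>2)) \<le> c * ?e x" using c by simp
        also have "\<dots> \<le> (- T x) * ?e x" using Tc[OF True] by (intro mult_right_mono) auto
        finally show ?thesis using B in_small by (auto simp: Z0 mult.commute indicator_def simp del: power_divide)
      next
        case False
        have "?e x * T x \<le> 0" using Tc[OF True] c by (simp add: mult_nonneg_nonpos)
        then show ?thesis using False B by (auto simp: Z0 indicator_def)
      qed
    next
      case False
      then have "r \<le> norm (x - x\<^sub>0)" by (auto simp: dist_norm norm_minus_commute)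
      then have "r\<^sup>2 \<le> (norm (x - x\<^sub>0))\<^sup>2" using r(1) by (intro power_mono) auto
      then have e: "?e x \<le> exp (- (s * r\<^sup>2))" using s by (simp add: dot_square_norm)
      have "x \<notin> cball x\<^sub>0 (r/2)" using False r(1) by auto
      moreover have "?e x * (2 * s * Z x + T x) \<le> ?B" 
      proof -
        have "2 * s * Z x + T x \<le> 2 * s * C2 + C1"
          using C1(2)[of x] C2(2)[of x] s by (intro add_mono mult_left_mono) auto
        also have "\<dots> \<le> (2 * s + 1) * C" using s C1(1) C2(1) by (simp add: C_def algebra_simps)
        finally have "?e x * (2 * s * Z x + T x) \<le> ?e x * ((2 * s + 1) * C)" by simp
        also have "\<dots> \<le> exp (- (s * r\<^sup>2)) * ((2 * s + 1) * C)"
          using e s C1(1) C2(1) by (intro mult_right_mono) (auto simp: C_def)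
        finally show ?thesis by (simp add: mult_ac)
      qed
      ultimately show ?thesis using T(2) Z(2) by (cases "x \<in> K") auto
    qed
    have i1: "integrable lborel (\<lambda>x. ?A * indicator (cball x\<^sub>0 (r/2)) x)"
      and i2: "integrable lborel (\<lambda>x. ?B * indicator K x)"
      using fin K by (auto intro!: integrable_mult_right integrable_real_indicator)
    have "0 \<le> (LINT x|lborel. ?e x * (2 * s * Z x + T x))" by (rule ineq[OF s])
    also have "\<dots> \<le> (LINT x|lborel. ?A * indicator (cball x\<^sub>0 (r/2)) x + ?B * indicator K x)"
    proof (intro integral_mono pt Bochner_Integration.integrable_add i1 i2)
      show "integrable lborel (\<lambda>x. ?e x * (2 * s * Z x + T x))"
        by (rule integrable_compact_support[OF _ \<open>compact K\<close>])
          (auto intro!: continuous_intros T(1) Z(1) simp: T(2) Z(2))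
    qed
    also have "\<dots> = ?A * v + ?B * V"
      using i1 i2 K by (subst Bochner_Integration.integral_add) (auto simp: v_def V_def)
    finally have "c * v * exp (- (s * (r/2)\<^sup>2)) \<le> ?B * V" by (simp add: algebra_simps)
    moreover have "exp (- (s * r\<^sup>2)) = exp (- (3 / 4 * r\<^sup>2 * s)) * exp (- (s * (r/2)\<^sup>2))"
      by (simp add: exp_add[symmetric] power_divide algebra_simps)
    ultimately have "c * v * exp (- (s * (r/2)\<^sup>2))
        \<le> (2 * s + 1) * exp (- (3 / 4 * r\<^sup>2 * s)) * (C * V) * exp (- (s * (r/2)\<^sup>2))"
      by (simp add: mult_ac)
    then show ?thesis by (rule mult_right_le_imp_le) simp
  qed
  define k where "k = 3 / 4 * r\<^sup>2"
  have k: "k > 0" using r(1) by (simp add: k_def)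
  \<comment> \<open>With y = k s the factor (2 s + 1) exp (- k s) becomes (1 + (2/k) y) exp (- y), a
    polynomial against an exponential.\<close>
  have "((\<lambda>y. poly [:1, 2 / k:] y * exp (- y) * (C * V)) \<longlongrightarrow> 0 * (C * V)) at_top"
    by (intro tendsto_mult tendsto_const poly_div_exp_tendsto_0)
  then have "eventually (\<lambda>y. poly [:1, 2 / k:] y * exp (- y) * (C * V) < c * v) at_top"
    using c v by (intro order_tendstoD(2)) auto
  with eventually_gt_at_top[of 0] obtain y where y: "y > 0"
    "poly [:1, 2 / k:] y * exp (- y) * (C * V) < c * v"
    using eventually_happens[OF eventually_conj] by (metis (mono_tags, lifting) trivial_limit_at_top_linorder)
  have "c * v \<le> (2 * (y / k) + 1) * exp (- (3 / 4 * r\<^sup>2 * (y / k))) * (C * V)"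
    using y(1) k by (intro main) simp
  also have "3 / 4 * r\<^sup>2 * (y / k) = y" using k by (simp add: k_def)
  finally show False using y(2) by (simp add: algebra_simps)
qed

subsection \<open>Exterior algebra\<close>

lemma eps_sq [simp]: "eps i K * eps i K = 1" "eps i K * (eps i K * c) = c"
  by (simp_all add: eps_def power_mult_distrib[symmetric] mult.assoc[symmetric])

text \<open>The rule dx_i wedge dx_j = - dx_j wedge dx_i for coefficients: inserting one index
  raises the count behind the other's sign exactly when it is the smaller one, which happens for one
  of the two orders.\<close>

lemma eps_swap:
  fixes i j :: "'n::{finite,linorder}"
  assumes "i \<noteq> j" "i \<notin> K" "j \<notin> K"
  shows "eps i K * eps j (insert i K) = - (eps j K * eps i (insert j K))"
proof -
  have *: "card {k \<in> insert i K. k < j} = card {k \<in> K. k < j} + (if i < j then 1 else 0)"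
    if "i \<notin> K" for i j
  proof -
    have "{k \<in> insert i K. k < j} = (if i < j then insert i {k \<in> K. k < j} else {k \<in> K. k < j})"
      by auto
    then show ?thesis using that by simp
  qed
  show ?thesis
    unfolding eps_def *[OF assms(2)] *[OF assms(3)]
    using assms(1) by (cases i j rule: linorder_cases) simp_all
qed

text \<open>Pairs of a q-set \<open>J\<close> and a member j correspond to pairs of a (q-1)-set
  \<open>K\<close> and a non-member j by deleting and inserting j. This switches between summing
  over the coefficients of a q-form and over those of its contractions.\<close>

lemma sum_pairs_reindex:
  fixes F :: "'n::finite set \<Rightarrow> 'n \<Rightarrow> real"
  assumes "1 \<le> q"
  shows "(\<Sum>J\<in>{J. card J = q}. \<Sum>j\<in>J. F (J - {j}) j) = (\<Sum>K\<in>{K. card K = q - 1}. \<Sum>j\<in>- K. F K j)"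
proof -
  have "(\<Sum>J\<in>{J. card J = q}. \<Sum>j\<in>J. F (J - {j}) j)
      = (\<Sum>(J, j)\<in>(SIGMA J:{J. card J = q}. J). F (J - {j}) j)"
    by (rule sum.Sigma) auto
  also have "\<dots> = (\<Sum>(K, j)\<in>(SIGMA K:{K. card K = q - 1}. - K). F K j)"
    using assms
    by (intro sum.reindex_bij_witness[of _ "\<lambda>(K, j). (insert j K, j)" "\<lambda>(J, j). (J - {j}, j)"])
      (auto simp: insert_absorb)
  also have "\<dots> = (\<Sum>K\<in>{K. card K = q - 1}. \<Sum>j\<in>- K. F K j)"
    by (rule sum.Sigma[symmetric]) auto
  finally show ?thesis .
qed

text \<open>\<open>ctr \<alpha> K j\<close> is the \<open>dx\<^sub>K\<close> coefficient of the contraction of \<open>\<alpha>\<close> with the \<open>j\<close>-th coordinate field.\<close>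

definition ctr :: "('n::{finite,linorder} set \<Rightarrow> 'r::finite \<Rightarrow> real) \<Rightarrow> 'n set \<Rightarrow> 'n \<Rightarrow> real^'r" where
  "ctr \<alpha> K j = (if j \<in> K then 0 else eps j K *\<^sub>R (\<chi> \<tau>. \<alpha> (insert j K) \<tau>))"

lemma sum_ctr_reindex:
  assumes "1 \<le> q" and F0: "\<And>K j. F K j 0 = 0"
  shows "(\<Sum>K\<in>{K. card K = q - 1}. \<Sum>j\<in>UNIV. F K j (ctr \<alpha> K j))
    = (\<Sum>J\<in>{J. card J = q}. \<Sum>j\<in>J. F (J - {j}) j (eps j (J - {j}) *\<^sub>R (\<chi> \<tau>. \<alpha> J \<tau>)) :: real)"
proof -
  have "(\<Sum>J\<in>{J. card J = q}. \<Sum>j\<in>J. F (J - {j}) j (eps j (J - {j}) *\<^sub>R (\<chi> \<tau>. \<alpha> J \<tau>)))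
      = (\<Sum>J\<in>{J. card J = q}. \<Sum>j\<in>J. F (J - {j}) j (ctr \<alpha> (J - {j}) j))"
    by (intro sum.cong refl) (simp add: ctr_def insert_absorb)
  also have "\<dots> = (\<Sum>K\<in>{K. card K = q - 1}. \<Sum>j\<in>- K. F K j (ctr \<alpha> K j))"
    by (rule sum_pairs_reindex[OF assms(1)])
  also have "\<dots> = (\<Sum>K\<in>{K. card K = q - 1}. \<Sum>j\<in>UNIV. F K j (ctr \<alpha> K j))"
    by (intro sum.cong refl sum.mono_neutral_left) (auto simp: ctr_def F0)
  finally show ?thesis by simp
qed

lemma inner_g_eq:
  "inner_g q G \<alpha> \<beta> = (\<Sum>J\<in>{J. card J = q}. (\<chi> \<tau>. \<alpha> J \<tau>) \<bullet> (G *v (\<chi> \<tau>. \<beta> J \<tau>)))"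
  by (simp add: inner_g_def inner_vec_def matrix_vector_mult_def sum_distrib_left mult_ac)

lemma inner_g_divide: "inner_g q G (\<lambda>J \<tau>. \<alpha> J \<tau> / c) \<beta> = inverse c * inner_g q G \<alpha> \<beta>"
  by (simp add: inner_g_def sum_distrib_left divide_inverse mult_ac)

text \<open>Each set of cardinality q arises from exactly q pairs (K, j), and the signs square to 1.
  This is the source of the factor q in 2 s q.\<close>

lemma sum_ctr_inner_g:
  assumes "1 \<le> q"
  shows "(\<Sum>K\<in>{K. card K = q - 1}. \<Sum>j\<in>UNIV. ctr \<alpha> K j \<bullet> (G *v ctr \<alpha> K j)) = q * inner_g q G \<alpha> \<alpha>"
  by (subst sum_ctr_reindex[OF assms])
    (simp_all add: matrix_vector_mult_scaleR inner_g_eq sum_distrib_left)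

text \<open>Wedging with dx_i is adjoint to contraction with the i-th coordinate field, so the form
  <c_ij dx_i wedge (d/dx_j contract \<alpha>), \<alpha>> becomes a bilinear expression in the
  contractions of \<alpha> alone. The index pairs left out of \<open>form_op\<close> contribute zero
  contractions.\<close>

lemma inner_form_op:
  assumes "1 \<le> q"
  shows "inner_g q G (form_op c q \<alpha>) \<alpha> = (\<Sum>K\<in>{K. card K = q - 1}. \<Sum>i\<in>UNIV. \<Sum>j\<in>UNIV.
      ((\<chi> \<tau> \<xi>. c i j \<tau> \<xi>) *v ctr \<alpha> K j) \<bullet> (G *v ctr \<alpha> K i))"
proof -
  define V where "V K i = (\<Sum>j\<in>UNIV. (\<chi> \<tau> \<xi>. c i j \<tau> \<xi>) *v ctr \<alpha> K j)" for K i
  have op: "(\<chi> \<tau>. form_op c q \<alpha> J \<tau>) = (\<Sum>i\<in>J. eps i (J - {i}) *\<^sub>R V (J - {i}) i)" if "card J = q" for J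
  proof -
    have "(\<Sum>j\<in>UNIV - (J - {i}). \<Sum>\<xi>\<in>UNIV.
        c i j \<tau> \<xi> * eps i (J - {i}) * eps j (J - {i}) * \<alpha> (insert j (J - {i})) \<xi>)
        = eps i (J - {i}) * V (J - {i}) i $ \<tau>" for i \<tau>
    proof -
      have "V (J - {i}) i $ \<tau> = (\<Sum>j\<in>UNIV. \<Sum>\<xi>\<in>UNIV. c i j \<tau> \<xi> * ctr \<alpha> (J - {i}) j $ \<xi>)"
        by (simp add: V_def matrix_vector_mult_def)
      also have "\<dots> = (\<Sum>j\<in>UNIV - (J - {i}). \<Sum>\<xi>\<in>UNIV. c i j \<tau> \<xi> * ctr \<alpha> (J - {i}) j $ \<xi>)"
      proof (intro sum.mono_neutral_right ballI sum.neutral)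
        fix j \<xi> assume "j \<in> UNIV - (UNIV - (J - {i}))"
        then have "ctr \<alpha> (J - {i}) j = 0" by (simp add: ctr_def)
        then show "c i j \<tau> \<xi> * ctr \<alpha> (J - {i}) j $ \<xi> = 0" by simp
      qed auto
      also have "\<dots> = (\<Sum>j\<in>UNIV - (J - {i}). \<Sum>\<xi>\<in>UNIV.
          c i j \<tau> \<xi> * (eps j (J - {i}) * \<alpha> (insert j (J - {i})) \<xi>))"
        by (intro sum.cong refl) (auto simp: ctr_def)
      finally show ?thesis by (simp add: sum_distrib_left mult_ac)
    qed
    then show ?thesis using that by (simp add: vec_eq_iff form_op_def)
  qed
  have "inner_g q G (form_op c q \<alpha>) \<alpha> = (\<Sum>J\<in>{J. card J = q}. \<Sum>i\<in>J.
      V (J - {i}) i \<bullet> (G *v (eps i (J - {i}) *\<^sub>R (\<chi> \<tau>. \<alpha> J \<tau>))))"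
    unfolding inner_g_eq by (intro sum.cong refl) (simp add: op inner_sum_left matrix_vector_mult_scaleR)
  also have "\<dots> = (\<Sum>K\<in>{K. card K = q - 1}. \<Sum>i\<in>UNIV. V K i \<bullet> (G *v ctr \<alpha> K i))"
    by (rule sum_ctr_reindex[OF assms, symmetric]) simp
  finally show ?thesis by (simp add: V_def inner_sum_left)
qed

text \<open>For a fixed \<open>J\<close> every i in \<open>J\<close> reproduces the coefficient
  once, through j = i with squared sign: the operator counts the degree.\<close>

lemma form_op_scalar:
  assumes "\<And>i j \<tau> \<xi>. c i j \<tau> \<xi> = (if i = j \<and> \<tau> = \<xi> then l else 0)"
  shows "form_op c q \<beta> J \<tau> = (if card J = q then l * q * \<beta> J \<tau> else 0)"
proof -
  have "(\<Sum>j\<in>UNIV - (J - {i}). \<Sum>\<xi>\<in>UNIV.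
      c i j \<tau> \<xi> * eps i (J - {i}) * eps j (J - {i}) * \<beta> (insert j (J - {i})) \<xi>) = l * \<beta> J \<tau>"
    if "i \<in> J" for i
  proof -
    have "(\<Sum>j\<in>UNIV - (J - {i}). \<Sum>\<xi>\<in>UNIV.
        c i j \<tau> \<xi> * eps i (J - {i}) * eps j (J - {i}) * \<beta> (insert j (J - {i})) \<xi>)
        = (\<Sum>j\<in>UNIV - (J - {i}). if i = j then l * \<beta> J \<tau> else 0)"
    proof (intro sum.cong refl)
      fix j
      have "(\<Sum>\<xi>\<in>UNIV. c i j \<tau> \<xi> * eps i (J - {i}) * eps j (J - {i}) * \<beta> (insert j (J - {i})) \<xi>)
          = (\<Sum>\<xi>\<in>UNIV. if \<tau> = \<xi> then (if i = j then l * \<beta> J \<tau> else 0) else 0)"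
        using that by (intro sum.cong refl) (auto simp: assms insert_absorb mult.assoc)
      then show "(\<Sum>\<xi>\<in>UNIV. c i j \<tau> \<xi> * eps i (J - {i}) * eps j (J - {i}) * \<beta> (insert j (J - {i})) \<xi>)
          = (if i = j then l * \<beta> J \<tau> else 0)" by simp
    qed
    then show ?thesis by simp
  qed
  then show ?thesis by (simp add: form_op_def)
qed

text \<open>On q-forms the Hessian operator is multiplication by l q, which is nonzero. In other
  degrees it returns 0, and uniqueness there comes from the condition
  \<open>is_form q \<beta>\<close> in the description of the inverse.\<close>

lemma hess_inv_scalar:
  assumes "\<And>i j. pd i (pd j \<psi>) x = (if i = j then l else 0)" and "l \<noteq> 0" "1 \<le> q"
    and "is_form q \<alpha>"
  shows "hess_inv \<psi> q x \<alpha> = (\<lambda>J \<tau>. \<alpha> J \<tau> / (l * q))"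
proof -
  have op: "form_op (hess_coef \<psi> x) q \<beta> J \<tau> = (if card J = q then l * q * \<beta> J \<tau> else 0)" for \<beta> J \<tau>
    by (rule form_op_scalar) (simp add: hess_coef_def assms(1))
  have lq: "l * q \<noteq> 0" using assms(2,3) by simp
  show ?thesis
    unfolding hess_inv_def
  proof (rule the_equality)
    show "is_form q (\<lambda>J \<tau>. \<alpha> J \<tau> / (l * q)) \<and> form_op (hess_coef \<psi> x) q (\<lambda>J \<tau>. \<alpha> J \<tau> / (l * q)) = \<alpha>"
      using assms(4) lq by (auto simp: is_form_def op fun_eq_iff)
  next
    fix \<beta> assume \<beta>: "is_form q \<beta> \<and> form_op (hess_coef \<psi> x) q \<beta> = \<alpha>"
    show "\<beta> = (\<lambda>J \<tau>. \<alpha> J \<tau> / (l * q))"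
    proof (intro ext)
      fix J \<tau>
      have "\<alpha> J \<tau> = (if card J = q then l * q * \<beta> J \<tau> else 0)" using \<beta> op by metis
      then show "\<beta> J \<tau> = \<alpha> J \<tau> / (l * q)" using \<beta> lq by (auto simp: is_form_def)
    qed
  qed
qed

subsection \<open>Functions with commuting second derivatives\<close>

text \<open>A class closed under the operations building the cut-off forms below; it replaces Schwarz's
  theorem on mixed partial derivatives.\<close>

definition smooth_sym :: "(real^'n::finite \<Rightarrow> real) \<Rightarrow> bool" where
  "smooth_sym f \<longleftrightarrow> smooth_on UNIV f \<and> (\<forall>i j x. pd i (pd j f) x = pd j (pd i f) x)"

lemma smooth_differentiable:
  assumes "smooth_on UNIV f"
  shows "f differentiable (at x)" "pd j f differentiable (at x)"
  using assms Ck_1_differentiable[of f x] Ck_1_differentiable[of "pd j f" x]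
    Ck_pd[of "Suc 0" UNIV f j] by (auto simp: smooth_on_def simp del: Ck.simps)

lemma smooth_sym_const: "smooth_sym (\<lambda>x. c)"
proof -
  have "pd j (\<lambda>x. c) = (\<lambda>x. 0)" for j :: 'a by auto
  then show ?thesis by (simp add: smooth_sym_def smooth_on_def Ck_const)
qed

lemma smooth_sym_component: "smooth_sym (\<lambda>x. x $ k)"
proof -
  have "pd j (\<lambda>x. x $ k) = (\<lambda>x. if k = j then 1 else 0)" for j by (auto simp: pd_component)
  then show ?thesis by (simp add: smooth_sym_def smooth_on_def Ck_component)
qed

lemma smooth_sym_add:
  assumes "smooth_sym f" "smooth_sym g"
  shows "smooth_sym (\<lambda>x. f x + g x)"
proof -
  have s: "smooth_on UNIV f" "smooth_on UNIV g" using assms by (simp_all add: smooth_sym_def)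
  note d = smooth_differentiable[OF s(1)] smooth_differentiable[OF s(2)]
  have "pd j (\<lambda>x. f x + g x) = (\<lambda>x. pd j f x + pd j g x)" for j
    by (intro ext pd_add d)
  then show ?thesis
    using assms by (simp add: smooth_sym_def smooth_on_def pd_add d Ck_add)
qed

lemma smooth_sym_mult:
  assumes "smooth_sym f" "smooth_sym g"
  shows "smooth_sym (\<lambda>x. f x * g x)"
proof -
  have s: "smooth_on UNIV f" "smooth_on UNIV g" using assms by (simp_all add: smooth_sym_def)
  note d = smooth_differentiable[OF s(1)] smooth_differentiable[OF s(2)]
  have 1: "pd j (\<lambda>x. f x * g x) = (\<lambda>x. f x * pd j g x + pd j f x * g x)" for j
    by (intro ext pd_mult d)
  have "pd i (\<lambda>x. f x * pd j g x + pd j f x * g x) x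
      = f x * pd i (pd j g) x + pd i f x * pd j g x + (pd j f x * pd i g x + pd i (pd j f) x * g x)" for i j x
    by (simp add: pd_add pd_mult d)
  then show ?thesis
    using assms by (simp add: smooth_sym_def smooth_on_def 1 Ck_mult)
qed

lemma smooth_sym_sum:
  assumes "\<And>i. i \<in> I \<Longrightarrow> smooth_sym (f i)"
  shows "smooth_sym (\<lambda>x. \<Sum>i\<in>I. f i x)"
  using assms
proof (induction I rule: infinite_finite_induct)
  case (insert a I)
  then have "smooth_sym (\<lambda>x. f a x + (\<Sum>i\<in>I. f i x))" by (intro smooth_sym_add) auto
  then show ?case using insert by simp
qed (simp_all add: smooth_sym_const)

lemma smooth_sym_flat:
  assumes "smooth_sym f"
  shows "smooth_sym (\<lambda>x. flat p (f x))"
proof -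
  have s: "smooth_on UNIV f" using assms by (simp add: smooth_sym_def)
  note d = smooth_differentiable[OF s]
  define p' where "p' p = monom 1 2 * (p - pderiv p)" for p :: "real poly"
  have 1: "pd j (\<lambda>x. flat p (f x)) = (\<lambda>x. flat (p' p) (f x) * pd j f x)" for j p
    unfolding p'_def by (intro ext pd_compose flat_has_derivative d)
  have k: "Ck k UNIV (\<lambda>x. flat p (f x))" for k p
    using s by (intro Ck_flat) (auto simp: smooth_on_def)
  have "pd i (\<lambda>x. flat (p' p) (f x) * pd j f x) x
      = flat (p' p) (f x) * pd i (pd j f) x + flat (p' (p' p)) (f x) * pd i f x * pd j f x" for i j x
    by (simp add: pd_mult d Ck_1_differentiable[OF k] 1)
  then show ?thesis
    using assms k by (simp add: smooth_sym_def smooth_on_def 1)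
qed

lemma smooth_on_pd: "smooth_on UNIV f \<Longrightarrow> smooth_on UNIV (pd j f)"
  unfolding smooth_on_def using Ck_pd by blast

subsection \<open>Closed forms with constant germ\<close>

text \<open>In the double sum over ordered pairs from \<open>J\<close> the summand is antisymmetric:
  the signs anticommute by \<open>eps_swap\<close> and the second derivatives commute by
  \<open>smooth_sym\<close>.\<close>

lemma dform_dform:
  fixes \<beta> :: "real^('n::{finite,linorder}) \<Rightarrow> 'n set \<Rightarrow> 'r::finite \<Rightarrow> real"
  assumes \<beta>: "\<And>K \<tau>. smooth_sym (\<lambda>x. \<beta> x K \<tau>)"
  shows "dform (p + 1) (dform p \<beta>) x J \<tau> = 0"
proof (cases "card J = p + 2")
  case True
  define b where "b K = (\<lambda>x. \<beta> x K \<tau>)" for K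
  have b: "smooth_sym (b K)" for K using \<beta> by (simp add: b_def)
  have s: "smooth_on UNIV (b K)" for K using b by (simp add: smooth_sym_def)
  define A where "A j i = eps j (J - {j}) * eps i (J - {j} - {i}) * pd j (pd i (b (J - {j} - {i}))) x" for j i
  have "eps j (J - {j}) * pd j (\<lambda>y. dform p \<beta> y (J - {j}) \<tau>) x = (\<Sum>i\<in>J - {j}. A j i)" if "j \<in> J" for j
  proof -
    have "card (J - {j}) = p + 1" using that True by simp
    then have "(\<lambda>y. dform p \<beta> y (J - {j}) \<tau>)
        = (\<lambda>y. \<Sum>i\<in>J - {j}. eps i (J - {j} - {i}) * pd i (b (J - {j} - {i})) y)"
      by (simp add: dform_def b_def)
    then show ?thesis
      by (simp add: pd_sum pd_cmult smooth_differentiable(2)[OF s] sum_distrib_left A_def mult.assoc)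
  qed
  then have "dform (p + 1) (dform p \<beta>) x J \<tau> = (\<Sum>j\<in>J. \<Sum>i\<in>J - {j}. A j i)"
    using True by (simp add: dform_def)
  \<comment> \<open>Putting 0 on the diagonal makes both index sets equal to \<open>J\<close>, so
    the sums can be exchanged; the double sum then equals its own negative.\<close>
  also have "\<dots> = (\<Sum>j\<in>J. \<Sum>i\<in>J. if i = j then 0 else A j i)"
    by (rule sum.cong[OF refl], rule sum.mono_neutral_cong_left) auto
  finally have 1: "dform (p + 1) (dform p \<beta>) x J \<tau> = (\<Sum>j\<in>J. \<Sum>i\<in>J. if i = j then 0 else A j i)" .
  have anti: "A j i = - A i j" if "i \<in> J" "j \<in> J" "i \<noteq> j" for i j
  proof -
    have e: "J - {j} = insert i (J - {i, j})" "J - {i} = insert j (J - {i, j})"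
      "J - {j} - {i} = J - {i, j}" "J - {i} - {j} = J - {i, j}" using that by auto
    define L where "L = J - {i, j}"
    have "A j i = eps i L * eps j (insert i L) * pd j (pd i (b L)) x"
      unfolding A_def unfolding e(3) unfolding e(1) L_def[symmetric] by (simp only: mult.commute mult.left_commute)
    also have "eps i L * eps j (insert i L) = - (eps j L * eps i (insert j L))"
      using that by (intro eps_swap) (auto simp: L_def)
    also have "pd j (pd i (b L)) x = pd i (pd j (b L)) x"
      using b[of L] unfolding smooth_sym_def by blast
    also have "- (eps j L * eps i (insert j L)) * pd i (pd j (b L)) x = - A i j"
      unfolding A_def unfolding e(4) unfolding e(2) L_def[symmetric] by (simp only: mult.commute mult.left_commute mult_minus_left mult_minus_right)
    finally show ?thesis .
  qed
  have "(\<Sum>j\<in>J. \<Sum>i\<in>J. if i = j then 0 else A j i)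
      = (\<Sum>j\<in>J. \<Sum>i\<in>J. - (if j = i then 0 else A i j))"
  proof (intro sum.cong refl)
    fix j i assume "j \<in> J" "i \<in> J"
    with anti[of i j] show "(if i = j then 0 else A j i) = - (if j = i then 0 else A i j)"
      by (cases "i = j") simp_all
  qed
  also have "\<dots> = (\<Sum>i\<in>J. \<Sum>j\<in>J. - (if j = i then 0 else A i j))"
    by (rule sum.swap)
  also have "\<dots> = - (\<Sum>i\<in>J. \<Sum>j\<in>J. if j = i then 0 else A i j)"
    by (simp only: sum_negf)
  finally show ?thesis using 1 by simp
qed (simp add: dform_def)

lemma cutoff_exists:
  fixes x\<^sub>0 :: "real^'n::finite"
  assumes "R > 0"
  obtains \<kappa> where "smooth_sym \<kappa>" "\<And>x. x \<notin> cball x\<^sub>0 R \<Longrightarrow> \<kappa> x = 0" "\<And>x. x \<in> ball x\<^sub>0 (R / 2) \<Longrightarrow> \<kappa> x = 1"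
proof -
  define e where "e = R\<^sup>2 / 2"
  have e: "e > 0" using assms by (simp add: e_def)
  define N where "N x = (\<Sum>i\<in>UNIV. (x $ i + - x\<^sub>0 $ i) * (x $ i + - x\<^sub>0 $ i))" for x
  have N: "N x = (norm (x - x\<^sub>0))\<^sup>2" for x
    by (simp add: N_def power2_norm_eq_inner inner_vec_def)
  define c where "c = flat 1 (flat 1 e)"
  have c: "c > 0" unfolding c_def by (intro flat_1_pos e)
  \<comment> \<open>The inner term \<open>flat 1 (N x + - e)\<close> is 0 for
    \<open>N x \<le> e\<close>, where the outer argument is the constant \<open>flat 1 e\<close> and
    the value is 1. For \<open>N x \<ge> 2 * e\<close>, that is beyond radius \<open>R\<close>, it
    is at least \<open>flat 1 e\<close>, so the outer function vanishes. Nesting two flat functions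
    uses only sums, products and \<open>flat\<close>, under which \<open>smooth_sym\<close> is
    stable.\<close>
  define \<kappa> where "\<kappa> x = inverse c * flat 1 (flat 1 e + -1 * flat 1 (N x + - e))" for x
  show ?thesis
  proof (rule that[of \<kappa>])
    show "smooth_sym \<kappa>"
      unfolding \<kappa>_def N_def
      by (intro smooth_sym_mult smooth_sym_flat smooth_sym_add smooth_sym_sum smooth_sym_const
          smooth_sym_component)
    show "\<kappa> x = 0" if "x \<notin> cball x\<^sub>0 R" for x
    proof -
      have "R \<le> norm (x - x\<^sub>0)" using that by (auto simp: dist_norm norm_minus_commute)
      then have "R\<^sup>2 \<le> N x" unfolding N using assms by (intro power_mono) auto
      then have "e \<le> N x - e" by (simp add: e_def)
      from flat_1_mono[OF e this] show ?thesis by (simp add: \<kappa>_def flat_1_nonpos)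
    qed
    show "\<kappa> x = 1" if "x \<in> ball x\<^sub>0 (R / 2)" for x
    proof -
      have "norm (x - x\<^sub>0) \<le> R / 2" using that by (auto simp: dist_norm norm_minus_commute)
      then have "N x \<le> (R / 2)\<^sup>2" unfolding N by (intro power_mono) auto
      moreover have "(R / 2)\<^sup>2 = R\<^sup>2 / 4" by (simp add: power_divide)
      ultimately have "N x \<le> e" using zero_le_power2[of R] unfolding e_def by linarith
      then show ?thesis using c by (simp add: \<kappa>_def flat_1_nonpos c_def)
    qed
  qed
qed

text \<open>A primitive of a constant form \<open>\<xi>\<close> is \<open>1/q\<close> times its contraction with the Euler field.\<close>

lemma closed_form_with_constant_germ:
  fixes \<xi> :: "'n::{finite,linorder} set \<Rightarrow> 'r::finite \<Rightarrow> real" and x\<^sub>0 :: "real^('n::{finite,linorder})"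
  assumes "1 \<le> q" "is_form q \<xi>" "R > 0" "cball x\<^sub>0 R \<subseteq> D"
  obtains f where "closed_test_form D q f" "\<And>x. x \<in> ball x\<^sub>0 (R / 2) \<Longrightarrow> f x = \<xi>"
    "\<And>x I \<tau>. x \<notin> cball x\<^sub>0 R \<Longrightarrow> f x I \<tau> = 0"
proof -
  obtain \<kappa> where \<kappa>: "smooth_sym \<kappa>" "\<And>x. x \<notin> cball x\<^sub>0 R \<Longrightarrow> \<kappa> x = 0"
    "\<And>x. x \<in> ball x\<^sub>0 (R / 2) \<Longrightarrow> \<kappa> x = 1"
    using cutoff_exists[OF assms(3)] by metis
  define l where "l K \<tau> x = (\<Sum>j\<in>- K. (eps j K * \<xi> (insert j K) \<tau> / q) * (x $ j + - x\<^sub>0 $ j))" for K \<tau> x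
  define \<beta> where "\<beta> x K \<tau> = l K \<tau> x * \<kappa> x" for x K \<tau>
  have l: "smooth_sym (l K \<tau>)" for K \<tau>
    unfolding l_def
    by (intro smooth_sym_mult smooth_sym_add smooth_sym_sum smooth_sym_const smooth_sym_component)
  have \<beta>: "smooth_sym (\<lambda>x. \<beta> x K \<tau>)" for K \<tau>
    unfolding \<beta>_def by (intro smooth_sym_mult l \<kappa>(1))
  have pdl: "pd j (l K \<tau>) x = eps j K * \<xi> (insert j K) \<tau> / q" if "j \<notin> K" for j K \<tau> x
  proof -
    have d: "(\<lambda>x. x $ i) differentiable (at x)" for i :: 'n
      by (rule differentiableI[OF has_derivative_component])
    have d': "(\<lambda>x. x $ i + - x\<^sub>0 $ i) differentiable (at x)" for i
      by (rule differentiable_add[OF d differentiable_const])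
    have p: "pd j (\<lambda>x. x $ i + - x\<^sub>0 $ i) x = (if i = j then 1 else 0)" for i
      using pd_add[OF d differentiable_const[of "- x\<^sub>0 $ i"], of j i] by (simp add: pd_component)
    have "pd j (l K \<tau>) x = (\<Sum>i\<in>- K. pd j (\<lambda>x. (eps i K * \<xi> (insert i K) \<tau> / q) * (x $ i + - x\<^sub>0 $ i)) x)"
      unfolding l_def by (rule pd_sum) (rule differentiable_mult[OF differentiable_const d'])
    also have "\<dots> = (\<Sum>i\<in>- K. (eps i K * \<xi> (insert i K) \<tau> / q) * (if i = j then 1 else 0))"
      by (simp only: pd_cmult[OF d'] p)
    also have "\<dots> = (\<Sum>i\<in>- K. if i = j then eps j K * \<xi> (insert j K) \<tau> / q else 0)"
      by (intro sum.cong refl) auto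
    finally show ?thesis using that by simp
  qed
  \<comment> \<open>The cut-off sits on the primitive, so \<open>f\<close> is exact and hence
    closed. The degree shift q - 1 is inverted later by means of \<open>1 \<le> q\<close>.\<close>
  define f where "f = dform (q - 1) \<beta>"
  have supp: "f x I \<tau> = 0" if "x \<notin> cball x\<^sub>0 R" for x I \<tau>
  proof -
    have "pd j (\<lambda>y. \<beta> y (I - {j}) \<tau>) x = 0" for j
      by (rule pd_outside[OF closed_cball[of x\<^sub>0 R] _ that]) (simp add: \<beta>_def \<kappa>(2))
    then show ?thesis by (simp add: f_def dform_def)
  qed
  have pd\<beta>: "Ck k UNIV (pd j (\<lambda>y. \<beta> y K \<tau>))" for k j K \<tau>
    using \<beta>[of K \<tau>] smooth_on_pd[of "\<lambda>y. \<beta> y K \<tau>" j] by (simp add: smooth_sym_def smooth_on_def)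
  have "closed_test_form D q f"
    unfolding closed_test_form_def
  proof (intro conjI allI ballI)
    show "is_form q (f x)" for x using assms(1) by (auto simp: f_def is_form_def dform_def)
    show "smooth_on UNIV (\<lambda>x. f x I \<tau>)" for I \<tau>
    proof (cases "card I = q")
      case True
      have "smooth_on UNIV (\<lambda>x. \<Sum>j\<in>I. eps j (I - {j}) * pd j (\<lambda>y. \<beta> y (I - {j}) \<tau>) x)"
        unfolding smooth_on_def by (intro allI Ck_sum Ck_cmult open_UNIV pd\<beta>)
      then show ?thesis using True assms(1) by (simp add: f_def dform_def)
    next
      case False
      then show ?thesis using assms(1) by (simp add: f_def dform_def smooth_on_def Ck_const)
    qed
    show "\<exists>K. compact K \<and> K \<subseteq> D \<and> (\<forall>x I \<tau>. x \<notin> K \<longrightarrow> f x I \<tau> = 0)"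
      using supp assms(4) by (intro exI[of _ "cball x\<^sub>0 R"]) simp
    show "dform q f x J \<tau> = 0" for x J \<tau>
      using dform_dform[where \<beta> = \<beta> and p = "q - 1", OF \<beta>] assms(1) by (simp add: f_def)
  qed
  moreover have "f x = \<xi>" if "x \<in> ball x\<^sub>0 (R / 2)" for x
  proof (intro ext)
    fix I \<tau>
    show "f x I \<tau> = \<xi> I \<tau>"
    proof (cases "card I = q")
      case True
      \<comment> \<open>Near the centre each of the q indices j in \<open>I\<close> returns the
        coefficient of \<xi> divided by q once its sign is squared, so they add up to that
        coefficient.\<close>
      have "pd j (\<lambda>y. \<beta> y (I - {j}) \<tau>) x = eps j (I - {j}) * \<xi> I \<tau> / q" if j: "j \<in> I" for j
      proof -
        have "pd j (\<lambda>y. \<beta> y (I - {j}) \<tau>) x = pd j (l (I - {j}) \<tau>) x"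
          using \<open>x \<in> ball x\<^sub>0 (R / 2)\<close>
          by (intro pd_cong_open[OF open_ball[of x\<^sub>0 "R / 2"]]) (simp_all add: \<beta>_def \<kappa>(3))
        then show ?thesis using j by (simp add: pdl insert_absorb)
      qed
      then show ?thesis using True assms(1) by (simp add: f_def dform_def)
    next
      case False
      then show ?thesis using assms(1,2) by (simp add: f_def dform_def is_form_def)
    qed
  qed
  ultimately show ?thesis using supp by (rule that)
qed

subsection \<open>Matrix-valued functions\<close>

lemma matrix_inv_mult:
  fixes A :: "real^'r^'r"
  assumes "invertible A"
  shows "A ** matrix_inv A = mat 1" "matrix_inv A ** A = mat 1"
  using assms someI_ex[of "\<lambda>B. A ** B = mat 1 \<and> B ** A = mat 1"]
  unfolding matrix_inv_def invertible_def by blast+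

lemma matrix_minus_right: "A ** (- C) = - (A ** C)" for A :: "real^'b::finite^'a::finite"
  and C :: "real^'c::finite^'b"
  by (simp add: vec_eq_iff matrix_matrix_mult_def sum_negf)

lemma matrix_minus_left: "(- A) ** C = - (A ** C)" for A :: "real^'b::finite^'a::finite"
  and C :: "real^'c::finite^'b"
  by (simp add: vec_eq_iff matrix_matrix_mult_def sum_negf)

lemma matrix_vector_minus_left: "(- A) *v v = - (A *v v)" for A :: "real^'b::finite^'a::finite"
  by (simp add: vec_eq_iff matrix_vector_mult_def sum_negf)

lemma Ck_det:
  fixes A :: "real^'n::finite \<Rightarrow> real^'r::finite^'r"
  assumes "open S" "\<And>a b. Ck k S (\<lambda>x. A x $ a $ b)"
  shows "Ck k S (\<lambda>x. det (A x))"
  unfolding det_def by (intro Ck_sum Ck_cmult Ck_prod assms)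

text \<open>By Cramer's rule an entry of the inverse is a quotient of two determinants, and
  determinants are polynomial in the entries.\<close>

lemma Ck_matrix_inv:
  fixes A :: "real^'n::finite \<Rightarrow> real^'r::finite^'r"
  assumes S: "open S" and A: "\<And>a b. Ck k S (\<lambda>x. A x $ a $ b)" and inv: "\<And>x. x \<in> S \<Longrightarrow> invertible (A x)"
  shows "Ck k S (\<lambda>x. matrix_inv (A x) $ a $ b)"
proof -
  \<comment> \<open>The matrix of Cramer's rule: \<open>A x\<close> with column \<open>a\<close>
    replaced by the basis vector of index \<open>b\<close>.\<close>
  define C where "C x = (\<chi> i j. if j = a then axis b 1 $ i else A x $ i $ j)" for x
  have "matrix_inv (A x) $ a $ b = det (C x) * inverse (det (A x))" if "x \<in> S" for x
  proof -
    have d: "det (A x) \<noteq> 0" using inv[OF that] by (simp add: invertible_det_nz)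
    have "A x *v (matrix_inv (A x) *v axis b 1) = axis b 1"
      using matrix_inv_mult(1)[OF inv[OF that]] by (simp add: matrix_vector_mul_assoc)
    then have "matrix_inv (A x) *v axis b 1
        = (\<chi> k. det (\<chi> i j. if j = k then axis b 1 $ i else A x $ i $ j) / det (A x))"
      using cramer[OF d] by blast
    from arg_cong[OF this, of "\<lambda>v. v $ a"] show ?thesis
      by (simp add: C_def divide_inverse matrix_vector_mul_component inner_axis matrix_vector_mult_basis column_def)
  qed
  moreover have "Ck k S (\<lambda>x. det (C x) * inverse (det (A x)))"
  proof (intro Ck_mult S Ck_inverse Ck_det A)
    show "Ck k S (\<lambda>x. C x $ i $ j)" for i j
      using A[of i j] by (cases "j = a") (simp_all add: C_def Ck_const)
    show "det (A x) \<noteq> 0" if "x \<in> S" for x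
      using inv[OF that] by (simp add: invertible_det_nz)
  qed
  ultimately show ?thesis
    using Ck_cong[OF S, of "\<lambda>x. matrix_inv (A x) $ a $ b" "\<lambda>x. det (C x) * inverse (det (A x))" k]
    by blast
qed

definition pd_matrix :: "'n::finite \<Rightarrow> (real^'n \<Rightarrow> real^'r::finite^'r) \<Rightarrow> real^'n \<Rightarrow> real^'r^'r" where
  "pd_matrix j A x = (\<chi> a b. pd j (\<lambda>z. A z $ a $ b) x)"

lemma bilinear_expand: "v \<bullet> (A *v w) = (\<Sum>a\<in>UNIV. \<Sum>b\<in>UNIV. (v $ a * w $ b) * A $ a $ b)"
  for A :: "real^'r::finite^'s::finite"
  by (simp add: inner_vec_def matrix_vector_mult_def sum_distrib_left mult_ac)

lemma pd_bilinear:
  fixes A :: "real^'n::finite \<Rightarrow> real^'r::finite^'r"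
  assumes "\<And>a b. (\<lambda>z. A z $ a $ b) differentiable (at x)"
  shows "pd j (\<lambda>z. v \<bullet> (A z *v w)) x = v \<bullet> (pd_matrix j A x *v w)"
    and "(\<lambda>z. v \<bullet> (A z *v w)) differentiable (at x)"
proof -
  have d: "(\<lambda>z. (v $ a * w $ b) * A z $ a $ b) differentiable (at x)" for a b
    by (intro differentiable_mult differentiable_const assms)
  show "pd j (\<lambda>z. v \<bullet> (A z *v w)) x = v \<bullet> (pd_matrix j A x *v w)"
    unfolding bilinear_expand using d
    by (simp add: pd_sum differentiable_sum pd_cmult[OF assms] pd_matrix_def)
  show "(\<lambda>z. v \<bullet> (A z *v w)) differentiable (at x)"
    unfolding bilinear_expand using d by (intro differentiable_sum) auto
qed

lemma pd_matrix_mult: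
  fixes A B :: "real^'n::finite \<Rightarrow> real^'r::finite^'r"
  assumes A: "\<And>a b. (\<lambda>z. A z $ a $ b) differentiable (at x)"
    and B: "\<And>a b. (\<lambda>z. B z $ a $ b) differentiable (at x)"
  shows "pd_matrix j (\<lambda>z. A z ** B z) x = A x ** pd_matrix j B x + pd_matrix j A x ** B x"
proof -
  have "pd j (\<lambda>z. \<Sum>c\<in>UNIV. A z $ a $ c * B z $ c $ b) x
      = (\<Sum>c\<in>UNIV. A x $ a $ c * pd j (\<lambda>z. B z $ c $ b) x + pd j (\<lambda>z. A z $ a $ c) x * B x $ c $ b)" for a b
    by (subst pd_sum) (auto intro!: differentiable_mult A B simp: pd_mult[OF A B])
  then show ?thesis
    by (simp add: vec_eq_iff pd_matrix_def matrix_matrix_mult_def sum.distrib)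
qed

lemma inner_symmetric_matrix:
  fixes A :: "real^'r::finite^'r"
  assumes "transpose A = A"
  shows "v \<bullet> (A *v w) = (A *v v) \<bullet> w"
  using vector_transpose_matrix[of v A] dot_lmul_matrix[of v A w] assms by simp

section \<open>Positive definiteness of the metric and comparison with the Euclidean one\<close>

lemma metric_pos:
  assumes "riemannian_metric_C2 D g" "x \<in> D" "v \<noteq> 0"
  shows "v \<bullet> (g x *v v) > 0"
  using assms unfolding riemannian_metric_C2_def by blast

lemma metric_invertible:
  assumes "riemannian_metric_C2 D g" "x \<in> D"
  shows "invertible (g x)"
proof -
  have "v = 0" if "g x *v v = 0" for v
    using metric_pos[OF assms, of v] that by (cases "v = 0") simp_all
  then have "\<exists>B. B ** g x = mat 1" by (simp add: matrix_left_invertible_ker)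
  then show ?thesis by (simp add: invertible_left_inverse)
qed

lemma metric_nonneg:
  assumes "riemannian_metric_C2 D g" "x \<in> D"
  shows "0 \<le> v \<bullet> (g x *v v)"
  using metric_pos[OF assms, of v] by (cases "v = 0") simp_all

lemma continuous_on_bilinear:
  fixes A :: "'a::topological_space \<Rightarrow> real^'r::finite^'r"
  assumes "\<And>a b. continuous_on S (\<lambda>x. A x $ a $ b)" "continuous_on S v" "continuous_on S w"
  shows "continuous_on S (\<lambda>x. v x \<bullet> (A x *v w x))"
  unfolding bilinear_expand by (intro continuous_intros assms)

text \<open>The constant is the minimum of the quadratic form over the compact product of
  \<open>K\<close> and the unit sphere; homogeneity extends the bound to all vectors.\<close>

lemma metric_lower_bound:
  fixes g :: "real^'n::finite \<Rightarrow> real^'r::finite^'r"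
  assumes g: "riemannian_metric_C2 D g" and K: "compact K" "K \<subseteq> D"
  obtains c where "c > 0" "\<And>x v. x \<in> K \<Longrightarrow> c * (v \<bullet> v) \<le> v \<bullet> (g x *v v)"
proof (cases "K = {}")
  case True
  then show ?thesis using that[of 1] by simp
next
  case False
  let ?C = "K \<times> sphere (0::real^'r) 1"
  have gc: "continuous_on K (\<lambda>x. g x $ a $ b)" for a b
    using g unfolding riemannian_metric_C2_def
    by (intro continuous_on_subset[OF Ck_imp_continuous_on K(2)]) blast
  have "continuous_on ?C (\<lambda>p. snd p \<bullet> (g (fst p) *v snd p))"
    by (intro continuous_on_bilinear continuous_intros continuous_on_compose2[OF gc]) auto
  moreover have "compact ?C" by (intro compact_Times K(1) compact_sphere)
  moreover have "?C \<noteq> {}"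
  proof -
    have "axis undefined 1 \<in> sphere (0::real^'r) 1" by simp
    then show ?thesis using False by blast
  qed
  ultimately obtain p where p: "p \<in> ?C" "\<And>p'. p' \<in> ?C \<Longrightarrow>
      snd p \<bullet> (g (fst p) *v snd p) \<le> snd p' \<bullet> (g (fst p') *v snd p')"
    using continuous_attains_inf[of ?C] by blast
  define c where "c = snd p \<bullet> (g (fst p) *v snd p)"
  show ?thesis
  proof (rule that[of c])
    have "snd p \<noteq> 0" "fst p \<in> D" using p(1) K(2) by auto
    then show "c > 0" unfolding c_def using metric_pos[OF g] by blast
    show "c * (v \<bullet> v) \<le> v \<bullet> (g x *v v)" if "x \<in> K" for x v
    proof (cases "v = 0")
      case nz: False
      define w where "w = inverse (norm v) *\<^sub>R v"
      have v: "v = norm v *\<^sub>R w" using nz by (simp add: w_def)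
      have "norm w = 1" using nz by (simp add: w_def)
      then have "c \<le> w \<bullet> (g x *v w)" using p(2)[of "(x, w)"] that by (simp add: c_def)
      then have "c * (norm v)\<^sup>2 \<le> (norm v)\<^sup>2 * (w \<bullet> (g x *v w))"
        by (subst mult.commute) (intro mult_left_mono, simp_all)
      also have "\<dots> = (norm v *\<^sub>R w) \<bullet> (g x *v (norm v *\<^sub>R w))"
        by (simp add: matrix_vector_mult_scaleR power2_eq_square)
      also have "\<dots> = v \<bullet> (g x *v v)" by (simp only: v[symmetric])
      finally show ?thesis by (simp add: dot_square_norm)
    qed simp
  qed
qed

subsection \<open>The quadratic weight\<close>

lemma pd_inner_self:
  fixes x\<^sub>0 :: "real^'n::finite"
  shows "pd j (\<lambda>x. s * ((x - x\<^sub>0) \<bullet> (x - x\<^sub>0))) x = 2 * s * (x - x\<^sub>0) $ j"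
proof -
  have "((\<lambda>x. s * ((x - x\<^sub>0) \<bullet> (x - x\<^sub>0))) has_derivative (\<lambda>h. s * ((x - x\<^sub>0) \<bullet> h + h \<bullet> (x - x\<^sub>0)))) (at x)"
    by (auto intro!: derivative_eq_intros)
  from pd_has_derivative[OF this] show ?thesis
    by (simp add: inner_axis inner_axis' algebra_simps)
qed

lemma pd_component_diff: "pd i (\<lambda>x. c * (x - x\<^sub>0) $ j) x = (if i = j then c else 0)"
proof -
  have "((\<lambda>x. c * (x - x\<^sub>0) $ j) has_derivative (\<lambda>h. c * h $ j)) (at x)"
    by (auto intro!: derivative_eq_intros bounded_linear.has_derivative[OF bounded_linear_vec_nth])
  from pd_has_derivative[OF this] show ?thesis by (simp add: axis_def)
qed

lemma pd_pd_inner_self: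
  fixes x\<^sub>0 :: "real^'n::finite"
  shows "pd i (pd j (\<lambda>x. s * ((x - x\<^sub>0) \<bullet> (x - x\<^sub>0)))) x = (if i = j then 2 * s else 0)"
proof -
  have "pd j (\<lambda>x. s * ((x - x\<^sub>0) \<bullet> (x - x\<^sub>0))) = (\<lambda>x. (2 * s) * (x - x\<^sub>0) $ j)"
    by (intro ext pd_inner_self)
  then show ?thesis by (simp only: pd_component_diff)
qed

lemma quadratic_weight_admissible:
  fixes x\<^sub>0 :: "real^'n::finite"
  assumes "s > 0"
  defines "\<psi> \<equiv> \<lambda>x. s * ((x - x\<^sub>0) \<bullet> (x - x\<^sub>0))"
  shows "smooth_on UNIV \<psi>" "strictly_convex \<psi>" "pos_def_hessian \<psi>"
proof -
  show "smooth_on UNIV \<psi>"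
    unfolding \<psi>_def smooth_on_def by (intro allI Ck_cmult Ck_inner_self open_UNIV)
  show "strictly_convex \<psi>"
    unfolding strictly_convex_def
  proof (intro allI impI)
    fix x y :: "real^'n" and t :: real assume t: "x \<noteq> y \<and> 0 < t \<and> t < 1"
    define a b where "a = x - x\<^sub>0" and "b = y - x\<^sub>0"
    have ab: "(1 - t) *\<^sub>R x + t *\<^sub>R y - x\<^sub>0 = (1 - t) *\<^sub>R a + t *\<^sub>R b"
      by (simp add: a_def b_def algebra_simps)
    \<comment> \<open>For a quadratic function the convexity defect is an exact multiple of the
      squared distance.\<close>
    have "(1 - t) * (s * (a \<bullet> a)) + t * (s * (b \<bullet> b))
        - s * (((1 - t) *\<^sub>R a + t *\<^sub>R b) \<bullet> ((1 - t) *\<^sub>R a + t *\<^sub>R b)) = s * t * (1 - t) * ((a - b) \<bullet> (a - b))"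
      by (simp add: inner_simps inner_commute algebra_simps)
    moreover have "(a - b) \<bullet> (a - b) > 0" using t by (simp add: a_def b_def)
    ultimately show "\<psi> ((1 - t) *\<^sub>R x + t *\<^sub>R y) < (1 - t) * \<psi> x + t * \<psi> y"
      using t assms(1) unfolding \<psi>_def ab a_def[symmetric] b_def[symmetric]
      by (smt (verit, best) mult_pos_pos)
  qed
  show "pos_def_hessian \<psi>"
    unfolding pos_def_hessian_def \<psi>_def pd_pd_inner_self
  proof (intro allI impI)
    fix x v :: "real^'n" assume "v \<noteq> 0"
    have "(\<Sum>i\<in>UNIV. \<Sum>j\<in>UNIV. (if i = j then 2 * s else 0) * v $ i * v $ j)
        = (\<Sum>i\<in>UNIV. \<Sum>j\<in>UNIV. if i = j then 2 * s * v $ i * v $ j else 0)"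
      by (intro sum.cong refl) simp
    also have "\<dots> = 2 * s * (v \<bullet> v)"
      by (simp add: inner_vec_def sum_distrib_left mult.assoc)
    finally show "0 < (\<Sum>i\<in>UNIV. \<Sum>j\<in>UNIV. (if i = j then 2 * s else 0) * v $ i * v $ j)"
      using \<open>v \<noteq> 0\<close> assms(1) by simp
  qed
qed

subsection \<open>Local integrability\<close>

text \<open>On a compact set of finite measure square integrability implies integrability through
  |y| <= 1 + y^2, and \<open>metric_lower_bound\<close> bounds the square of one coefficient by the
  energy density of \<open>u\<close>.\<close>

lemma L2_forms_locally_integrable:
  fixes g :: "real^('n::{finite,linorder}) \<Rightarrow> real^'r::finite^'r"
  assumes g: "riemannian_metric_C2 D g" and u: "L2_forms D g p u" and "open D"
    and K: "compact K" "K \<subseteq> D"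
  shows "set_integrable lborel K (\<lambda>x. u x L \<tau>)"
proof (cases "card L = p")
  case False
  then have "u x L \<tau> = 0" for x using u by (simp add: L2_forms_def is_form_def)
  then show ?thesis by (simp add: set_integrable_def)
next
  case True
  obtain c where c: "c > 0" "\<And>x v. x \<in> K \<Longrightarrow> c * (v \<bullet> v) \<le> v \<bullet> (g x *v v)"
    using metric_lower_bound[OF g K] by metis
  have Ks: "K \<in> sets lborel" using K(1) by (simp add: borel_compact)
  have "set_integrable lborel K (\<lambda>x. inner_g p (g x) (u x) (u x))"
  proof (rule set_integrable_subset[OF _ Ks K(2)])
    show "set_integrable lborel D (\<lambda>x. inner_g p (g x) (u x) (u x))"
      using u unfolding L2_forms_def by blast
  qed
  then have i: "integrable lborel (\<lambda>x. indicator K x * inner_g p (g x) (u x) (u x))"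
    by (simp add: set_integrable_def)
  have "emeasure lborel K < \<infinity>"
    using emeasure_bounded_finite[OF compact_imp_bounded[OF K(1)]] .
  then have k: "integrable lborel (\<lambda>x. indicator K x :: real)"
    using Ks by (intro integrable_real_indicator) auto
  have m: "(\<lambda>x. indicator K x * u x L \<tau>) \<in> borel_measurable lborel"
  proof (rule borel_measurable_times[OF borel_measurable_indicator[OF Ks]])
    show "(\<lambda>x. u x L \<tau>) \<in> borel_measurable lborel" using u unfolding L2_forms_def by blast
  qed
  have b: "\<bar>u x L \<tau>\<bar> \<le> 1 + inner_g p (g x) (u x) (u x) / c" if x: "x \<in> K" for x
  proof -
    let ?v = "\<lambda>J. \<chi> \<tau>. u x J \<tau>"
    have "(u x L \<tau>)\<^sup>2 \<le> ?v L \<bullet> ?v L"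
      using member_le_sum[of \<tau> UNIV "\<lambda>\<tau>. (u x L \<tau>)\<^sup>2"] by (simp add: inner_vec_def power2_eq_square)
    also have "c * (?v L \<bullet> ?v L) \<le> ?v L \<bullet> (g x *v ?v L)" by (rule c(2)[OF x])
    also have "\<dots> \<le> inner_g p (g x) (u x) (u x)"
      unfolding inner_g_eq
    proof (rule member_le_sum)
      show "0 \<le> ?v J \<bullet> (g x *v ?v J)" for J using x K(2) by (intro metric_nonneg[OF g]) blast
    qed (use True in simp_all)
    finally have "(u x L \<tau>)\<^sup>2 \<le> inner_g p (g x) (u x) (u x) / c"
      using c(1) by (simp add: field_simps)
    moreover have "\<bar>u x L \<tau>\<bar> \<le> 1 + (u x L \<tau>)\<^sup>2"
      using zero_le_power2[of "\<bar>u x L \<tau>\<bar> - 1"] zero_le_power2[of "u x L \<tau>"]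
      by (simp add: power2_diff)
    ultimately show ?thesis by linarith
  qed
  have "integrable lborel (\<lambda>x. indicator K x * u x L \<tau>)"
  proof (rule Bochner_Integration.integrable_bound[OF _ m])
    show "integrable lborel (\<lambda>x. indicator K x + indicator K x * inner_g p (g x) (u x) (u x) / c)"
      using i k by simp
    show "AE x in lborel. norm (indicator K x * u x L \<tau>)
        \<le> norm (indicator K x + indicator K x * inner_g p (g x) (u x) (u x) / c)"
    proof (intro AE_I2)
      fix x show "norm (indicator K x * u x L \<tau>)
        \<le> norm (indicator K x + indicator K x * inner_g p (g x) (u x) (u x) / c)"
        using b[of x] by (cases "x \<in> K") auto
    qed
  qed
  then show ?thesis by (simp add: set_integrable_def)
qed

subsection \<open>The Bochner type inequality for a test form\<close>

locale test_form =
  fixes D :: "(real^('n::{finite,linorder})) set"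
    and g :: "real^('n::{finite,linorder}) \<Rightarrow> real^'r::finite^'r"
    and q :: nat and f :: "real^('n::{finite,linorder}) \<Rightarrow> 'n set \<Rightarrow> 'r \<Rightarrow> real"
    and x\<^sub>0 :: "real^('n::{finite,linorder})" and K :: "(real^('n::{finite,linorder})) set"
  assumes open_D: "open D" and g: "riemannian_metric_C2 D g" and q: "1 \<le> q"
    and form_f: "\<And>x. is_form q (f x)" and smooth_f: "\<And>I \<tau>. smooth_on UNIV (\<lambda>x. f x I \<tau>)"
    and K: "compact K" "K \<subseteq> D" and supp_f: "\<And>x I \<tau>. x \<notin> K \<Longrightarrow> f x I \<tau> = 0"
begin

abbreviation \<I> where "\<I> \<equiv> {L :: 'n set. card L = q - 1}"

text \<open>For the weight \<open>exp (- s |x - x\<^sub>0|\<^sup>2)\<close> the formal adjoint of \<open>d\<close> maps \<open>f\<close> to the form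
  whose \<open>dx\<^sub>L\<close> coefficient is \<open>2 s P L - B (S L)\<close>.\<close>

definition W where "W L j x = ctr (f x) L j"
definition P where "P L x = (\<Sum>j\<in>UNIV. (x - x\<^sub>0) $ j *\<^sub>R W L j x)"
definition S where "S L x = (\<chi> \<tau>. \<Sum>j\<in>UNIV. pd j (\<lambda>y. (g y *v W L j y) $ \<tau>) x)"
definition B where "B x = matrix_inv (g x)"
text \<open>\<open>F\<close> and \<open>M\<close> are the components of two vector fields whose
  products with \<open>x - x\<^sub>0\<close> are the squared norm of \<open>P\<close> and the cross
  term \<open>PS\<close>. Since 2 s times \<open>x - x\<^sub>0\<close> is the gradient of the
  weight, each such product can be traded for a divergence at the gain of one power of s.\<close>

definition F where "F j x = (\<Sum>L\<in>\<I>. W L j x \<bullet> (g x *v P L x))"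
definition M where "M j x = (\<Sum>L\<in>\<I>. W L j x \<bullet> S L x)"
definition N where "N x = inner_g q (g x) (f x) (f x)"
definition PS where "PS x = (\<Sum>L\<in>\<I>. P L x \<bullet> S L x)"
definition SBS where "SBS x = (\<Sum>L\<in>\<I>. S L x \<bullet> (B x *v S L x))"
text \<open>\<open>T\<close> and \<open>Z\<close> collect what remains of order 1 and of order 2 s
  after these trades, with the part q \<open>N\<close> of the latter split off.\<close>

definition T where "T x = SBS x - (\<Sum>j\<in>UNIV. pd j (M j) x)"
definition Z where "Z x = (\<Sum>j\<in>UNIV. pd j (F j) x) - q * N x - PS x"

lemma g_Ck: "Ck 2 D (\<lambda>x. g x $ a $ b)" and g_sym: "x \<in> D \<Longrightarrow> transpose (g x) = g x"
  using g by (auto simp: riemannian_metric_C2_def simp del: Ck.simps)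

lemma supp_W: "x \<notin> K \<Longrightarrow> W L j x = 0"
  by (simp add: W_def ctr_def supp_f vec_eq_iff)

lemma W_Ck: "Ck k A (\<lambda>x. W L j x $ \<tau>)"
proof (cases "j \<in> L")
  case False
  then have "(\<lambda>x. W L j x $ \<tau>) = (\<lambda>x. eps j L * f x (insert j L) \<tau>)"
    by (auto simp: W_def ctr_def)
  moreover have "Ck k UNIV (\<lambda>x. eps j L * f x (insert j L) \<tau>)"
    using smooth_f by (intro Ck_cmult smooth_on_imp_Ck) auto
  ultimately show ?thesis using Ck_subset by fastforce
qed (simp add: W_def ctr_def Ck_const)

lemma P_comp: "P L x $ \<tau> = (\<Sum>j\<in>UNIV. (x $ j - x\<^sub>0 $ j) * W L j x $ \<tau>)"
  by (simp add: P_def)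

lemma P_Ck: "open A \<Longrightarrow> Ck k A (\<lambda>x. P L x $ \<tau>)"
  unfolding P_comp by (intro Ck_sum Ck_mult Ck_diff Ck_component Ck_const W_Ck)

lemma gW_comp: "(g x *v W L j x) $ \<tau> = (\<Sum>b\<in>UNIV. g x $ \<tau> $ b * W L j x $ b)"
  by (simp add: matrix_vector_mult_def)

lemma Ck_extend: "Ck k D h \<Longrightarrow> (\<And>x. x \<notin> K \<Longrightarrow> h x = 0) \<Longrightarrow> Ck k UNIV h"
  using Ck_extend_zero[OF open_D compact_imp_closed[OF K(1)] K(2)] .

lemma pd_off_K: "(\<And>x. x \<notin> K \<Longrightarrow> h x = 0) \<Longrightarrow> x \<notin> K \<Longrightarrow> pd j h x = 0"
  using pd_outside[OF compact_imp_closed[OF K(1)]] .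

lemma gW_Ck: "Ck 2 UNIV (\<lambda>x. (g x *v W L j x) $ \<tau>)"
proof (rule Ck_extend)
  show "Ck 2 D (\<lambda>x. (g x *v W L j x) $ \<tau>)"
    unfolding gW_comp by (intro Ck_sum Ck_mult g_Ck W_Ck open_D)
qed (simp add: supp_W)

lemma S_Ck: "Ck 1 UNIV (\<lambda>x. S L x $ \<tau>)"
proof -
  have "Ck 1 UNIV (pd j (\<lambda>y. (g y *v W L j y) $ \<tau>))" for j
    using Ck_pd[of 1 UNIV "\<lambda>y. (g y *v W L j y) $ \<tau>" j] gW_Ck[of L j \<tau>]
    by (simp only: Suc_1)
  then have "Ck 1 UNIV (\<lambda>x. \<Sum>j\<in>UNIV. pd j (\<lambda>y. (g y *v W L j y) $ \<tau>) x)"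
    by (intro Ck_sum) auto
  then show ?thesis by (simp only: S_def vec_lambda_beta)
qed

lemma supp_S: "x \<notin> K \<Longrightarrow> S L x = 0"
  by (simp add: S_def vec_eq_iff pd_off_K supp_W)

lemma F_Ck: "Ck 1 UNIV (F j)"
proof (rule Ck_extend)
  have "Ck 1 D (\<lambda>x. \<Sum>L\<in>\<I>. \<Sum>a\<in>UNIV. \<Sum>b\<in>UNIV. (W L j x $ a * P L x $ b) * g x $ a $ b)"
    by (intro Ck_sum Ck_mult W_Ck P_Ck open_D Ck_mono[OF g_Ck]) simp
  then show "Ck 1 D (F j)" unfolding F_def[abs_def] bilinear_expand .
qed (simp add: F_def supp_W)

lemma supp_F: "x \<notin> K \<Longrightarrow> F j x = 0"
  by (simp add: F_def supp_W)

lemma M_Ck: "Ck 1 UNIV (M j)"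
proof -
  have "Ck 1 UNIV (\<lambda>x. \<Sum>L\<in>\<I>. \<Sum>a\<in>UNIV. W L j x $ a * S L x $ a)"
    by (intro Ck_sum Ck_mult W_Ck S_Ck open_UNIV)
  then show ?thesis by (simp only: M_def[abs_def] inner_vec_def inner_real_def)
qed

lemma supp_M: "x \<notin> K \<Longrightarrow> M j x = 0"
  by (simp add: M_def supp_W)

lemma P_inner: "P L x \<bullet> v = (\<Sum>j\<in>UNIV. (x - x\<^sub>0) $ j * (W L j x \<bullet> v))"
  by (simp add: P_def inner_sum_left)

lemma PS_eq: "PS x = (\<Sum>j\<in>UNIV. (x - x\<^sub>0) $ j * M j x)"
proof -
  have "(\<Sum>j\<in>UNIV. (x - x\<^sub>0) $ j * M j x) = (\<Sum>L\<in>\<I>. \<Sum>j\<in>UNIV. (x - x\<^sub>0) $ j * (W L j x \<bullet> S L x))"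
    unfolding M_def sum_distrib_left by (rule sum.swap)
  then show ?thesis by (simp only: PS_def P_inner)
qed

lemma PgP_eq: "(\<Sum>L\<in>\<I>. P L x \<bullet> (g x *v P L x)) = (\<Sum>j\<in>UNIV. (x - x\<^sub>0) $ j * F j x)"
  unfolding F_def sum_distrib_left P_inner by (rule sum.swap)

lemma B_Ck: "Ck 2 D (\<lambda>x. B x $ a $ b)"
  unfolding B_def by (intro Ck_matrix_inv open_D g_Ck metric_invertible[OF g])

lemma continuous_SBS: "continuous_on UNIV SBS"
proof -
  have "Ck 0 D (\<lambda>x. \<Sum>L\<in>\<I>. \<Sum>a\<in>UNIV. \<Sum>b\<in>UNIV. (S L x $ a * S L x $ b) * B x $ a $ b)"
    by (intro Ck_sum Ck_mult open_D Ck_mono[OF Ck_subset[OF S_Ck]] Ck_mono[OF B_Ck]) simp_all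
  then have "Ck 0 D SBS" unfolding SBS_def[abs_def] bilinear_expand .
  then have "Ck 0 UNIV SBS" by (rule Ck_extend) (simp add: SBS_def supp_S)
  then show ?thesis by simp
qed

lemma supp_SBS: "x \<notin> K \<Longrightarrow> SBS x = 0"
  by (simp add: SBS_def supp_S)

lemma supp_PS: "x \<notin> K \<Longrightarrow> PS x = 0"
  by (simp add: PS_def supp_S)

lemma continuous_pd: "Ck 1 UNIV h \<Longrightarrow> continuous_on UNIV (pd j h)"
  by simp

lemma continuous_PS: "continuous_on UNIV PS"
  unfolding PS_eq[abs_def] by (intro continuous_intros Ck_imp_continuous_on[OF M_Ck])

lemma continuous_N: "continuous_on UNIV N"
proof -
  have "Ck 0 D (\<lambda>x. \<Sum>I\<in>{I. card I = q}. \<Sum>\<tau>\<in>UNIV. \<Sum>\<xi>\<in>UNIV. f x I \<tau> * f x I \<xi> * g x $ \<tau> $ \<xi>)"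
    by (intro Ck_sum Ck_mult open_D smooth_on_imp_Ck smooth_f Ck_mono[OF g_Ck]) simp
  then have "Ck 0 D N" unfolding N_def[abs_def] inner_g_def .
  then have "Ck 0 UNIV N" by (rule Ck_extend) (simp add: N_def inner_g_def supp_f)
  then show ?thesis by simp
qed

lemma supp_N: "x \<notin> K \<Longrightarrow> N x = 0"
  by (simp add: N_def inner_g_def supp_f)

lemma continuous_T: "continuous_on UNIV T"
  unfolding T_def[abs_def] by (intro continuous_intros continuous_SBS continuous_pd M_Ck)

lemma continuous_Z: "continuous_on UNIV Z"
  unfolding Z_def[abs_def] by (intro continuous_intros continuous_N continuous_PS continuous_pd F_Ck)

lemma supp_T: "x \<notin> K \<Longrightarrow> T x = 0"
  by (simp add: T_def supp_SBS pd_off_K supp_M)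

lemma supp_Z: "x \<notin> K \<Longrightarrow> Z x = 0"
  by (simp add: Z_def supp_PS supp_N pd_off_K supp_F)

lemma N_nonneg: "0 \<le> N x"
proof (cases "x \<in> K")
  case True
  then show ?thesis
    unfolding N_def inner_g_eq using K(2) by (intro sum_nonneg metric_nonneg[OF g]) blast
qed (simp add: supp_N)

end

section \<open>Integration against the Gaussian weight\<close>

locale weighted_test_form = test_form D g q f x\<^sub>0 K
  for D :: "(real^('n::{finite,linorder})) set"
    and g :: "real^('n::{finite,linorder}) \<Rightarrow> real^'r::finite^'r" and q f x\<^sub>0 K +
  fixes s :: real
  assumes s: "s > 0"
begin

definition \<psi> where "\<psi> x = s * ((x - x\<^sub>0) \<bullet> (x - x\<^sub>0))"
definition e where "e x = exp (- \<psi> x)"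
text \<open>The squared norm of the adjoint form 2 s P - B S, expanded in powers of s with the help
  of g B = 1; the first sum is rewritten through \<open>F\<close> as in
  \<open>PgP_eq\<close>.\<close>

definition H where "H x = 4 * s\<^sup>2 * (\<Sum>j\<in>UNIV. (x - x\<^sub>0) $ j * F j x) - 4 * s * PS x + SBS x"

lemma \<psi>_eq: "\<psi> = (\<lambda>x. s * ((x - x\<^sub>0) \<bullet> (x - x\<^sub>0)))"
  by (auto simp: \<psi>_def)

lemma \<psi>_Ck: "Ck k A \<psi>"
  using quadratic_weight_admissible(1)[OF s, of x\<^sub>0] by (simp add: \<psi>_eq smooth_on_imp_Ck)

lemma pd_\<psi>: "pd j \<psi> x = 2 * s * (x - x\<^sub>0) $ j"
  unfolding \<psi>_eq by (rule pd_inner_self)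

lemma e_Ck: "Ck k UNIV e"
  unfolding e_def[abs_def] by (intro Ck_exp Ck_uminus \<psi>_Ck open_UNIV)

lemma e_pos: "e x > 0" by (simp add: e_def)

lemma e_le_1: "e x \<le> 1" using s by (simp add: e_def \<psi>_def)

lemma pd_e: "pd j e x = - (2 * s * (x - x\<^sub>0) $ j) * e x"
proof -
  have "((\<lambda>t. exp (- t)) has_real_derivative - exp (- \<psi> x)) (at (\<psi> x))"
    by (auto intro!: derivative_eq_intros)
  from pd_compose[OF this Ck_1_differentiable[OF \<psi>_Ck]] show ?thesis
    by (simp add: e_def[abs_def] pd_\<psi>)
qed

lemma continuous_e: "continuous_on UNIV e"
  by (rule Ck_imp_continuous_on[OF e_Ck])

lemma integrable_e: "continuous_on UNIV h \<Longrightarrow> (\<And>x. x \<notin> K \<Longrightarrow> h x = 0) \<Longrightarrow> integrable lborel (\<lambda>x. e x * h x)"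
  by (rule integrable_compact_support[OF _ K(1)]) (auto intro!: continuous_intros continuous_e)

lemma by_parts:
  assumes "Ck 1 UNIV h" "\<And>x. x \<notin> K \<Longrightarrow> h x = 0"
  shows "(LINT x|lborel. e x * (2 * s * (x - x\<^sub>0) $ j * h x)) = (LINT x|lborel. e x * pd j h x)"
  unfolding e_def pd_\<psi>[symmetric]
  by (rule integral_by_parts_exp[OF assms(1)[unfolded One_nat_def] K(1) assms(2) \<psi>_Ck])

text \<open>One power of s is integrated away from the s^2 term, which becomes 2 s times the
  divergence of \<open>F\<close>. The cross term - 4 s PS is split in halves: one is integrated by
  parts into - div M, where second derivatives of the metric enter, and the other is kept, since
  near the centre it cancels against the divergence of \<open>F\<close>.\<close>

lemma integral_H:
  "(LINT x|lborel. e x * H x) = (LINT x|lborel. e x * (2 * s * Z x + T x)) + 2 * s * q * (LINT x|lborel. e x * N x)"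
proof -
  let ?y = "\<lambda>j x. 2 * s * (x - x\<^sub>0) $ j"
  have iF: "integrable lborel (\<lambda>x. e x * (?y j x * F j x))" "integrable lborel (\<lambda>x. e x * pd j (F j) x)" for j
    by (rule integrable_e; auto intro!: continuous_intros Ck_imp_continuous_on[OF F_Ck] continuous_pd F_Ck
        simp: supp_F pd_off_K)+
  have iM: "integrable lborel (\<lambda>x. e x * (?y j x * M j x))" "integrable lborel (\<lambda>x. e x * pd j (M j) x)" for j
    by (rule integrable_e; auto intro!: continuous_intros Ck_imp_continuous_on[OF M_Ck] continuous_pd M_Ck
        simp: supp_M pd_off_K)+
  have iPS: "integrable lborel (\<lambda>x. e x * PS x)" by (rule integrable_e[OF continuous_PS supp_PS])
  have iSBS: "integrable lborel (\<lambda>x. e x * SBS x)" by (rule integrable_e[OF continuous_SBS supp_SBS])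
  have iN: "integrable lborel (\<lambda>x. e x * N x)" by (rule integrable_e[OF continuous_N supp_N])
  have F: "(LINT x|lborel. (\<Sum>j\<in>UNIV. e x * (?y j x * F j x))) = (LINT x|lborel. (\<Sum>j\<in>UNIV. e x * pd j (F j) x))"
    unfolding Bochner_Integration.integral_sum[OF iF(1)] Bochner_Integration.integral_sum[OF iF(2)]
    by (intro sum.cong refl by_parts F_Ck supp_F)
  have M: "(LINT x|lborel. (\<Sum>j\<in>UNIV. e x * (?y j x * M j x))) = (LINT x|lborel. (\<Sum>j\<in>UNIV. e x * pd j (M j) x))"
    unfolding Bochner_Integration.integral_sum[OF iM(1)] Bochner_Integration.integral_sum[OF iM(2)]
    by (intro sum.cong refl by_parts M_Ck supp_M)
  have eH: "e x * H x = 2 * s * (\<Sum>j\<in>UNIV. e x * (?y j x * F j x))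
      - 2 * s * (e x * PS x) - (\<Sum>j\<in>UNIV. e x * (?y j x * M j x)) + e x * SBS x" for x
    by (simp add: H_def PS_eq sum_distrib_left power2_eq_square algebra_simps sum_subtractf)
  have eZT: "e x * (2 * s * Z x + T x) = 2 * s * (\<Sum>j\<in>UNIV. e x * pd j (F j) x) - 2 * s * q * (e x * N x)
      - 2 * s * (e x * PS x) + e x * SBS x - (\<Sum>j\<in>UNIV. e x * pd j (M j) x)" for x
    by (simp add: Z_def T_def sum_distrib_left algebra_simps)
  show ?thesis
    unfolding eH eZT using F M iF iM iPS iSBS iN
    by (simp add: Bochner_Integration.integral_add Bochner_Integration.integral_diff)
qed

section \<open>Duality: testing the weak equation against the metric dual of the weighted
  form\<close>

definition \<Phi> where "\<Phi> J \<tau> x = e x * (g x *v (\<chi> \<tau>. f x J \<tau>)) $ \<tau>"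

lemma supp_\<Phi>: "x \<notin> K \<Longrightarrow> \<Phi> J \<tau> x = 0"
  by (simp add: \<Phi>_def matrix_vector_mult_def supp_f)

lemma \<Phi>_Ck: "Ck 1 UNIV (\<Phi> J \<tau>)"
proof (rule Ck_extend)
  have "Ck 1 D (\<lambda>x. e x * (\<Sum>b\<in>UNIV. g x $ \<tau> $ b * f x J b))"
    by (intro Ck_mult Ck_sum open_D Ck_subset[OF e_Ck] Ck_mono[OF g_Ck] smooth_on_imp_Ck smooth_f) simp_all
  then show "Ck 1 D (\<Phi> J \<tau>)" by (simp only: \<Phi>_def[abs_def] matrix_vector_mult_def vec_lambda_beta)
qed (rule supp_\<Phi>)

text \<open>The inner product <u, h> for h = 2 s P - B S, with g h written out as 2 s g P - S so
  that no inverse matrix occurs.\<close>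

definition pairing where
  "pairing u x = (\<Sum>L\<in>\<I>. (\<chi> \<tau>. u x L \<tau>) \<bullet> ((2 * s) *\<^sub>R (g x *v P L x) - S L x))"

text \<open>After regrouping by (q-1)-sets the sign of each term is absorbed into the contraction
  \<open>W\<close>. The derivative of the weight then produces the part with \<open>P\<close>, and
  that of g W the part with \<open>S\<close>.\<close>

lemma pairing_pointwise:
  "(\<Sum>J\<in>{J. card J = q}. \<Sum>j\<in>J. \<Sum>\<tau>\<in>UNIV. - (eps j (J - {j}) * u x (J - {j}) \<tau> * pd j (\<Phi> J \<tau>) x))
    = e x * pairing u x"
proof -
  define G where "G L j = (\<Sum>\<tau>\<in>UNIV. u x L \<tau> * (e x * (2 * s * (x - x\<^sub>0) $ j * (g x *v W L j x) $ \<tau>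
      - pd j (\<lambda>y. (g y *v W L j y) $ \<tau>) x)))" for L j
  have d: "(\<lambda>y. (g y *v W L j y) $ \<tau>) differentiable (at x)" for L j \<tau>
    by (rule Ck_1_differentiable[OF Ck_mono[OF gW_Ck]]) simp
  have G: "- (eps j (J - {j}) * u x (J - {j}) \<tau> * pd j (\<Phi> J \<tau>) x)
      = u x (J - {j}) \<tau> * (e x * (2 * s * (x - x\<^sub>0) $ j * (g x *v W (J - {j}) j x) $ \<tau>
      - pd j (\<lambda>y. (g y *v W (J - {j}) j y) $ \<tau>) x))" if "j \<in> J" for J j \<tau>
  proof -
    have "W (J - {j}) j y = eps j (J - {j}) *\<^sub>R (\<chi> \<tau>. f y J \<tau>)" for y
      using that by (simp add: W_def ctr_def insert_absorb)
    then have "(\<lambda>y. eps j (J - {j}) * \<Phi> J \<tau> y) = (\<lambda>y. e y * (g y *v W (J - {j}) j y) $ \<tau>)"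
      by (simp add: \<Phi>_def matrix_vector_mult_scaleR mult.left_commute)
    then have "eps j (J - {j}) * pd j (\<Phi> J \<tau>) x = pd j (\<lambda>y. e y * (g y *v W (J - {j}) j y) $ \<tau>) x"
      using pd_cmult[OF Ck_1_differentiable[OF \<Phi>_Ck[unfolded One_nat_def]], of j "eps j (J - {j})" J \<tau> x]
      by simp
    also have "\<dots> = e x * pd j (\<lambda>y. (g y *v W (J - {j}) j y) $ \<tau>) x
        - (2 * s * (x - x\<^sub>0) $ j) * e x * (g x *v W (J - {j}) j x) $ \<tau>"
      by (subst pd_mult[OF Ck_1_differentiable[OF e_Ck] d]) (simp only: pd_e mult_minus_left add_uminus_conv_diff)
    finally have *: "eps j (J - {j}) * pd j (\<Phi> J \<tau>) x = \<dots>" .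
    have "- (eps j (J - {j}) * u x (J - {j}) \<tau> * pd j (\<Phi> J \<tau>) x)
        = - (u x (J - {j}) \<tau> * (eps j (J - {j}) * pd j (\<Phi> J \<tau>) x))" by (simp only: mult_ac)
    then show ?thesis unfolding * by (simp add: algebra_simps)
  qed
  have "(\<Sum>J\<in>{J. card J = q}. \<Sum>j\<in>J. \<Sum>\<tau>\<in>UNIV. - (eps j (J - {j}) * u x (J - {j}) \<tau> * pd j (\<Phi> J \<tau>) x))
      = (\<Sum>J\<in>{J. card J = q}. \<Sum>j\<in>J. G (J - {j}) j)"
    unfolding G_def by (intro sum.cong refl G)
  also have "\<dots> = (\<Sum>L\<in>\<I>. \<Sum>j\<in>- L. G L j)" by (rule sum_pairs_reindex[OF q])
  also have "\<dots> = (\<Sum>L\<in>\<I>. \<Sum>j\<in>UNIV. G L j)"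
  proof (rule sum.cong[OF refl], rule sum.mono_neutral_left)
    fix L :: "'n set"
    show "\<forall>j\<in>UNIV - - L. G L j = 0"
    proof
      fix j assume "j \<in> UNIV - - L"
      then have "W L j = (\<lambda>y. 0)" by (auto simp: W_def ctr_def)
      then show "G L j = 0" by (simp add: G_def)
    qed
  qed auto
  also have "\<dots> = (\<Sum>L\<in>\<I>. e x * ((\<chi> \<tau>. u x L \<tau>) \<bullet> ((2 * s) *\<^sub>R (g x *v P L x) - S L x)))"
  proof (intro sum.cong refl)
    fix L :: "'n set"
    have gP: "(g x *v P L x) $ \<tau> = (\<Sum>j\<in>UNIV. (x - x\<^sub>0) $ j * (g x *v W L j x) $ \<tau>)" for \<tau>
    proof -
      have "g x *v P L x = (\<Sum>j\<in>UNIV. (x - x\<^sub>0) $ j *\<^sub>R (g x *v W L j x))"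
        unfolding P_def by (simp add: matrix_vector_mult_scaleR linear_sum[OF matrix_vector_mul_linear] o_def)
      then show ?thesis by simp
    qed
    have "(\<Sum>j\<in>UNIV. G L j) = (\<Sum>\<tau>\<in>UNIV. \<Sum>j\<in>UNIV. u x L \<tau> * (e x * (2 * s * (x - x\<^sub>0) $ j * (g x *v W L j x) $ \<tau>
      - pd j (\<lambda>y. (g y *v W L j y) $ \<tau>) x)))"
      unfolding G_def by (rule sum.swap)
    also have "\<dots> = (\<Sum>\<tau>\<in>UNIV. u x L \<tau> * (e x * (2 * s * (g x *v P L x) $ \<tau> - S L x $ \<tau>)))"
      unfolding gP S_def vec_lambda_beta
      by (simp only: mult.assoc sum_subtractf sum_distrib_left[symmetric])
    also have "\<dots> = e x * ((\<chi> \<tau>. u x L \<tau>) \<bullet> ((2 * s) *\<^sub>R (g x *v P L x) - S L x))"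
      by (simp add: inner_vec_def sum_distrib_left mult.left_commute)
    finally show "(\<Sum>j\<in>UNIV. G L j) = e x * ((\<chi> \<tau>. u x L \<tau>) \<bullet> ((2 * s) *\<^sub>R (g x *v P L x) - S L x))" .
  qed
  finally show ?thesis by (simp add: pairing_def sum_distrib_left)
qed

text \<open>The weak equations for all \<open>J\<close> and \<tau> are added up, each tested with
  its own coefficient of the dual form. Exchanging sums and integrals needs every single term to be
  integrable, which is the second conclusion of \<open>weak_eq_extends_to_C1\<close>.\<close>

lemma weak_pairing:
  assumes u: "L2_forms D g (q - 1) u" "weak_d_eq D q u f"
  shows "set_integrable lborel D (\<lambda>x. e x * pairing u x)"
    and "(LINT x:D|lborel. e x * pairing u x) = (LINT x|lborel. e x * N x)"
proof -
  have w: "(LINT x:D|lborel. f x J \<tau> * \<Phi> J \<tau> x)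
        = - (LINT x:D|lborel. (\<Sum>j\<in>J. eps j (J - {j}) * u x (J - {j}) \<tau> * pd j (\<Phi> J \<tau>) x))"
    "\<And>j. j \<in> J \<Longrightarrow> set_integrable lborel D (\<lambda>x. eps j (J - {j}) * u x (J - {j}) \<tau> * pd j (\<Phi> J \<tau>) x)"
    if J: "card J = q" for J \<tau>
  proof -
    have a: "set_integrable lborel K' (\<lambda>x. f x J \<tau>)" if "compact K'" "K' \<subseteq> D" for K'
      unfolding set_integrable_def
      by (rule borel_integrable_compact[OF that(1) Ck_imp_continuous_on[OF smooth_on_imp_Ck[OF smooth_f]]])
    have b: "set_integrable lborel K' (\<lambda>x. eps j (J - {j}) * u x (J - {j}) \<tau>)" if "compact K'" "K' \<subseteq> D" for K' j
      by (intro set_integrable_mult_right L2_forms_locally_integrable[OF g u(1) open_D that])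
    have weak: "(LINT x:D|lborel. f x J \<tau> * \<phi> x)
        = - (LINT x:D|lborel. (\<Sum>j\<in>J. eps j (J - {j}) * u x (J - {j}) \<tau> * pd j \<phi> x))"
      if "smooth_on UNIV \<phi>" "compact_supp_in D \<phi>" for \<phi>
      using u(2) J that unfolding weak_d_eq_def by blast
    show "(LINT x:D|lborel. f x J \<tau> * \<Phi> J \<tau> x)
        = - (LINT x:D|lborel. (\<Sum>j\<in>J. eps j (J - {j}) * u x (J - {j}) \<tau> * pd j (\<Phi> J \<tau>) x))"
      by (rule weak_eq_extends_to_C1(1)[where b = "\<lambda>j x. eps j (J - {j}) * u x (J - {j}) \<tau>",
            OF open_D _ _ _ \<Phi>_Ck[unfolded One_nat_def] K];
          (rule a b weak supp_\<Phi>; assumption))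
    show "set_integrable lborel D (\<lambda>x. eps j (J - {j}) * u x (J - {j}) \<tau> * pd j (\<Phi> J \<tau>) x)" if "j \<in> J" for j
      by (rule weak_eq_extends_to_C1(2)[where b = "\<lambda>j x. eps j (J - {j}) * u x (J - {j}) \<tau>",
            OF open_D _ _ _ \<Phi>_Ck[unfolded One_nat_def] K _ that];
          (rule a b weak supp_\<Phi>; assumption))
  qed
  have i: "integrable lborel (\<lambda>x. indicator D x *\<^sub>R - (eps j (J - {j}) * u x (J - {j}) \<tau> * pd j (\<Phi> J \<tau>) x))"
    if "J \<in> {J. card J = q}" "j \<in> J" for J j \<tau>
    using w(2)[of J j \<tau>] that by (simp add: set_integrable_def)
  have X: "indicator D x *\<^sub>R (e x * pairing u x) = (\<Sum>J\<in>{J. card J = q}. \<Sum>j\<in>J. \<Sum>\<tau>\<in>UNIV.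
      indicator D x *\<^sub>R - (eps j (J - {j}) * u x (J - {j}) \<tau> * pd j (\<Phi> J \<tau>) x))" for x
    by (simp only: pairing_pointwise[symmetric] scaleR_sum_right)
  show "set_integrable lborel D (\<lambda>x. e x * pairing u x)"
    unfolding set_integrable_def X by (intro Bochner_Integration.integrable_sum i)
  have fi: "integrable lborel (\<lambda>x. f x J \<tau> * \<Phi> J \<tau> x)" for J \<tau>
    by (rule integrable_compact_support[OF _ K(1)])
      (auto intro!: continuous_intros Ck_imp_continuous_on[OF smooth_on_imp_Ck[OF smooth_f]]
        Ck_imp_continuous_on[OF \<Phi>_Ck] simp: supp_f)
  have "(LINT x:D|lborel. e x * pairing u x) = (\<Sum>J\<in>{J. card J = q}. (LINT x|lborel. (\<Sum>j\<in>J. \<Sum>\<tau>\<in>UNIV.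
      indicator D x *\<^sub>R - (eps j (J - {j}) * u x (J - {j}) \<tau> * pd j (\<Phi> J \<tau>) x))))"
    unfolding set_lebesgue_integral_def X
    by (intro Bochner_Integration.integral_sum Bochner_Integration.integrable_sum i)
  also have "\<dots> = (\<Sum>J\<in>{J. card J = q}. \<Sum>j\<in>J. (LINT x|lborel. (\<Sum>\<tau>\<in>UNIV.
      indicator D x *\<^sub>R - (eps j (J - {j}) * u x (J - {j}) \<tau> * pd j (\<Phi> J \<tau>) x))))"
    by (intro sum.cong refl Bochner_Integration.integral_sum Bochner_Integration.integrable_sum i)
  also have "\<dots> = (\<Sum>J\<in>{J. card J = q}. \<Sum>j\<in>J. \<Sum>\<tau>\<in>UNIV.
      (LINT x|lborel. indicator D x *\<^sub>R - (eps j (J - {j}) * u x (J - {j}) \<tau> * pd j (\<Phi> J \<tau>) x)))"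
    by (intro sum.cong refl Bochner_Integration.integral_sum i)
  also have "\<dots> = (\<Sum>J\<in>{J. card J = q}. \<Sum>\<tau>\<in>UNIV. \<Sum>j\<in>J.
      (LINT x|lborel. indicator D x *\<^sub>R - (eps j (J - {j}) * u x (J - {j}) \<tau> * pd j (\<Phi> J \<tau>) x)))"
    by (intro sum.cong refl sum.swap)
  also have "\<dots> = (\<Sum>J\<in>{J. card J = q}. \<Sum>\<tau>\<in>UNIV. (LINT x|lborel. f x J \<tau> * \<Phi> J \<tau> x))"
  proof (intro sum.cong refl)
    fix J \<tau> assume J: "J \<in> {J :: 'n set. card J = q}"
    have "(LINT x|lborel. f x J \<tau> * \<Phi> J \<tau> x) = (LINT x:D|lborel. f x J \<tau> * \<Phi> J \<tau> x)"
      unfolding set_lebesgue_integral_def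
      using K(2) supp_f by (intro Bochner_Integration.integral_cong refl) (force simp: indicator_def)
    also have "\<dots> = - (LINT x:D|lborel. (\<Sum>j\<in>J. eps j (J - {j}) * u x (J - {j}) \<tau> * pd j (\<Phi> J \<tau>) x))"
      using J by (intro w(1)) simp
    also have "\<dots> = (LINT x|lborel. (\<Sum>j\<in>J. indicator D x *\<^sub>R - (eps j (J - {j}) * u x (J - {j}) \<tau> * pd j (\<Phi> J \<tau>) x)))"
      unfolding set_lebesgue_integral_def by (simp only: scaleR_sum_right scaleR_minus_right sum_negf integral_minus)
    also have "\<dots> = (\<Sum>j\<in>J. (LINT x|lborel. indicator D x *\<^sub>R - (eps j (J - {j}) * u x (J - {j}) \<tau> * pd j (\<Phi> J \<tau>) x)))"
      using J by (intro Bochner_Integration.integral_sum i)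
    finally show "(\<Sum>j\<in>J. (LINT x|lborel. indicator D x *\<^sub>R - (eps j (J - {j}) * u x (J - {j}) \<tau> * pd j (\<Phi> J \<tau>) x)))
        = (LINT x|lborel. f x J \<tau> * \<Phi> J \<tau> x)" by simp
  qed
  also have "\<dots> = (LINT x|lborel. (\<Sum>J\<in>{J. card J = q}. \<Sum>\<tau>\<in>UNIV. f x J \<tau> * \<Phi> J \<tau> x))"
    using fi by (simp only: Bochner_Integration.integral_sum Bochner_Integration.integrable_sum)
  also have "\<dots> = (LINT x|lborel. e x * N x)"
    by (simp add: N_def inner_g_eq \<Phi>_def inner_vec_def sum_distrib_left mult.left_commute)
  finally show "(LINT x:D|lborel. e x * pairing u x) = (LINT x|lborel. e x * N x)" .
qed

text \<open>Expand 0 <= <u - t h, u - t h> with h = 2 s P - B S. This is Cauchy-Schwarz with a free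
  parameter, which stays linear under integration.\<close>

lemma pairing_le:
  assumes x: "x \<in> D"
  shows "2 * t * pairing u x \<le> inner_g (q - 1) (g x) (u x) (u x) + t\<^sup>2 * H x"
proof -
  let ?v = "\<lambda>L. \<chi> \<tau>. u x L \<tau>" and ?G = "g x"
  have GB: "?G *v (B x *v w) = w" for w
    using matrix_inv_mult(1)[OF metric_invertible[OF g x]] by (simp add: matrix_vector_mul_assoc B_def)
  have sym: "a \<bullet> (?G *v b) = (?G *v a) \<bullet> b" for a b
    by (rule inner_symmetric_matrix[OF g_sym[OF x]])
  have "2 * t * (v \<bullet> ((2 * s) *\<^sub>R (?G *v p) - w))
      \<le> v \<bullet> (?G *v v) + t\<^sup>2 * (4 * s\<^sup>2 * (p \<bullet> (?G *v p)) - 4 * s * (p \<bullet> w) + w \<bullet> (B x *v w))" for v p w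
  proof -
    define h where "h = (2 * s) *\<^sub>R p - B x *v w"
    have Gh: "?G *v h = (2 * s) *\<^sub>R (?G *v p) - w"
      by (simp add: h_def matrix_vector_mult_diff_distrib matrix_vector_mult_scaleR GB)
    have "(B x *v w) \<bullet> (?G *v p) = w \<bullet> p" by (subst sym) (simp add: GB)
    then have hGh: "h \<bullet> (?G *v h) = 4 * s\<^sup>2 * (p \<bullet> (?G *v p)) - 4 * s * (p \<bullet> w) + w \<bullet> (B x *v w)"
      unfolding Gh by (simp add: h_def inner_simps inner_commute power2_eq_square algebra_simps)
    have "0 \<le> (v - t *\<^sub>R h) \<bullet> (?G *v (v - t *\<^sub>R h))" by (rule metric_nonneg[OF g x])
    also have "\<dots> = v \<bullet> (?G *v v) - 2 * t * (v \<bullet> (?G *v h)) + t\<^sup>2 * (h \<bullet> (?G *v h))"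
      using sym[of h v]
      by (simp add: matrix_vector_mult_diff_distrib matrix_vector_mult_scaleR inner_simps inner_commute
          power2_eq_square algebra_simps)
    finally show ?thesis unfolding Gh hGh[unfolded Gh] by simp
  qed
  then have "(\<Sum>L\<in>\<I>. 2 * t * (?v L \<bullet> ((2 * s) *\<^sub>R (?G *v P L x) - S L x)))
      \<le> (\<Sum>L\<in>\<I>. ?v L \<bullet> (?G *v ?v L) + t\<^sup>2 * (4 * s\<^sup>2 * (P L x \<bullet> (?G *v P L x))
        - 4 * s * (P L x \<bullet> S L x) + S L x \<bullet> (B x *v S L x)))"
    by (intro sum_mono)
  then show ?thesis
    unfolding pairing_def inner_g_eq H_def PgP_eq[symmetric] PS_def SBS_def
    by (simp add: sum_distrib_left[symmetric] sum.distrib sum_subtractf)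
qed

text \<open>The Hessian operator is the scalar 2 s q here. As the value is the
  \<open>ennreal\<close> of a real number, the equation also yields the finiteness that the
  hypothesis of the theorem demands.\<close>

lemma hess_inv_energy:
  "(\<integral>\<^sup>+x\<in>D. ennreal (inner_g q (g x) (hess_inv \<psi> q x (f x)) (f x) * exp (- \<psi> x)) \<partial>lborel)
    = ennreal (inverse (2 * s * q) * (LINT x|lborel. e x * N x))"
proof -
  define t where "t = inverse (2 * s * q)"
  have t: "t > 0" unfolding t_def using s q by simp
  have "inner_g q (g x) (hess_inv \<psi> q x (f x)) (f x) = t * N x" for x
  proof -
    have "hess_inv \<psi> q x (f x) = (\<lambda>J \<tau>. f x J \<tau> / (2 * s * q))"
    proof (rule hess_inv_scalar)
      show "pd i (pd j \<psi>) x = (if i = j then 2 * s else 0)" for i j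
        unfolding \<psi>_eq by (rule pd_pd_inner_self)
    qed (use s q form_f in auto)
    then show ?thesis by (simp only: inner_g_divide N_def t_def)
  qed
  then have "(\<integral>\<^sup>+x\<in>D. ennreal (inner_g q (g x) (hess_inv \<psi> q x (f x)) (f x) * exp (- \<psi> x)) \<partial>lborel)
      = (\<integral>\<^sup>+x\<in>D. ennreal (t * N x * exp (- \<psi> x)) \<partial>lborel)"
    by simp
  also have "\<dots> = (\<integral>\<^sup>+x. ennreal (t * (e x * N x)) \<partial>lborel)"
  proof (intro nn_integral_cong)
    fix x show "ennreal (t * N x * exp (- \<psi> x)) * indicator D x = ennreal (t * (e x * N x))"
    proof (cases "x \<in> D")
      case False
      then have "x \<notin> K" using K(2) by blast
      then show ?thesis using False by (simp add: supp_N)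
    qed (simp add: e_def mult_ac)
  qed
  also have "\<dots> = ennreal (LINT x|lborel. t * (e x * N x))"
  proof (rule nn_integral_eq_integral)
    show "integrable lborel (\<lambda>x. t * (e x * N x))"
      using integrable_e[OF continuous_N supp_N] by simp
    show "AE x in lborel. 0 \<le> t * (e x * N x)"
      using t e_pos N_nonneg by (intro AE_I2) (simp add: less_imp_le)
  qed
  finally show ?thesis by (simp add: t_def)
qed

lemma gaussian_inequality:
  assumes u: "L2_forms D g (q - 1) u" "weak_d_eq D q u f"
    and le: "(\<integral>\<^sup>+x\<in>D. ennreal (inner_g (q - 1) (g x) (u x) (u x) * exp (- \<psi> x)) \<partial>lborel)
      \<le> (\<integral>\<^sup>+x\<in>D. ennreal (inner_g q (g x) (hess_inv \<psi> q x (f x)) (f x) * exp (- \<psi> x)) \<partial>lborel)"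
  shows "0 \<le> (LINT x|lborel. e x * (2 * s * Z x + T x))"
proof -
  \<comment> \<open>The constant of the L^2 estimate is also the right parameter in
    \<open>pairing_le\<close>: the integrated inequality 2 t N <= U + t^2 H combined with U <= t N
    leaves N <= t H, as sharp as Cauchy-Schwarz itself.\<close>
  define t where "t = inverse (2 * s * q)"
  define U where "U x = inner_g (q - 1) (g x) (u x) (u x)" for x
  let ?IN = "LINT x|lborel. e x * N x" and ?IH = "LINT x|lborel. e x * H x"
  let ?IZ = "LINT x|lborel. e x * (2 * s * Z x + T x)"
  have t: "t > 0" unfolding t_def using s q by simp
  have tq: "t * (2 * s * q) = 1" unfolding t_def using s q by (intro left_inverse) simp
  have U_nonneg: "0 \<le> U x" if "x \<in> D" for x
    unfolding U_def inner_g_eq by (intro sum_nonneg metric_nonneg[OF g that])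
  have iU: "integrable lborel (\<lambda>x. indicator D x * U x)"
    using u(1) by (simp add: L2_forms_def set_integrable_def U_def)
  \<comment> \<open>The weight is at most 1, so \<open>u\<close> being square integrable makes its
    weighted energy finite; this turns the extended-real estimate into one between real
    integrals.\<close>
  have iY: "integrable lborel (\<lambda>x. e x * (indicator D x * U x))"
  proof (rule Bochner_Integration.integrable_bound[OF iU])
    have "e \<in> borel_measurable lborel"
      using borel_measurable_continuous_onI[OF continuous_e] by simp
    then show "(\<lambda>x. e x * (indicator D x * U x)) \<in> borel_measurable lborel"
      by (rule borel_measurable_times[OF _ borel_measurable_integrable[OF iU]])
    show "AE x in lborel. norm (e x * (indicator D x * U x)) \<le> norm (indicator D x * U x)"
      using e_pos e_le_1 by (intro AE_I2) (simp add: abs_mult mult_left_le_one_le less_imp_le)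
  qed
  have Y_nonneg: "0 \<le> e x * (indicator D x * U x)" for x
    using U_nonneg[of x] e_pos[of x] by (cases "x \<in> D") simp_all
  have "(\<integral>\<^sup>+x\<in>D. ennreal (inner_g (q - 1) (g x) (u x) (u x) * exp (- \<psi> x)) \<partial>lborel)
      = (\<integral>\<^sup>+x. ennreal (e x * (indicator D x * U x)) \<partial>lborel)"
    by (intro nn_integral_cong) (simp add: indicator_def U_def e_def mult_ac)
  also have "\<dots> = ennreal (LINT x|lborel. e x * (indicator D x * U x))"
    by (rule nn_integral_eq_integral[OF iY]) (simp only: Y_nonneg AE_I2)
  finally have "ennreal (LINT x|lborel. e x * (indicator D x * U x)) \<le> ennreal (t * ?IN)"
    using le unfolding hess_inv_energy t_def by simp
  moreover have "0 \<le> t * ?IN"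
    using t e_pos N_nonneg by (intro mult_nonneg_nonneg integral_nonneg_AE AE_I2) (simp_all add: less_imp_le)
  ultimately have Y: "(LINT x|lborel. e x * (indicator D x * U x)) \<le> t * ?IN"
    by (simp add: ennreal_le_iff)
  have supp_H: "H x = 0" if "x \<notin> K" for x
    using that by (simp add: H_def supp_F supp_PS supp_SBS)
  have cH: "continuous_on UNIV H"
    unfolding H_def[abs_def]
    by (intro continuous_intros continuous_SBS continuous_PS Ck_imp_continuous_on[OF F_Ck])
  have iH: "integrable lborel (\<lambda>x. e x * H x)" by (rule integrable_e[OF cH supp_H])
  have iX: "integrable lborel (\<lambda>x. indicator D x * (e x * pairing u x))"
    using weak_pairing(1)[OF u] by (simp add: set_integrable_def)
  have pt: "2 * t * (indicator D x * (e x * pairing u x)) \<le> e x * (indicator D x * U x) + t\<^sup>2 * (e x * H x)" for x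
  proof (cases "x \<in> D")
    case True
    have "e x * (2 * t * pairing u x) \<le> e x * (U x + t\<^sup>2 * H x)"
      using pairing_le[OF True] e_pos[of x] unfolding U_def by (intro mult_left_mono) auto
    then show ?thesis using True by (simp add: algebra_simps)
  next
    case False
    then have "x \<notin> K" using K(2) by blast
    then show ?thesis using False by (simp add: supp_H)
  qed
  have "2 * t * ?IN = (LINT x|lborel. 2 * t * (indicator D x * (e x * pairing u x)))"
    using weak_pairing(2)[OF u] by (simp add: set_lebesgue_integral_def)
  also have "\<dots> \<le> (LINT x|lborel. e x * (indicator D x * U x) + t\<^sup>2 * (e x * H x))"
    by (intro integral_mono pt Bochner_Integration.integrable_add integrable_mult_right iX iY iH)
  also have "\<dots> = (LINT x|lborel. e x * (indicator D x * U x)) + t\<^sup>2 * ?IH"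
    using iY iH by simp
  also have "\<dots> \<le> t * ?IN + t\<^sup>2 * ?IH" using Y by simp
  finally have "t * ?IN \<le> t * (t * ?IH)" by (simp add: power2_eq_square)
  then have "?IN \<le> t * ?IH" using t by simp
  \<comment> \<open>Here t times 2 s q is 1, so the integral of \<open>N\<close> has coefficient 1
    on both sides and drops out.\<close>
  also have "\<dots> = t * ?IZ + t * (2 * s * q) * ?IN" unfolding integral_H by (simp add: algebra_simps)
  finally have "0 \<le> t * ?IZ" unfolding tq by simp
  then show ?thesis using t by (simp add: zero_le_mult_iff)
qed

end

subsection \<open>The curvature at a point where the test form is constant\<close>

locale constant_germ = test_form D g q f x\<^sub>0 K
  for D :: "(real^('n::{finite,linorder})) set"
    and g :: "real^('n::{finite,linorder}) \<Rightarrow> real^'r::finite^'r" and q f x\<^sub>0 K +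
  fixes \<xi> :: "'n set \<Rightarrow> 'r \<Rightarrow> real" and a :: real
  assumes a: "a > 0" "ball x\<^sub>0 a \<subseteq> D" and germ: "\<And>x. x \<in> ball x\<^sub>0 a \<Longrightarrow> f x = \<xi>"
begin

abbreviation w where "w L j \<equiv> ctr \<xi> L j"
abbreviation dg where "dg j x \<equiv> pd_matrix j g x"
abbreviation ddg where "ddg i j x \<equiv> pd_matrix i (pd_matrix j g) x"

lemma W_germ: "x \<in> ball x\<^sub>0 a \<Longrightarrow> W L j x = w L j"
  by (simp add: W_def germ del: mem_ball)

lemma g_Ck': "Ck (Suc (Suc 0)) D (\<lambda>x. g x $ b $ c)"
  using g_Ck by (simp only: numeral_2_eq_2)

lemma g_differentiable: "x \<in> D \<Longrightarrow> (\<lambda>y. g y $ b $ c) differentiable (at x)"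
  by (rule Ck_differentiable_at[OF g_Ck' open_D])

lemma dg_differentiable: "x \<in> D \<Longrightarrow> (\<lambda>y. dg j y $ b $ c) differentiable (at x)"
  using Ck_differentiable_at[OF Ck_pd[OF g_Ck'] open_D] by (simp only: pd_matrix_def vec_lambda_beta)

lemma B_differentiable: "x \<in> D \<Longrightarrow> (\<lambda>y. B y $ b $ c) differentiable (at x)"
  using Ck_differentiable_at[OF B_Ck[unfolded numeral_2_eq_2] open_D] .

lemma dg_sym: "x \<in> D \<Longrightarrow> transpose (dg j x) = dg j x"
proof -
  assume x: "x \<in> D"
  have "g y $ b $ c = g y $ c $ b" if "y \<in> D" for y b c
  proof -
    have "transpose (g y) $ c $ b = g y $ c $ b" by (simp only: g_sym[OF that])
    then show ?thesis by (simp only: transpose_def vec_lambda_beta)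
  qed
  then have "pd j (\<lambda>y. g y $ b $ c) x = pd j (\<lambda>y. g y $ c $ b) x" for b c
    by (intro pd_cong_open[OF open_D x])
  then show ?thesis by (simp add: transpose_def pd_matrix_def vec_eq_iff)
qed

lemma S_germ:
  assumes x: "x \<in> ball x\<^sub>0 a"
  shows "S L x = (\<Sum>j\<in>UNIV. dg j x *v w L j)"
proof -
  have xD: "x \<in> D" using x a(2) by blast
  have "pd j (\<lambda>y. (g y *v W L j y) $ \<tau>) x = (dg j x *v w L j) $ \<tau>" for j \<tau>
  proof -
    have "pd j (\<lambda>y. (g y *v W L j y) $ \<tau>) x = pd j (\<lambda>y. axis \<tau> 1 \<bullet> (g y *v w L j)) x"
      by (rule pd_cong_open[OF open_ball x]) (simp only: W_germ inner_axis' mult_1 inner_real_def)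
    also have "\<dots> = axis \<tau> 1 \<bullet> (dg j x *v w L j)"
      by (rule pd_bilinear(1)[OF g_differentiable[OF xD]])
    finally show ?thesis by (simp add: inner_axis')
  qed
  then show ?thesis by (simp add: S_def vec_eq_iff)
qed

text \<open>Where the form is constant, the divergence of \<open>F\<close> has only two kinds of
  terms. Differentiating \<open>x - x\<^sub>0\<close> gives a Kronecker delta and hence q
  \<open>N\<close> by \<open>sum_ctr_inner_g\<close>; differentiating the metric gives
  \<open>PS\<close>.\<close>

lemma Z_germ:
  assumes x: "x \<in> ball x\<^sub>0 a"
  shows "Z x = 0"
proof -
  have xD: "x \<in> D" using x a(2) by blast
  let ?y = "\<lambda>k. (x - x\<^sub>0) $ k"
  have d: "(\<lambda>y. (y - x\<^sub>0) $ k) differentiable (at x)" for k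
    by (simp add: differentiable_diff differentiableI[OF has_derivative_component])
  have pdF: "pd j (F j) x = (\<Sum>L\<in>\<I>. \<Sum>k\<in>UNIV. ?y k * (w L j \<bullet> (dg j x *v w L k))
      + (if j = k then w L j \<bullet> (g x *v w L j) else 0))" for j
  proof -
    have "F j y = (\<Sum>L\<in>\<I>. \<Sum>k\<in>UNIV. (y - x\<^sub>0) $ k * (w L j \<bullet> (g y *v w L k)))" if "y \<in> ball x\<^sub>0 a" for y
      unfolding F_def P_def W_germ[OF that]
      by (simp add: matrix_vector_mult_scaleR linear_sum[OF matrix_vector_mul_linear] o_def inner_sum_right)
    then have "pd j (F j) x = pd j (\<lambda>y. \<Sum>L\<in>\<I>. \<Sum>k\<in>UNIV. (y - x\<^sub>0) $ k * (w L j \<bullet> (g y *v w L k))) x"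
      by (rule pd_cong_open[OF open_ball x])
    also have "\<dots> = (\<Sum>L\<in>\<I>. \<Sum>k\<in>UNIV. pd j (\<lambda>y. (y - x\<^sub>0) $ k * (w L j \<bullet> (g y *v w L k))) x)"
      by (rule pd_sum_sum[OF finite])
        (rule differentiable_mult[OF d pd_bilinear(2)[OF g_differentiable[OF xD]]])
    also have "\<dots> = (\<Sum>L\<in>\<I>. \<Sum>k\<in>UNIV. ?y k * (w L j \<bullet> (dg j x *v w L k))
        + (if j = k then w L j \<bullet> (g x *v w L j) else 0))"
    proof (intro sum.cong refl)
      fix L k
      have "pd j (\<lambda>y. (y - x\<^sub>0) $ k) x = (if j = k then 1 else 0)"
        using pd_component_diff[of j 1 x\<^sub>0 k x] by (simp only: mult_1)
      then show "pd j (\<lambda>y. (y - x\<^sub>0) $ k * (w L j \<bullet> (g y *v w L k))) x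
          = ?y k * (w L j \<bullet> (dg j x *v w L k)) + (if j = k then w L j \<bullet> (g x *v w L j) else 0)"
        by (simp only: pd_mult[OF d pd_bilinear(2)[OF g_differentiable[OF xD]]]
            pd_bilinear(1)[OF g_differentiable[OF xD]]) simp
    qed
    finally show ?thesis .
  qed
  have "(\<Sum>j\<in>UNIV. pd j (F j) x) = (\<Sum>L\<in>\<I>. \<Sum>j\<in>UNIV. \<Sum>k\<in>UNIV. ?y k * (w L j \<bullet> (dg j x *v w L k))
      + (if j = k then w L j \<bullet> (g x *v w L j) else 0))"
    unfolding pdF by (rule sum.swap)
  also have "\<dots> = (\<Sum>L\<in>\<I>. \<Sum>j\<in>UNIV. \<Sum>k\<in>UNIV. ?y k * (w L j \<bullet> (dg j x *v w L k)))
      + (\<Sum>L\<in>\<I>. \<Sum>j\<in>UNIV. w L j \<bullet> (g x *v w L j))"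
    by (simp add: sum.distrib)
  also have "(\<Sum>L\<in>\<I>. \<Sum>j\<in>UNIV. w L j \<bullet> (g x *v w L j)) = q * N x"
    using sum_ctr_inner_g[OF q, of \<xi> "g x"] germ[OF x] by (simp add: N_def)
  also have "(\<Sum>L\<in>\<I>. \<Sum>j\<in>UNIV. \<Sum>k\<in>UNIV. ?y k * (w L j \<bullet> (dg j x *v w L k))) = PS x"
  proof -
    have "(\<Sum>j\<in>UNIV. \<Sum>k\<in>UNIV. ?y k * (w L j \<bullet> (dg j x *v w L k))) = P L x \<bullet> S L x" for L
    proof -
      \<comment> \<open>The derivative of a symmetric matrix function is symmetric, so the two
        contractions may be exchanged; this matches the derivative of the metric in div F with
        \<open>S\<close>.\<close>
      have dgw: "w L j \<bullet> (dg j x *v w L k) = w L k \<bullet> (dg j x *v w L j)" for j k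
        by (subst inner_symmetric_matrix[OF dg_sym[OF xD]]) (rule inner_commute)
      have "(\<Sum>j\<in>UNIV. \<Sum>k\<in>UNIV. ?y k * (w L j \<bullet> (dg j x *v w L k)))
          = (\<Sum>j\<in>UNIV. \<Sum>k\<in>UNIV. ?y k * (w L k \<bullet> (dg j x *v w L j)))"
        by (intro sum.cong refl) (rule arg_cong[OF dgw])
      then show ?thesis
        unfolding P_inner W_germ[OF x] S_germ[OF x] inner_sum_right sum_distrib_left .
    qed
    then show ?thesis by (simp only: PS_def)
  qed
  finally show ?thesis by (simp add: Z_def)
qed

text \<open>Lowering the fibre index of - d_i (g^(-1) d_j g) by g gives (d_i g) g^(-1) (d_j g) - d_i
  d_j g. Summed over the contractions of \<xi>, the first part is \<open>SBS\<close> and the second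
  is the divergence of \<open>M\<close>, with the derivatives in the same order.\<close>

lemma T_germ: "T x\<^sub>0 = inner_g q (g x\<^sub>0) (form_op (curv_coef g x\<^sub>0) q \<xi>) \<xi>"
proof -
  have x0: "x\<^sub>0 \<in> ball x\<^sub>0 a" and xD: "x\<^sub>0 \<in> D" using a by auto
  let ?g = "g x\<^sub>0" and ?B = "B x\<^sub>0" and ?dg = "\<lambda>j. dg j x\<^sub>0" and ?ddg = "\<lambda>i j. ddg i j x\<^sub>0"
  have pdM: "pd j (M j) x\<^sub>0 = (\<Sum>L\<in>\<I>. \<Sum>k\<in>UNIV. w L j \<bullet> (?ddg j k *v w L k))" for j
  proof -
    have "M j y = (\<Sum>L\<in>\<I>. \<Sum>k\<in>UNIV. w L j \<bullet> (dg k y *v w L k))" if "y \<in> ball x\<^sub>0 a" for y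
      unfolding M_def W_germ[OF that] S_germ[OF that] by (simp add: inner_sum_right)
    then have "pd j (M j) x\<^sub>0 = pd j (\<lambda>y. \<Sum>L\<in>\<I>. \<Sum>k\<in>UNIV. w L j \<bullet> (dg k y *v w L k)) x\<^sub>0"
      by (rule pd_cong_open[OF open_ball x0])
    also have "\<dots> = (\<Sum>L\<in>\<I>. \<Sum>k\<in>UNIV. pd j (\<lambda>y. w L j \<bullet> (dg k y *v w L k)) x\<^sub>0)"
      by (rule pd_sum_sum[OF finite]) (rule pd_bilinear(2)[OF dg_differentiable[OF xD]])
    finally show ?thesis by (simp only: pd_bilinear(1)[OF dg_differentiable[OF xD]])
  qed
  \<comment> \<open>Differentiate the identity g B = 1, valid on the open set
    \<open>D\<close>.\<close>
  have dB: "?g ** pd_matrix i B x\<^sub>0 = - (?dg i ** ?B)" for i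
  proof -
    have "pd_matrix i (\<lambda>y. g y ** B y) x\<^sub>0 = pd_matrix i (\<lambda>y. mat 1) x\<^sub>0"
    proof -
      have "g y ** B y = mat 1" if "y \<in> D" for y
        unfolding B_def by (rule matrix_inv_mult(1)[OF metric_invertible[OF g that]])
      then have "pd i (\<lambda>y. (g y ** B y) $ b $ c) x\<^sub>0 = pd i (\<lambda>y. mat 1 $ b $ c) x\<^sub>0" for b c
        by (intro pd_cong_open[OF open_D xD]) simp
      then show ?thesis by (simp add: pd_matrix_def)
    qed
    also have "\<dots> = 0" by (simp add: pd_matrix_def vec_eq_iff)
    finally show ?thesis
      using pd_matrix_mult[OF g_differentiable[OF xD] B_differentiable[OF xD], of i]
      by (simp add: eq_neg_iff_add_eq_0)
  qed
  have C: "(\<chi> \<tau> \<eta>. curv_coef g x\<^sub>0 i j \<tau> \<eta>) = - (?B ** ?ddg i j + pd_matrix i B x\<^sub>0 ** ?dg j)" for i j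
  proof -
    have "(\<chi> \<tau> \<eta>. curv_coef g x\<^sub>0 i j \<tau> \<eta>) = - pd_matrix i (\<lambda>y. B y ** dg j y) x\<^sub>0"
      by (simp add: curv_coef_def pd_matrix_def B_def vec_eq_iff)
    then show ?thesis
      by (simp only: pd_matrix_mult[OF B_differentiable[OF xD] dg_differentiable[OF xD]])
  qed
  have gB: "?g ** ?B = mat 1"
    unfolding B_def by (rule matrix_inv_mult(1)[OF metric_invertible[OF g xD]])
  have summand: "((\<chi> \<tau> \<eta>. curv_coef g x\<^sub>0 i j \<tau> \<eta>) *v v) \<bullet> (?g *v v')
      = (?dg i *v v') \<bullet> (?B *v (?dg j *v v)) - v' \<bullet> (?ddg i j *v v)" for i j v v'
  proof -
    have "?g ** (\<chi> \<tau> \<eta>. curv_coef g x\<^sub>0 i j \<tau> \<eta>) = - (?ddg i j) + ?dg i ** ?B ** ?dg j"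
      unfolding C matrix_minus_right matrix_add_ldistrib matrix_mul_assoc gB dB matrix_minus_left matrix_mul_lid
      by simp
    then have "?g *v ((\<chi> \<tau> \<eta>. curv_coef g x\<^sub>0 i j \<tau> \<eta>) *v v) = - (?ddg i j *v v) + ?dg i *v (?B *v (?dg j *v v))"
      by (simp only: matrix_vector_mul_assoc matrix_mul_assoc matrix_vector_mult_add_rdistrib matrix_vector_minus_left)
    moreover have "((\<chi> \<tau> \<eta>. curv_coef g x\<^sub>0 i j \<tau> \<eta>) *v v) \<bullet> (?g *v v')
        = (?g *v ((\<chi> \<tau> \<eta>. curv_coef g x\<^sub>0 i j \<tau> \<eta>) *v v)) \<bullet> v'"
      by (rule inner_symmetric_matrix[OF g_sym[OF xD]])
    moreover have "(?dg i *v (?B *v (?dg j *v v))) \<bullet> v' = (?dg i *v v') \<bullet> (?B *v (?dg j *v v))"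
      using inner_symmetric_matrix[OF dg_sym[OF xD], of "?B *v (?dg j *v v)" i v'] by (simp only: inner_commute)
    ultimately show ?thesis by (simp add: inner_diff_right inner_commute)
  qed
  have "inner_g q ?g (form_op (curv_coef g x\<^sub>0) q \<xi>) \<xi> = (\<Sum>L\<in>\<I>. \<Sum>i\<in>UNIV. \<Sum>j\<in>UNIV.
      (?dg i *v w L i) \<bullet> (?B *v (?dg j *v w L j)) - w L i \<bullet> (?ddg i j *v w L j))"
    unfolding inner_form_op[OF q] summand ..
  also have "\<dots> = (\<Sum>L\<in>\<I>. \<Sum>i\<in>UNIV. \<Sum>j\<in>UNIV. (?dg i *v w L i) \<bullet> (?B *v (?dg j *v w L j)))
      - (\<Sum>L\<in>\<I>. \<Sum>i\<in>UNIV. \<Sum>j\<in>UNIV. w L i \<bullet> (?ddg i j *v w L j))"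
    by (simp only: sum_subtractf)
  also have "(\<Sum>L\<in>\<I>. \<Sum>i\<in>UNIV. \<Sum>j\<in>UNIV. (?dg i *v w L i) \<bullet> (?B *v (?dg j *v w L j))) = SBS x\<^sub>0"
    unfolding SBS_def S_germ[OF x0]
    by (simp add: inner_sum_left inner_sum_right linear_sum[OF matrix_vector_mul_linear] o_def)
      (intro sum.cong refl sum.swap)
  also have "(\<Sum>L\<in>\<I>. \<Sum>i\<in>UNIV. \<Sum>j\<in>UNIV. w L i \<bullet> (?ddg i j *v w L j)) = (\<Sum>j\<in>UNIV. pd j (M j) x\<^sub>0)"
    unfolding pdM by (rule sum.swap)
  finally show ?thesis by (simp add: T_def)
qed

end

theorem theorem1p1:
  fixes D :: "(real^('n::{finite,linorder})) set"
    and g :: "real^('n::{finite,linorder}) \<Rightarrow> real^'r::finite^'r"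
    and q :: nat
  assumes "open D" and "connected D"
    and "riemannian_metric_C2 D g"
    and "1 \<le> q" and "q \<le> CARD('n)"
    and "\<forall>\<psi> (f :: real^('n::{finite,linorder}) \<Rightarrow> 'n set \<Rightarrow> 'r \<Rightarrow> real).
           smooth_on UNIV \<psi> \<and> strictly_convex \<psi> \<and> pos_def_hessian \<psi> \<and>
           closed_test_form D q f \<and>
           (\<integral>\<^sup>+x\<in>D. ennreal (inner_g q (g x) (hess_inv \<psi> q x (f x)) (f x) * exp (- \<psi> x)) \<partial>lborel) < \<infinity>
           \<longrightarrow> (\<exists>u. L2_forms D g (q - 1) u \<and> weak_d_eq D q u f \<and>
                (\<integral>\<^sup>+x\<in>D. ennreal (inner_g (q - 1) (g x) (u x) (u x) * exp (- \<psi> x)) \<partial>lborel)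
                \<le> (\<integral>\<^sup>+x\<in>D. ennreal (inner_g q (g x) (hess_inv \<psi> q x (f x)) (f x) * exp (- \<psi> x)) \<partial>lborel))"
  shows "nakano_q_semipositive D g q"
  unfolding nakano_q_semipositive_def
proof (intro ballI allI impI)
  fix x\<^sub>0 and \<xi> :: "'n set \<Rightarrow> 'r \<Rightarrow> real"
  assume x0: "x\<^sub>0 \<in> D" and \<xi>: "is_form q \<xi>"
  obtain R where R: "R > 0" "cball x\<^sub>0 R \<subseteq> D"
    using \<open>open D\<close> x0 open_contains_cball by blast
  obtain f where f: "closed_test_form D q f" "\<And>x. x \<in> ball x\<^sub>0 (R / 2) \<Longrightarrow> f x = \<xi>"
    "\<And>x I \<tau>. x \<notin> cball x\<^sub>0 R \<Longrightarrow> f x I \<tau> = 0"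
    using closed_form_with_constant_germ[OF assms(4) \<xi> R] by blast
  interpret constant_germ D g q f x\<^sub>0 "cball x\<^sub>0 R" \<xi> "R / 2"
  proof
    show "ball x\<^sub>0 (R / 2) \<subseteq> D" using R by (auto simp: subset_iff)
  qed (use assms(1,3,4) f R in \<open>auto simp: closed_test_form_def\<close>)
  have "0 \<le> T x\<^sub>0"
  proof (rule gaussian_concentration[OF continuous_T supp_T continuous_Z supp_Z Z_germ compact_cball a(1)])
    fix s :: real assume s: "s > 0"
    \<comment> \<open>The form \<open>f\<close>, and with it \<open>T\<close> and \<open>Z\<close>,
      is fixed before s is chosen; only the weight and the solution u depend on s.\<close>
    interpret weighted_test_form D g q f x\<^sub>0 "cball x\<^sub>0 R" s
      using s by unfold_locales
    have "smooth_on UNIV \<psi>" "strictly_convex \<psi>" "pos_def_hessian \<psi>"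
      unfolding \<psi>_eq using quadratic_weight_admissible[OF s] by blast+
    moreover have "(\<integral>\<^sup>+x\<in>D. ennreal (inner_g q (g x) (hess_inv \<psi> q x (f x)) (f x) * exp (- \<psi> x)) \<partial>lborel) < \<infinity>"
      unfolding hess_inv_energy by simp
    ultimately obtain u where "L2_forms D g (q - 1) u" "weak_d_eq D q u f"
      "(\<integral>\<^sup>+x\<in>D. ennreal (inner_g (q - 1) (g x) (u x) (u x) * exp (- \<psi> x)) \<partial>lborel)
        \<le> (\<integral>\<^sup>+x\<in>D. ennreal (inner_g q (g x) (hess_inv \<psi> q x (f x)) (f x) * exp (- \<psi> x)) \<partial>lborel)"
      using assms(6) f(1) by blast
    from gaussian_inequality[OF this]
    show "0 \<le> (LINT x|lborel. exp (- (s * ((x - x\<^sub>0) \<bullet> (x - x\<^sub>0)))) * (2 * s * Z x + T x))"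
      by (simp only: e_def \<psi>_def)
  qed
  then show "0 \<le> inner_g q (g x\<^sub>0) (form_op (curv_coef g x\<^sub>0) q \<xi>) \<xi>"
    by (simp only: T_germ)
qed

end
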